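(* Let $d\ge1$, let $\nu$ be a probability measure on $\mathbb{R}_+$ with $\nu((0,\infty))>0$, and let $\eta$ be a Poisson process on $\mathbb{R}^d\times\mathbb{R}_+$ with intensity $\ell\otimes\nu$, where $\ell$ is Lebesgue measure; write its points as $(x_i,R_i)$. For $\lambda>0$ let $X_\lambda=[-\lambda^{1/d},\lambda^{1/d}]^d$, and for $k\ge2$ let $N_{k,\lambda}$ be the number of sets $\{x_1,\dots,x_k\}\subset X_\lambda$ of $k$ distinct (spatial) points of $\eta$, with associated radii $R_1,\dots,R_k$, such that $\|x_i-x_j\|_{\mathbb{R}^d}\le R_i$ for all $i,j=1,\dots,k$. Let $F(r)=\nu((r,\infty))$, $r\ge 0$. If for some $\varepsilon>0$ $$\int_{\mathbb{R}_+}F(r)\,r^{4d-1+\varepsilon}\,dr<\infty,$$ then for every $k\ge2$ there exist constants $c_k,C_k>0$ independent of $\lambda$ such that, as $\lambda\to\infty$, $$\mathrm{Var}(N_{k,\lambda})\sim c_k\lambda,\qquad d_W(\tilde N_{k,\lambda},N)\le C_k\lambda^{-1/2},$$ where $\tilde N_{k,\lambda}=(N_{k,\lambda}-E[N_{k,\lambda}])/\sqrt{\mathrm{Var}(N_{k,\lambda})}$ and $N\sim\mathscr N(0,1)$.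
   Context: $a_\lambda\sim b_\lambda$ means $a_\lambda/b_\lambda\to1$. $d_W(F,N)=\sup_g|E[g(F)]-E[g(N)]|$ over functions $g:\mathbb{R}\to\mathbb{R}$ with Lipschitz constant at most $1$. *)

theory Defs
  imports "HOL-Probability.Probability" "HOL-Library.Landau_Symbols"
begin

(* A proper point process on the measurable space of S: the random counting measure
   eta = delta_(Z 0) + delta_(Z 1) + ... of finitely or countably many (kap) measurable random
   points.  Points may coincide; multiplicities are counted. *)

definition point_process ::
    "'w measure \<Rightarrow> 'a measure \<Rightarrow> ('w \<Rightarrow> 'a measure) \<Rightarrow> bool" where
  "point_process M S \<eta> \<longleftrightarrow>
     (\<exists>(\<kappa> :: 'w \<Rightarrow> enat) (Z :: nat \<Rightarrow> 'w \<Rightarrow> 'a).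
        \<kappa> \<in> measurable M (count_space UNIV) \<and> (\<forall>n. Z n \<in> measurable M S) \<and>
        (\<forall>\<omega>\<in>space M. sets (\<eta> \<omega>) = sets S \<and>
           (\<forall>B\<in>sets S. emeasure (\<eta> \<omega>) B =
              emeasure (count_space UNIV) {n. enat n < \<kappa> \<omega> \<and> Z n \<omega> \<in> B})))"

(* In poisson_count the value 0 ^ 0 = 1 makes the law the point mass at 0 if mu B = 0. *)

locale poisson_process = prob_space M
  for M :: "'w measure" and \<mu> :: "'a measure" and \<eta> :: "'w \<Rightarrow> 'a measure" +
  assumes point_process: "point_process M \<mu> \<eta>"
    and poisson_count: "\<And>B n. B \<in> sets \<mu> \<Longrightarrow> emeasure \<mu> B < \<infinity> \<Longrightarrow>
          prob {\<omega> \<in> space M. emeasure (\<eta> \<omega>) B = of_nat n} =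
            measure \<mu> B ^ n / fact n * exp (- measure \<mu> B)"
    and infinite_count: "\<And>B. B \<in> sets \<mu> \<Longrightarrow> emeasure \<mu> B = \<infinity> \<Longrightarrow>
          AE \<omega> in M. emeasure (\<eta> \<omega>) B = \<infinity>"
    and indep_counts: "\<And>(B :: nat \<Rightarrow> 'a set) m.
          (\<And>i. i < m \<Longrightarrow> B i \<in> sets \<mu>) \<Longrightarrow> disjoint_family_on B {..<m} \<Longrightarrow>
          indep_vars (\<lambda>_. borel) (\<lambda>i \<omega>. emeasure (\<eta> \<omega>) (B i)) {..<m}"

definition points :: "'a measure \<Rightarrow> 'a set" where
  "points m = {z. emeasure m {z} > 0}"

definition window :: "real \<Rightarrow> (real ^ 'n) set" where
  "window t = {x. \<forall>i. x $ i \<in> {- (t powr (1 / real CARD('n))) .. t powr (1 / real CARD('n))}}"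

(* The number of k-sets A of spatial points in the window; R x is the radius attached to x.
   If eta is a Poisson process with intensity lborel x nu, then almost surely R x is unique and
   the family of sets is finite, so that the conventions made by the existential quantifier and
   by card for infinite sets matter only on a null set. *)

definition num_cliques :: "nat \<Rightarrow> real \<Rightarrow> ((real ^ 'n) \<times> real) measure \<Rightarrow> nat" where
  "num_cliques k t m =
     card {A. A \<subseteq> window t \<and> finite A \<and> card A = k \<and>
              (\<exists>R. (\<forall>x\<in>A. (x, R x) \<in> points m) \<and> (\<forall>x\<in>A. \<forall>y\<in>A. norm (x - y) \<le> R x))}"

definition expct :: "'w measure \<Rightarrow> ('w \<Rightarrow> real) \<Rightarrow> real" where
  "expct M X = (\<integral>\<omega>. X \<omega> \<partial>M)"

definition var :: "'w measure \<Rightarrow> ('w \<Rightarrow> real) \<Rightarrow> real" where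
  "var M X = expct M (\<lambda>\<omega>. (X \<omega> - expct M X)\<^sup>2)"

definition standardize :: "'w measure \<Rightarrow> ('w \<Rightarrow> real) \<Rightarrow> 'w \<Rightarrow> real" where
  "standardize M X \<omega> = (X \<omega> - expct M X) / sqrt (var M X)"

(* The Wasserstein distance in terms of the laws P and Q, which are meant to have finite first
   moments: otherwise the Bochner integrals default to 0. *)

definition wasserstein :: "real measure \<Rightarrow> real measure \<Rightarrow> ennreal" where
  "wasserstein P Q =
     (SUP g \<in> {g :: real \<Rightarrow> real. 1-lipschitz_on UNIV g}.
        ennreal \<bar>(\<integral>x. g x \<partial>P) - (\<integral>x. g x \<partial>Q)\<bar>)"

end

theory Submission
  imports Defs "HOL-Real_Asymp.Real_Asymp"
begin

text \<open>Discretise window and radii into small cells. The occupied cells form independent Bernoulli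
  sites with small probabilities \<open>p\<close>, and the clique count becomes the number of \<open>k\<close>-cliques of a
  finite graph all of whose vertices are occupied. In this graph the total weight \<open>p\<close> of the
  neighbours of a site is bounded uniformly in the mesh and in \<open>\<lambda>\<close>, because \<open>\<integral> r\<^sup>d d\<nu> < \<infinity>\<close>: a
  neighbour \<open>y\<close> of \<open>x\<close> needs a radius of at least \<open>\<parallel>x - y\<parallel>\<close>. Hence sums over chains of intersecting
  cliques are of order \<open>\<lambda>\<close>.

  Occupying a clique \<open>A\<close> by force realises the size bias of the count, so Stein's equation bounds the
  Wasserstein distance by \<open>O(\<lambda> / \<sigma>\<^sup>3 + sqrt \<lambda> / \<sigma>\<^sup>2)\<close> with chain sums as constants. The clique counts of the
  discretisations are eventually equal to the original count and dominated by \<open>2\<close> to the number of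
  points, so all estimates survive the limit.

  Occupations are positively correlated; therefore the variance is superadditive over disjoint
  translates of a window, and Fekete's argument gives \<open>Var \<sim> c \<lambda>\<close>, where \<open>c\<close> is a supremum and hence
  positive.\<close>

section \<open>Solutions of the Stein equation\<close>

text \<open>The radii are unbounded, so there is no finite range of dependence in space. Dependence
  is therefore measured by shared vertices: in the finite model two cliques without a common site
  are independent, however close they are, and every covariance is carried by intersecting cliques.
  The normal approximation then uses of the geometry only a degree bound.

  The finite model also replaces the Mecke formula: given that all sites of \<open>A\<close> are
  occupied, the occupied set is distributed as \<open>S \<union> A\<close>. Stein's method thus
  becomes algebra of finite sums, and integrals enter only in the passage to the limit.

  The mesh is \<open>L / q\<close> with a free parameter \<open>L\<close>, on which the limit does
  not depend. Taking for \<open>L\<close> the side length of a small window puts its translates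
  exactly on the grid of a large one, so that the covariance sums of both can be compared term by
  term.\<close>

lemma lipschitz_smoothing:
  fixes g :: "real \<Rightarrow> real"
  assumes g: "1-lipschitz_on UNIV g" and e: "e > 0"
  obtains h h' where "\<And>x. (h has_real_derivative h' x) (at x)" "\<And>x. \<bar>h' x\<bar> \<le> 1" "\<And>x. \<bar>h x - g x\<bar> \<le> e"
proof -
  have cont: "isCont g x" for x
    using lipschitz_on_continuous_on[OF g] by (simp add: continuous_on_eq_continuous_at)
  have "\<exists>G. \<forall>x :: real. - \<infinity> < ereal x \<longrightarrow> ereal x < \<infinity> \<longrightarrow> (G has_vector_derivative g x) (at x)"
    by (rule einterval_antiderivative) (auto simp: cont)
  then obtain G where G: "(G has_real_derivative g x) (at x)" for x
    by (auto simp: has_real_derivative_iff_has_vector_derivative)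
  have lip: "\<bar>g x - g y\<bar> \<le> \<bar>x - y\<bar>" for x y
    using lipschitz_onD[OF g, of x y] by (simp add: dist_real_def)
  \<comment> \<open>\<open>h x\<close> is the mean of \<open>g\<close> over
    \<open>[x, x + e]\<close>. Its derivative is a difference quotient of \<open>g\<close>, hence at
    most 1 in modulus, and by the mean value theorem \<open>h x\<close> is a value of
    \<open>g\<close> at a point closer than \<open>e\<close> to \<open>x\<close>.\<close>
  show ?thesis
  proof (rule that[of "\<lambda>x. (G (x + e) - G x) / e" "\<lambda>x. (g (x + e) - g x) / e"])
    fix x
    have "((\<lambda>x. G (x + e)) has_real_derivative g (x + e)) (at x)"
      using G[of "x + e"] by (simp add: DERIV_shift)
    then show "((\<lambda>x. (G (x + e) - G x) / e) has_real_derivative (g (x + e) - g x) / e) (at x)"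
      using G[of x] e by (auto intro!: derivative_eq_intros)
    show "\<bar>(g (x + e) - g x) / e\<bar> \<le> 1"
      using lip[of "x + e" x] e by (simp add: abs_div)
    obtain z where z: "z > x" "z < x + e" "G (x + e) - G x = e * g z"
      using MVT2[of x "x + e" G g] G e by auto
    then have "(G (x + e) - G x) / e = g z" using e by simp
    then show "\<bar>(G (x + e) - G x) / e - g x\<bar> \<le> e"
      using lip[of z x] z by simp
  qed
qed

text \<open>A maximum principle: \<open>(v - B) exp (-x\<^sup>2 / 2)\<close> is nondecreasing on \<open>[a, \<infinity>)\<close> and tends to \<open>0\<close>.\<close>

lemma gaussian_ode_bound_aux:
  fixes v q :: "real \<Rightarrow> real"
  assumes v: "\<And>x. (v has_real_derivative x * v x + q x) (at x)"
    and q: "\<And>x. x \<ge> a \<Longrightarrow> - (B * x) \<le> q x"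
    and lim: "((\<lambda>x. v x * exp (- (x\<^sup>2) / 2)) \<longlongrightarrow> 0) at_top"
  shows "v a \<le> B"
proof -
  define \<psi> where "\<psi> x = (v x - B) * exp (- (x\<^sup>2) / 2)" for x
  have d: "(\<psi> has_real_derivative (q x + B * x) * exp (- (x\<^sup>2) / 2)) (at x)" for x
    unfolding \<psi>_def using v[of x]
    by (auto intro!: derivative_eq_intros simp: field_simps)
  have mono: "\<psi> x \<le> \<psi> y" if "a \<le> x" "x \<le> y" for x y
  proof (rule DERIV_nonneg_imp_nondecreasing[OF that(2)])
    fix z assume "x \<le> z" "z \<le> y"
    then have "0 \<le> (q z + B * z) * exp (- (z\<^sup>2) / 2)"
      using q[of z] that by auto
    with d show "\<exists>y. (\<psi> has_real_derivative y) (at z) \<and> 0 \<le> y" by blast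
  qed
  have "((\<lambda>x::real. B * exp (- (x\<^sup>2) / 2)) \<longlongrightarrow> 0) at_top"
    by real_asymp
  from tendsto_diff[OF lim this] have "(\<psi> \<longlongrightarrow> 0) at_top"
    unfolding \<psi>_def by (simp add: algebra_simps)
  then have "\<psi> a \<le> 0"
    by (rule tendsto_lowerbound) (auto intro!: eventually_at_top_linorderI[of a] mono)
  then show ?thesis unfolding \<psi>_def by (simp add: mult_le_0_iff)
qed

lemma gaussian_ode_bound_right:
  fixes v q :: "real \<Rightarrow> real"
  assumes v: "\<And>x. (v has_real_derivative x * v x + q x) (at x)"
    and q: "\<And>x. x \<ge> a \<Longrightarrow> \<bar>q x\<bar> \<le> B * x"
    and lim: "((\<lambda>x. v x * exp (- (x\<^sup>2) / 2)) \<longlongrightarrow> 0) at_top"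
  shows "\<bar>v a\<bar> \<le> B"
proof -
  have "v a \<le> B"
  proof (rule gaussian_ode_bound_aux[where v = v and q = q and a = a])
    show "- (B * x) \<le> q x" if "x \<ge> a" for x
      using q[OF that] by linarith
  qed (use v lim in auto)
  moreover have "- v a \<le> B"
  proof (rule gaussian_ode_bound_aux[where v = "\<lambda>x. - v x" and q = "\<lambda>x. - q x" and a = a])
    show "((\<lambda>x. - v x) has_real_derivative x * - v x + - q x) (at x)" for x
      using v[of x] by (auto intro!: derivative_eq_intros)
    show "((\<lambda>x. - v x * exp (- (x\<^sup>2) / 2)) \<longlongrightarrow> 0) at_top"
      using tendsto_minus[OF lim] by simp
    show "- (B * x) \<le> - q x" if "x \<ge> a" for x
      using q[OF that] by linarith
  qed
  ultimately show ?thesis by (simp add: abs_le_iff)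
qed

text \<open>Reflection at 0 preserves the form of the equation and turns the forcing term into
  \<open>- q (- x)\<close>, which exchanges the two ends of the line.\<close>

lemma gaussian_ode_bound_left:
  fixes v q :: "real \<Rightarrow> real"
  assumes v: "\<And>x. (v has_real_derivative x * v x + q x) (at x)"
    and q: "\<And>x. x \<ge> a \<Longrightarrow> \<bar>q (- x)\<bar> \<le> B * x"
    and lim: "((\<lambda>x. v x * exp (- (x\<^sup>2) / 2)) \<longlongrightarrow> 0) at_bot"
  shows "\<bar>v (- a)\<bar> \<le> B"
proof -
  have "((\<lambda>x. v (- x)) has_real_derivative x * v (- x) + - q (- x)) (at x)" for x
    using DERIV_chain2[where f = v and g = uminus and x = x and s = UNIV and Db = "-1", OF v[of "- x"]]
    by (simp add: DERIV_minus[OF DERIV_ident])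
  from gaussian_ode_bound_right[where q = "\<lambda>x. - q (- x)", OF this, of a B] show ?thesis
    using q lim by (simp add: filterlim_at_bot_mirror)
qed

text \<open>Normalising the antiderivative to vanish at the left end makes the total integral its
  limit at the right end. For a centred integrand both limits are 0, which is the boundary condition
  of the maximum principle at either end.\<close>

lemma antiderivative_limits:
  fixes f :: "real \<Rightarrow> real"
  assumes cont: "\<And>x. isCont f x" and int: "integrable lborel f"
  obtains F where "\<And>x. (F has_real_derivative f x) (at x)"
    "(F \<longlongrightarrow> 0) at_bot" "(F \<longlongrightarrow> (\<integral>x. f x \<partial>lborel)) at_top"
proof -
  have "\<exists>G. \<forall>x :: real. - \<infinity> < ereal x \<longrightarrow> ereal x < \<infinity> \<longrightarrow> (G has_vector_derivative f x) (at x)"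
    by (rule einterval_antiderivative) (auto simp: cont)
  then obtain G where G: "(G has_vector_derivative f x) (at x)" for x
    by auto
  have si: "set_integrable lborel S f" if "S \<in> sets borel" for S
    unfolding set_integrable_def using int that by (intro integrable_mult_indicator) auto
  have FTC: "(LINT t:{a..b}|lborel. f t) = G b - G a" if "a \<le> b" for a b
    unfolding set_lebesgue_integral_def
    using that G cont
    by (intro integral_FTC_atLeastAtMost) (auto intro: has_vector_derivative_at_within continuous_at_imp_continuous_on)
  have top: "((\<lambda>x. G x - G 0) \<longlongrightarrow> (LINT t:{0..}|lborel. f t)) at_top"
    by (rule Lim_transform_eventually[OF tendsto_set_lebesgue_integral_at_top[OF _ si]])
       (auto intro!: eventually_at_top_linorderI[of 0] FTC)
  have bot: "((\<lambda>x. G 0 - G x) \<longlongrightarrow> (LINT t:{..0}|lborel. f t)) at_bot"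
    by (rule Lim_transform_eventually[OF tendsto_set_lebesgue_integral_at_bot[OF _ si]])
       (auto intro!: eventually_at_bot_linorderI[of 0] FTC)
  have "(LINT t:{..0} \<union> {0..}|lborel. f t) = (LINT t:{..0}|lborel. f t) + (LINT t:{0..}|lborel. f t)"
  proof (rule set_integral_Un_AE)
    show "AE x in lborel. \<not> (x \<in> {..0::real} \<and> x \<in> {0..})"
      using AE_lborel_singleton[of 0] by eventually_elim auto
  qed (auto simp: si)
  also have "{..0::real} \<union> {0..} = UNIV" by auto
  finally have tot: "(\<integral>x. f x \<partial>lborel) = (LINT t:{..0}|lborel. f t) + (LINT t:{0..}|lborel. f t)"
    by (simp add: set_lebesgue_integral_def)
  show ?thesis
  proof (rule that[of "\<lambda>x. G x - G 0 + (LINT t:{..0}|lborel. f t)"])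
    show "((\<lambda>x. G x - G 0 + (LINT t:{..0}|lborel. f t)) has_real_derivative f x) (at x)" for x
      using G[of x] unfolding has_real_derivative_iff_has_vector_derivative[symmetric]
      by (auto intro!: derivative_eq_intros)
    show "((\<lambda>x. G x - G 0 + (LINT t:{..0}|lborel. f t)) \<longlongrightarrow> 0) at_bot"
      using tendsto_diff[OF tendsto_const[of "LINT t:{..0}|lborel. f t"] bot] by (simp add: algebra_simps)
    show "((\<lambda>x. G x - G 0 + (LINT t:{..0}|lborel. f t)) \<longlongrightarrow> (\<integral>x. f x \<partial>lborel)) at_top"
      using tendsto_add[OF top tendsto_const[of "LINT t:{..0}|lborel. f t"]] tot by (simp add: algebra_simps)
  qed
qed

lemma std_normal_lipschitz_integrable:
  fixes h :: "real \<Rightarrow> real"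
  assumes h: "\<And>x. (h has_real_derivative h' x) (at x)" and h': "\<And>x. \<bar>h' x\<bar> \<le> 1"
  shows "integrable lborel (\<lambda>x. std_normal_density x * h x)"
    and "integral\<^sup>L std_normal_distribution h = (\<integral>x. std_normal_density x * h x \<partial>lborel)"
    and "\<bar>h x - integral\<^sup>L std_normal_distribution h\<bar> \<le> \<bar>x\<bar> + 1"
proof -
  have cont: "isCont h x" for x using h DERIV_isCont by blast
  have [measurable]: "h \<in> borel_measurable borel"
    by (intro borel_measurable_continuous_onI) (simp add: continuous_at_imp_continuous_on cont)
  have lip: "\<bar>h x - h y\<bar> \<le> \<bar>x - y\<bar>" for x y
    using field_differentiable_bound[of UNIV h h' 1 x y] h h' by (auto simp: norm_mult)
  note I0 = integrable_std_normal_moment_abs[of 0, simplified]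
  note I1 = integrable_std_normal_moment_abs[of 1, simplified]
  show int: "integrable lborel (\<lambda>x. std_normal_density x * h x)"
  proof (rule Bochner_Integration.integrable_bound)
    show "integrable lborel (\<lambda>x. \<bar>h 0\<bar> * std_normal_density x + std_normal_density x * \<bar>x\<bar>)"
      using I0 I1 by auto
    have "std_normal_density x * \<bar>h x\<bar> \<le> std_normal_density x * (\<bar>h 0\<bar> + \<bar>x\<bar>)" for x
      using lip[of x 0] by (intro mult_left_mono) auto
    then show "AE x in lborel. norm (std_normal_density x * h x)
        \<le> norm (\<bar>h 0\<bar> * std_normal_density x + std_normal_density x * \<bar>x\<bar>)"
      by (auto simp: abs_mult algebra_simps)
  qed simp
  show eq: "integral\<^sup>L std_normal_distribution h = (\<integral>x. std_normal_density x * h x \<partial>lborel)"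
    by (subst integral_density) auto
  have 1: "(\<integral>x. std_normal_density x \<partial>lborel) = 1"
    using integral_std_normal_moment_even[of 0] by simp
  have 2: "(\<integral>x. std_normal_density x * x\<^sup>2 \<partial>lborel) = 1"
    using integral_std_normal_moment_even[of 1] by (simp add: fact_numeral)
  have "h 0 - integral\<^sup>L std_normal_distribution h = (\<integral>x. std_normal_density x * h 0 - std_normal_density x * h x \<partial>lborel)"
    unfolding eq using int I0 1 by simp
  \<comment> \<open>The inequality \<open>|x| <= (1 + x^2) / 2\<close> replaces the first absolute
    moment by even moments and makes the constant exactly 1.\<close>
  also have "\<bar>\<dots>\<bar> \<le> (\<integral>x. std_normal_density x * ((1 + x^2) / 2) \<partial>lborel)"
  proof (rule integral_abs_bound[THEN order_trans], rule integral_mono)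
    show "integrable lborel (\<lambda>x. std_normal_density x * ((1 + x\<^sup>2) / 2))"
      using I0 integrable_std_normal_moment[of 2] by (auto simp: algebra_simps add_divide_distrib)
    fix x :: real
    have "0 \<le> (\<bar>x\<bar> - 1)^2" by simp
    then have "\<bar>x\<bar> \<le> (1 + x\<^sup>2) / 2" by (simp add: power2_eq_square algebra_simps)
    then have "\<bar>h 0 - h x\<bar> \<le> (1 + x\<^sup>2) / 2" using lip[of 0 x] by simp
    then have "std_normal_density x * \<bar>h 0 - h x\<bar> \<le> std_normal_density x * ((1 + x\<^sup>2) / 2)"
      by (intro mult_left_mono) auto
    then show "\<bar>std_normal_density x * h 0 - std_normal_density x * h x\<bar> \<le> std_normal_density x * ((1 + x\<^sup>2) / 2)"
      by (simp add: abs_mult right_diff_distrib[symmetric])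
  qed (use int I0 in auto)
  also have "\<dots> = 1"
    using I0 1 integrable_std_normal_moment[of 2] 2
    by (simp add: algebra_simps add_divide_distrib)
  finally show "\<bar>h x - integral\<^sup>L std_normal_distribution h\<bar> \<le> \<bar>x\<bar> + 1"
    using lip[of x 0] by simp
qed

text \<open>The solution is \<open>exp (x^2 / 2)\<close> times the antiderivative of the centred
  test function weighted by \<open>exp (- x^2 / 2)\<close>. Its derivative \<open>u\<close> solves
  an equation of the same form with forcing term \<open>f + h'\<close>, so the maximum principle
  serves twice. The constant 27 is 14 + 13, where 14 bounds \<open>x * u x\<close> and 13 bounds
  \<open>f + h'\<close>; it is not optimised.\<close>

lemma stein_solution:
  fixes h :: "real \<Rightarrow> real"
  assumes h: "\<And>x. (h has_real_derivative h' x) (at x)" and h': "\<And>x. \<bar>h' x\<bar> \<le> 1"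
  obtains F F' where "\<And>x. (F has_real_derivative F' x) (at x)" "\<And>x. \<bar>F' x\<bar> \<le> 27"
    "\<And>x y. \<bar>F' x - F' y\<bar> \<le> 27 * \<bar>x - y\<bar>"
    "\<And>x. F' x - x * F x = h x - integral\<^sup>L std_normal_distribution h"
proof -
  define k where "k x = h x - integral\<^sup>L std_normal_distribution h" for x
  have k_le: "\<bar>k x\<bar> \<le> \<bar>x\<bar> + 1" for x
    unfolding k_def using std_normal_lipschitz_integrable(3)[OF h h'] by simp
  have dk: "(k has_real_derivative h' x) (at x)" for x
    unfolding k_def using h[of x] by (auto intro!: derivative_eq_intros)
  have 1: "(\<integral>x. std_normal_density x \<partial>lborel) = 1"
    using integral_std_normal_moment_even[of 0] by simp
  note I0 = integrable_std_normal_moment_abs[of 0, simplified]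
  note int = std_normal_lipschitz_integrable(1)[OF h h']
  have eq: "exp (- (x\<^sup>2) / 2) * k x = sqrt (2 * pi) * (std_normal_density x * k x)" for x
    by (simp add: std_normal_density_def)
  have intk: "integrable lborel (\<lambda>x. exp (- (x\<^sup>2) / 2) * k x)"
    unfolding eq using int I0 by (auto simp: k_def right_diff_distrib)
  have int0: "(\<integral>x. exp (- (x\<^sup>2) / 2) * k x \<partial>lborel) = 0"
    unfolding eq using int I0 1 std_normal_lipschitz_integrable(2)[OF h h']
    by (simp add: k_def right_diff_distrib)
  have contk: "isCont k x" for x using dk DERIV_isCont by blast
  have contexp: "isCont (\<lambda>x. exp (- (x\<^sup>2) / 2) * k x) x" for x
    using contk by (intro continuous_intros) auto
  obtain H where H: "\<And>x. (H has_real_derivative exp (- (x\<^sup>2) / 2) * k x) (at x)"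
    "(H \<longlongrightarrow> 0) at_bot" "(H \<longlongrightarrow> 0) at_top"
    using antiderivative_limits[OF _ intk] unfolding int0
    by (metis (no_types, lifting) contexp)
  define f where "f x = exp (x\<^sup>2 / 2) * H x" for x
  have df: "(f has_real_derivative x * f x + k x) (at x)" for x
    unfolding f_def using H(1)[of x]
    by (auto intro!: derivative_eq_intros simp: algebra_simps exp_minus field_simps)
  have fH: "f x * exp (- (x\<^sup>2) / 2) = H x" for x
    by (simp add: f_def exp_minus)
  \<comment> \<open>Outside \<open>[-1, 1]\<close> the bound \<open>|k y| <= |y| + 1\<close> is at
    most \<open>2 * |y|\<close>, so that the maximum principle applies with
    \<open>B = 2\<close>.\<close>
  have f_out: "\<bar>f x\<bar> \<le> 2" if "\<bar>x\<bar> \<ge> 1" for x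
  proof (cases "x \<ge> 0")
    case True
    have "\<bar>k y\<bar> \<le> 2 * y" if "y \<ge> x" for y using k_le[of y] that True \<open>\<bar>x\<bar> \<ge> 1\<close> by linarith
    with gaussian_ode_bound_right[OF df, of x 2] H show ?thesis unfolding fH by blast
  next
    case False
    have "\<bar>k (- y)\<bar> \<le> 2 * y" if "y \<ge> - x" for y using k_le[of "-y"] that False \<open>\<bar>x\<bar> \<ge> 1\<close> by linarith
    with gaussian_ode_bound_left[OF df, of "- x" 2] H show ?thesis unfolding fH minus_minus by blast
  qed
  \<comment> \<open>Near 0 the forcing term is not bounded by a multiple of \<open>x\<close>.
    Instead \<open>H\<close> is continued from 1 into the interval: its slope is at most 2 over a
    length of at most 2, so \<open>|H| <= 2 + 4\<close>, and the factor \<open>exp (x^2 / 2)\<close>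
    is at most 2.\<close>
  have f_in: "\<bar>f x\<bar> \<le> 12" if x: "\<bar>x\<bar> \<le> 1" for x
  proof -
    have H1: "\<bar>H 1\<bar> \<le> 2"
    proof -
      have "\<bar>H 1\<bar> = \<bar>f 1\<bar> * exp (- 1 / 2)" using fH[of 1] by (simp add: abs_mult flip: fH)
      also have "\<dots> \<le> 2 * 1" using f_out[of 1] by (intro mult_mono) auto
      finally show ?thesis by simp
    qed
    have "norm (H x - H 1) \<le> 2 * norm (x - 1)"
    proof (rule field_differentiable_bound[of "{-1..1}"])
      fix z :: real assume z: "z \<in> {-1..1}"
      show "(H has_real_derivative exp (- (z\<^sup>2) / 2) * k z) (at z within {-1..1})"
        using H(1) DERIV_subset by blast
      have "exp (- (z\<^sup>2) / 2) * \<bar>k z\<bar> \<le> 1 * 2"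
        using k_le[of z] z by (intro mult_mono) auto
      then show "norm (exp (- (z\<^sup>2) / 2) * k z) \<le> 2" by (simp add: abs_mult)
    qed (use x in auto)
    also have "\<dots> \<le> 4" using x by auto
    finally have "\<bar>H x\<bar> \<le> 6" using H1 by auto
    moreover have "exp (x\<^sup>2 / 2) \<le> 2"
    proof -
      have "exp (x\<^sup>2 / 2) \<le> exp (1/2)" using x by (simp add: abs_square_le_1)
      also have "exp (1/2::real) \<le> 2" using exp_bound_half[of "1/2::real"] by simp
      finally show ?thesis .
    qed
    ultimately have "exp (x\<^sup>2 / 2) * \<bar>H x\<bar> \<le> 2 * 6" by (intro mult_mono) auto
    then show ?thesis by (simp add: f_def abs_mult)
  qed
  have f12: "\<bar>f x\<bar> \<le> 12" for x using f_in[of x] f_out[of x] by linarith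
  define u where "u x = x * f x + k x" for x
  define q where "q x = f x + h' x" for x
  have q13: "\<bar>q x\<bar> \<le> 13" for x unfolding q_def using f12[of x] h'[of x] by linarith
  have du: "(u has_real_derivative x * u x + q x) (at x)" for x
    unfolding u_def q_def using df[of x] dk[of x] by (auto intro!: derivative_eq_intros simp: algebra_simps)
  have u_le: "\<bar>u x\<bar> \<le> 13 * \<bar>x\<bar> + 1" for x
  proof -
    have "\<bar>x * f x\<bar> \<le> \<bar>x\<bar> * 12" unfolding abs_mult by (intro mult_left_mono f12) auto
    with k_le[of x] show ?thesis unfolding u_def by linarith
  qed
  have u_top: "((\<lambda>x. u x * exp (- (x\<^sup>2) / 2)) \<longlongrightarrow> 0) at_top"
  proof (rule Lim_null_comparison)
    show "\<forall>\<^sub>F x in at_top. norm (u x * exp (- (x\<^sup>2) / 2)) \<le> (13 * \<bar>x\<bar> + 1) * exp (- (x\<^sup>2) / 2)"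
      using u_le by (auto simp: abs_mult)
    show "((\<lambda>x::real. (13 * \<bar>x\<bar> + 1) * exp (- (x\<^sup>2) / 2)) \<longlongrightarrow> 0) at_top" by real_asymp
  qed
  have u_bot: "((\<lambda>x. u x * exp (- (x\<^sup>2) / 2)) \<longlongrightarrow> 0) at_bot"
  proof (rule Lim_null_comparison)
    show "\<forall>\<^sub>F x in at_bot. norm (u x * exp (- (x\<^sup>2) / 2)) \<le> (13 * \<bar>x\<bar> + 1) * exp (- (x\<^sup>2) / 2)"
      using u_le by (auto simp: abs_mult)
    show "((\<lambda>x::real. (13 * \<bar>x\<bar> + 1) * exp (- (x\<^sup>2) / 2)) \<longlongrightarrow> 0) at_bot" by real_asymp
  qed
  have xu: "\<bar>x * u x\<bar> \<le> 14" for x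
  proof -
    consider "x \<ge> 1" | "x \<le> -1" | "\<bar>x\<bar> \<le> 1" by linarith
    then show ?thesis
    proof cases
      case 1
      \<comment> \<open>Beyond \<open>x\<close> the constant bound 13 is also a linear one of slope
        \<open>13 / x\<close>; this yields the decay of \<open>u\<close> like
        \<open>1 / x\<close>.\<close>
      have "\<bar>q y\<bar> \<le> 13 / x * y" if "y \<ge> x" for y
      proof -
        have "13 \<le> 13 / x * y" using that 1 by (simp add: field_simps)
        with q13[of y] show ?thesis by linarith
      qed
      from gaussian_ode_bound_right[OF du this u_top] have "\<bar>u x\<bar> \<le> 13 / x" .
      then have "x * \<bar>u x\<bar> \<le> x * (13 / x)" using 1 by (intro mult_left_mono) auto
      then show ?thesis using 1 by (simp add: abs_mult)
    next
      case 2
      have "\<bar>q (- y)\<bar> \<le> 13 / (- x) * y" if "y \<ge> - x" for y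
      proof -
        have "13 \<le> 13 / (- x) * y" using that 2 by (simp add: field_simps)
        with q13[of "- y"] show ?thesis by linarith
      qed
      then have "\<bar>u (- (- x))\<bar> \<le> 13 / (- x)"
        by (rule gaussian_ode_bound_left[where a = "- x", OF du _ u_bot])
      then have "\<bar>u x\<bar> \<le> 13 / (- x)" by simp
      then have "(- x) * \<bar>u x\<bar> \<le> (- x) * (13 / (- x))" using 2 by (intro mult_left_mono) auto
      then show ?thesis using 2 by (simp add: abs_mult)
    next
      case 3
      have "\<bar>x\<bar> * \<bar>u x\<bar> \<le> 1 * 14" using u_le[of x] 3 by (intro mult_mono) auto
      then show ?thesis by (simp add: abs_mult)
    qed
  qed
  have ub: "\<bar>u x\<bar> \<le> 27" for x
  proof (cases "\<bar>x\<bar> \<le> 1")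
    case True
    then show ?thesis using u_le[of x] by linarith
  next
    case False
    then have "1 * \<bar>u x\<bar> \<le> \<bar>x\<bar> * \<bar>u x\<bar>" by (intro mult_right_mono) auto
    then show ?thesis using xu[of x] by (simp add: abs_mult)
  qed
  have "\<bar>u x - u y\<bar> \<le> 27 * \<bar>x - y\<bar>" for x y
  proof -
    have "\<bar>x * u x + q x\<bar> \<le> 27" for x using xu[of x] q13[of x] by linarith
    then show ?thesis
      using field_differentiable_bound[of UNIV u "\<lambda>x. x * u x + q x" 27 x y] du by auto
  qed
  with df ub show ?thesis
    by (intro that[of f u]) (auto simp: u_def k_def)
qed

section \<open>Independent Bernoulli sites\<close>

definition bern_weight :: "('a \<Rightarrow> real) \<Rightarrow> 'a set \<Rightarrow> 'a set \<Rightarrow> real" where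
  "bern_weight p I S = prod p S * (\<Prod>i\<in>I - S. 1 - p i)"

text \<open>Expectation under the product Bernoulli law, encoded as a finite sum over the possible
  occupied sets. Computations with it need no measurability; \<open>occupied_cells\<close> connects
  it with integrals over the Poisson process.\<close>

definition bern_exp :: "('a \<Rightarrow> real) \<Rightarrow> 'a set \<Rightarrow> ('a set \<Rightarrow> real) \<Rightarrow> real" where
  "bern_exp p I g = (\<Sum>S\<in>Pow I. bern_weight p I S * g S)"

lemma bern_exp_cong: "(\<And>S. S \<subseteq> I \<Longrightarrow> f S = g S) \<Longrightarrow> bern_exp p I f = bern_exp p I g"
  unfolding bern_exp_def by (intro sum.cong) auto

lemma bern_exp_add: "bern_exp p I (\<lambda>S. f S + g S) = bern_exp p I f + bern_exp p I g"
  unfolding bern_exp_def by (simp add: distrib_left sum.distrib)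

lemma bern_exp_diff: "bern_exp p I (\<lambda>S. f S - g S) = bern_exp p I f - bern_exp p I g"
  unfolding bern_exp_def by (simp add: right_diff_distrib sum_subtractf)

lemma bern_exp_cmult: "bern_exp p I (\<lambda>S. c * g S) = c * bern_exp p I g"
  unfolding bern_exp_def by (simp add: sum_distrib_left algebra_simps)

lemma bern_exp_sum: "bern_exp p I (\<lambda>S. \<Sum>a\<in>A. f a S) = (\<Sum>a\<in>A. bern_exp p I (f a))"
  unfolding bern_exp_def by (subst sum.swap) (simp add: sum_distrib_left)

lemma bern_exp_insert:
  assumes "finite I" "i \<notin> I"
  shows "bern_exp p (insert i I) g =
    p i * bern_exp p I (\<lambda>S. g (insert i S)) + (1 - p i) * bern_exp p I g"
proof -
  have fin: "finite S" if "S \<subseteq> I" for S using that assms finite_subset by blast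
  have inj: "inj_on (insert i) (Pow I)"
    using assms by (auto simp: inj_on_def)
  have "bern_exp p (insert i I) g =
      (\<Sum>S\<in>Pow I. bern_weight p (insert i I) S * g S) +
      (\<Sum>S\<in>insert i ` Pow I. bern_weight p (insert i I) S * g S)"
    unfolding bern_exp_def Pow_insert using assms
    by (intro sum.union_disjoint) auto
  also have "(\<Sum>S\<in>insert i ` Pow I. bern_weight p (insert i I) S * g S) =
      (\<Sum>S\<in>Pow I. bern_weight p (insert i I) (insert i S) * g (insert i S))"
    by (simp add: sum.reindex[OF inj])
  also have "(\<Sum>S\<in>Pow I. bern_weight p (insert i I) S * g S) = (1 - p i) * bern_exp p I g"
    unfolding bern_exp_def sum_distrib_left
  proof (rule sum.cong)
    fix S assume S: "S \<in> Pow I"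
    then have "insert i I - S = insert i (I - S)" using assms by auto
    then show "bern_weight p (insert i I) S * g S = (1 - p i) * (bern_weight p I S * g S)"
      using assms by (simp add: bern_weight_def)
  qed simp
  also have "(\<Sum>S\<in>Pow I. bern_weight p (insert i I) (insert i S) * g (insert i S)) =
      p i * bern_exp p I (\<lambda>S. g (insert i S))"
    unfolding bern_exp_def sum_distrib_left
  proof (rule sum.cong)
    fix S assume S: "S \<in> Pow I"
    then have "insert i I - insert i S = I - S" "i \<notin> S" using assms by auto
    then show "bern_weight p (insert i I) (insert i S) * g (insert i S) =
        p i * (bern_weight p I S * g (insert i S))"
      using assms fin S by (simp add: bern_weight_def)
  qed simp
  finally show ?thesis by simp
qed

lemma bern_exp_const: "finite I \<Longrightarrow> bern_exp p I (\<lambda>S. c) = c"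
proof (induction I rule: finite_induct)
  case empty
  then show ?case by (simp add: bern_exp_def bern_weight_def)
qed (simp add: bern_exp_insert algebra_simps)

lemma bern_exp_force_single:
  assumes "finite I" "i \<in> I"
  shows "bern_exp p I (\<lambda>S. if i \<in> S then g S else 0) = p i * bern_exp p I (\<lambda>S. g (insert i S))"
proof -
  define J where "J = I - {i}"
  have J: "I = insert i J" "i \<notin> J" "finite J" using assms by (auto simp: J_def)
  have "bern_exp p J (\<lambda>S. if i \<in> S then g S else 0) = bern_exp p J (\<lambda>S. 0)"
    using J by (intro bern_exp_cong) auto
  then show ?thesis
    using J by (simp add: bern_exp_insert bern_exp_const algebra_simps)
qed

text \<open>By independence, conditioning on the occupation of \<open>A\<close> leaves all other
  sites alone, so the conditioned set is distributed as \<open>S \<union> A\<close>. This is the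
  source of the size bias coupling.\<close>

lemma bern_exp_force:
  assumes "finite I" "A \<subseteq> I"
  shows "bern_exp p I (\<lambda>S. if A \<subseteq> S then g S else 0) = prod p A * bern_exp p I (\<lambda>S. g (S \<union> A))"
proof -
  have "finite A" using assms finite_subset by blast
  then show ?thesis using assms(2)
  proof (induction A arbitrary: g rule: finite_induct)
    case (insert a A)
    have "bern_exp p I (\<lambda>S. if insert a A \<subseteq> S then g S else 0)
        = bern_exp p I (\<lambda>S. if A \<subseteq> S then if a \<in> S then g S else 0 else 0)"
      by (intro bern_exp_cong) auto
    also have "\<dots> = prod p A * bern_exp p I (\<lambda>S. if a \<in> S \<union> A then g (S \<union> A) else 0)"
      using insert by simp
    also have "bern_exp p I (\<lambda>S. if a \<in> S \<union> A then g (S \<union> A) else 0)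
        = bern_exp p I (\<lambda>S. if a \<in> S then g (S \<union> A) else 0)"
      using insert by (intro bern_exp_cong) auto
    also have "\<dots> = p a * bern_exp p I (\<lambda>S. g (insert a S \<union> A))"
      using insert assms by (intro bern_exp_force_single) auto
    finally show ?case using insert by simp
  qed simp
qed

section \<open>Moments and covariances under the product law\<close>

locale bern_sites =
  fixes I :: "'a set" and p :: "'a \<Rightarrow> real"
  assumes finite_I: "finite I" and p_nonneg: "\<And>i. 0 \<le> p i" and p_le_1: "\<And>i. p i \<le> 1"
begin

abbreviation E :: "('a set \<Rightarrow> real) \<Rightarrow> real" where "E \<equiv> bern_exp p I"

lemmas E_const = bern_exp_const[OF finite_I]

lemma weight_nonneg: "0 \<le> bern_weight p I S"
  unfolding bern_weight_def using p_nonneg p_le_1 by (auto intro!: mult_nonneg_nonneg prod_nonneg)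

lemma E_mono: "(\<And>S. S \<subseteq> I \<Longrightarrow> f S \<le> g S) \<Longrightarrow> E f \<le> E g"
  unfolding bern_exp_def using weight_nonneg by (intro sum_mono mult_left_mono) auto

lemma E_abs: "\<bar>E f\<bar> \<le> E (\<lambda>S. \<bar>f S\<bar>)"
  unfolding bern_exp_def by (rule order_trans[OF sum_abs]) (simp add: abs_mult weight_nonneg)

lemma E_subset: "A \<subseteq> I \<Longrightarrow> E (\<lambda>S. of_bool (A \<subseteq> S)) = prod p A"
  using bern_exp_force[OF finite_I, of A p "\<lambda>_. 1"] by (simp add: E_const of_bool_def)

lemma E_abs_sqrt: "E (\<lambda>S. \<bar>f S\<bar>) \<le> sqrt (E (\<lambda>S. (f S)\<^sup>2))"
proof (rule real_le_rsqrt)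
  define c where "c = E (\<lambda>S. \<bar>f S\<bar>)"
  have "0 \<le> E (\<lambda>S. (\<bar>f S\<bar> - c)\<^sup>2)"
    using E_mono[of "\<lambda>_. 0" "\<lambda>S. (\<bar>f S\<bar> - c)\<^sup>2"] by (simp add: E_const)
  also have "\<dots> = E (\<lambda>S. (f S)\<^sup>2 - 2 * c * \<bar>f S\<bar> + c\<^sup>2)"
    by (intro bern_exp_cong) (simp add: power2_eq_square algebra_simps)
  also have "\<dots> = E (\<lambda>S. (f S)\<^sup>2) - c\<^sup>2"
    by (simp add: bern_exp_add bern_exp_diff bern_exp_cmult E_const c_def[symmetric] power2_eq_square)
  finally show "(E (\<lambda>S. \<bar>f S\<bar>))\<^sup>2 \<le> E (\<lambda>S. (f S)\<^sup>2)" by (simp add: c_def)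
qed

definition Var :: "('a set \<Rightarrow> real) \<Rightarrow> real" where "Var f = E (\<lambda>S. (f S - E f)\<^sup>2)"

lemma Var_eq: "Var f = E (\<lambda>S. (f S)\<^sup>2) - (E f)\<^sup>2"
proof -
  have "Var f = E (\<lambda>S. (f S)\<^sup>2 - 2 * E f * f S + (E f)\<^sup>2)"
    unfolding Var_def by (intro bern_exp_cong) (simp add: power2_eq_square algebra_simps)
  also have "\<dots> = E (\<lambda>S. (f S)\<^sup>2) - (E f)\<^sup>2"
    by (simp add: bern_exp_add bern_exp_diff bern_exp_cmult E_const power2_eq_square)
  finally show ?thesis .
qed

lemma Var_diff_le: "Var (\<lambda>S. f S - g S) \<le> 2 * Var f + 2 * Var g"
proof -
  have "Var (\<lambda>S. f S - g S) \<le> E (\<lambda>S. 2 * (f S - E f)\<^sup>2 + 2 * (g S - E g)\<^sup>2)"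
    unfolding Var_def bern_exp_diff
  proof (rule E_mono)
    fix S
    have "0 \<le> ((f S - E f) + (g S - E g))\<^sup>2" by simp
    then show "(f S - g S - (E f - E g))\<^sup>2 \<le> 2 * (f S - E f)\<^sup>2 + 2 * (g S - E g)\<^sup>2"
      by (simp add: power2_eq_square algebra_simps)
  qed
  then show ?thesis by (simp add: bern_exp_add bern_exp_cmult Var_def)
qed

lemma prod_p_bounds: "0 \<le> prod p A" "prod p A \<le> 1"
  using p_nonneg p_le_1 by (auto intro: prod_nonneg prod_le_1)

lemma prod_p_Un_Int: "finite A \<Longrightarrow> finite B \<Longrightarrow> prod p A * prod p B = prod p (A \<union> B) * prod p (A \<inter> B)"
  by (simp add: prod.union_inter)

lemma prod_p_mult_le: "finite A \<Longrightarrow> finite B \<Longrightarrow> prod p A * prod p B \<le> prod p (A \<union> B)"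
  using prod_p_Un_Int[of A B] prod_p_bounds by (simp add: mult_left_le)

lemma Var_sum:
  assumes D: "\<And>u. u \<in> U \<Longrightarrow> D u \<subseteq> I"
  shows "Var (\<lambda>S. \<Sum>u\<in>U. w u * of_bool (D u \<subseteq> S)) =
    (\<Sum>u\<in>U. \<Sum>v\<in>U. w u * w v * (prod p (D u \<union> D v) - prod p (D u) * prod p (D v)))"
proof -
  have "E (\<lambda>S. (\<Sum>u\<in>U. w u * of_bool (D u \<subseteq> S))\<^sup>2) =
      E (\<lambda>S. \<Sum>u\<in>U. \<Sum>v\<in>U. w u * w v * of_bool (D u \<union> D v \<subseteq> S))"
    unfolding power2_eq_square sum_product
    by (intro bern_exp_cong sum.cong) auto
  also have "\<dots> = (\<Sum>u\<in>U. \<Sum>v\<in>U. w u * w v * prod p (D u \<union> D v))"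
    unfolding bern_exp_sum bern_exp_cmult using D by (intro sum.cong refl) (subst E_subset, auto)
  finally have 1: "E (\<lambda>S. (\<Sum>u\<in>U. w u * of_bool (D u \<subseteq> S))\<^sup>2) = \<dots>" .
  have 2: "E (\<lambda>S. \<Sum>u\<in>U. w u * of_bool (D u \<subseteq> S)) = (\<Sum>u\<in>U. w u * prod p (D u))"
    unfolding bern_exp_sum bern_exp_cmult using D by (intro sum.cong refl) (subst E_subset, auto)
  show ?thesis
    unfolding Var_eq 1 2 unfolding power2_eq_square sum_product
    by (simp add: right_diff_distrib sum_subtractf algebra_simps)
qed

lemma Var_sum_le:
  assumes D: "\<And>u. u \<in> U \<Longrightarrow> D u \<subseteq> I" and w: "\<And>u. u \<in> U \<Longrightarrow> 0 \<le> w u"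
  shows "Var (\<lambda>S. \<Sum>u\<in>U. w u * of_bool (D u \<subseteq> S)) \<le>
    (\<Sum>u\<in>U. \<Sum>v\<in>U. of_bool (D u \<inter> D v \<noteq> {}) * (w u * w v * prod p (D u \<union> D v)))"
proof -
  have *: "Var (\<lambda>S. \<Sum>u\<in>U. w u * of_bool (D u \<subseteq> S)) =
    (\<Sum>u\<in>U. \<Sum>v\<in>U. w u * w v * (prod p (D u \<union> D v) - prod p (D u) * prod p (D v)))"
    by (rule Var_sum[OF D])
  show ?thesis unfolding *
  proof (intro sum_mono)
    fix u v assume uv: "u \<in> U" "v \<in> U"
    then have fin: "finite (D u)" "finite (D v)" using D finite_I finite_subset by blast+
    show "w u * w v * (prod p (D u \<union> D v) - prod p (D u) * prod p (D v))
        \<le> of_bool (D u \<inter> D v \<noteq> {}) * (w u * w v * prod p (D u \<union> D v))"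
    proof (cases "D u \<inter> D v = {}")
      case True
      then show ?thesis using fin by (simp add: prod.union_disjoint)
    next
      case False
      then show ?thesis using w[OF uv(1)] w[OF uv(2)] prod_p_bounds(1)[of "D u"] prod_p_bounds(1)[of "D v"]
        by (simp add: right_diff_distrib)
    qed
  qed
qed

end

section \<open>Sums over chains of intersecting sets\<close>

lemma sum_Pow_prod_le_exp:
  fixes p :: "'a \<Rightarrow> real"
  assumes "finite N" "\<And>i. 0 \<le> p i"
  shows "(\<Sum>D\<in>Pow N. prod p D) \<le> exp (sum p N)"
proof -
  \<comment> \<open>Expanding the product over the sites gives one term for each subset. The
    resulting bound sees \<open>N\<close> only through its total weight, so it does not deteriorate
    when the mesh is refined.\<close>
  have "(\<Sum>D\<in>Pow N. prod p D) = (\<Prod>i\<in>N. p i + 1)"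
    using assms(1) by (simp add: prod_add)
  also have "\<dots> \<le> (\<Prod>i\<in>N. exp (p i))"
    using assms(2) exp_ge_add_one_self by (intro prod_mono) (auto simp: add.commute add_nonneg_nonneg)
  also have "\<dots> = exp (sum p N)" using assms(1) by (simp add: exp_sum)
  finally show ?thesis .
qed

text \<open>All that is kept of the cliques of a graph: a member of the family through
  \<open>u\<close> lies in \<open>u\<close> and its neighbourhood. \<open>m\<close> bounds the
  weight of a neighbourhood and \<open>T\<close> the total weight; the estimates below involve the
  sites only through \<open>k\<close>, \<open>m\<close> and \<open>T\<close>.\<close>

locale bern_family = bern_sites I p
  for I :: "'a set" and p +
  fixes \<A> :: "'a set set" and Nb :: "'a \<Rightarrow> 'a set" and m T :: real and k :: nat
  assumes \<A>_sub: "\<And>A. A \<in> \<A> \<Longrightarrow> A \<subseteq> I" and \<A>_card: "\<And>A. A \<in> \<A> \<Longrightarrow> card A = k" and k_pos: "k > 0"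
    and \<A>_Nb: "\<And>A u. A \<in> \<A> \<Longrightarrow> u \<in> A \<Longrightarrow> A \<subseteq> insert u (Nb u)"
    and Nb: "\<And>u. u \<in> I \<Longrightarrow> Nb u \<subseteq> I" and Nb_sum: "\<And>u. u \<in> I \<Longrightarrow> sum p (Nb u) \<le> m"
    and p_sum: "sum p I \<le> T"
begin

lemma finite_\<A>: "finite \<A>"
  using \<A>_sub finite_I by (meson Pow_iff finite_Pow_iff finite_subset subsetI)

lemma finite_mem: "A \<in> \<A> \<Longrightarrow> finite A"
  using \<A>_sub finite_I finite_subset by blast

text \<open>A set \<open>A\<close> through \<open>u\<close> splits into \<open>A \<inter> U\<close>,
  for which there are at most \<open>2 ^ card U\<close> choices, and \<open>A - U\<close>, which is
  a subset of the neighbourhood of \<open>u\<close> because \<open>u\<close> itself lies in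
  \<open>U\<close>. The weights of the possible \<open>A - U\<close> add up to at most
  \<open>exp m\<close>.\<close>

lemma sum_through_le:
  assumes U: "U \<subseteq> I" "u \<in> U"
  shows "(\<Sum>A\<in>{A\<in>\<A>. u \<in> A}. prod p (U \<union> A)) \<le> 2 ^ card U * exp m * prod p U"
proof -
  have fU: "finite U" using U finite_I finite_subset by blast
  have fN: "finite (Nb u)" using Nb U finite_I finite_subset by blast
  have "(\<Sum>A\<in>{A\<in>\<A>. u \<in> A}. prod p (U \<union> A)) = (\<Sum>A\<in>{A\<in>\<A>. u \<in> A}. prod p U * prod p (A - U))"
  proof (intro sum.cong refl)
    fix A assume "A \<in> {A\<in>\<A>. u \<in> A}"
    then have "finite A" using finite_mem by auto
    then have "prod p (U \<union> (A - U)) = prod p U * prod p (A - U)"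
      using fU by (intro prod.union_disjoint) auto
    then show "prod p (U \<union> A) = prod p U * prod p (A - U)" by simp
  qed
  also have "\<dots> = prod p U * (\<Sum>A\<in>{A\<in>\<A>. u \<in> A}. prod p (A - U))"
    by (simp add: sum_distrib_left)
  also have "(\<Sum>A\<in>{A\<in>\<A>. u \<in> A}. prod p (A - U)) =
      (\<Sum>(J, D)\<in>(\<lambda>A. (A \<inter> U, A - U)) ` {A\<in>\<A>. u \<in> A}. prod p D)"
    by (subst sum.reindex) (auto simp: inj_on_def)
  also have "\<dots> \<le> (\<Sum>(J, D)\<in>Pow U \<times> Pow (Nb u). prod p D)"
  proof (rule sum_mono2)
    show "(\<lambda>A. (A \<inter> U, A - U)) ` {A \<in> \<A>. u \<in> A} \<subseteq> Pow U \<times> Pow (Nb u)"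
      using \<A>_Nb U(2) by fastforce
  qed (use fU fN prod_p_bounds in auto)
  also have "\<dots> = 2 ^ card U * (\<Sum>D\<in>Pow (Nb u). prod p D)"
    by (subst sum.cartesian_product[symmetric]) (simp add: card_Pow fU)
  also have "\<dots> \<le> 2 ^ card U * exp m"
  proof (intro mult_left_mono)
    have "(\<Sum>D\<in>Pow (Nb u). prod p D) \<le> exp (sum p (Nb u))"
      by (rule sum_Pow_prod_le_exp[OF fN p_nonneg])
    also have "\<dots> \<le> exp m" using Nb_sum U by auto
    finally show "(\<Sum>D\<in>Pow (Nb u). prod p D) \<le> exp m" .
  qed simp
  finally have "(\<Sum>A\<in>{A\<in>\<A>. u \<in> A}. prod p (U \<union> A)) \<le> prod p U * (2 ^ card U * exp m)"
    by (simp add: mult_left_mono prod_p_bounds(1))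
  then show ?thesis by (simp only: mult_ac)
qed

text \<open>A union bound over the common vertex. Thus prolonging a chain by one more set that meets
  it costs only a bounded factor, which is how the longer chain sums are reduced to shorter
  ones.\<close>

lemma sum_meeting_le:
  assumes U: "U \<subseteq> I" "card U \<le> c"
  shows "(\<Sum>A\<in>\<A>. of_bool (U \<inter> A \<noteq> {}) * prod p (U \<union> A)) \<le> real c * 2 ^ c * exp m * prod p U"
proof -
  have fU: "finite U" using U finite_I finite_subset by blast
  have "(\<Sum>A\<in>\<A>. of_bool (U \<inter> A \<noteq> {}) * prod p (U \<union> A)) \<le>
      (\<Sum>A\<in>\<A>. \<Sum>u\<in>U. of_bool (u \<in> A) * prod p (U \<union> A))"
  proof (intro sum_mono)
    fix A
    show "of_bool (U \<inter> A \<noteq> {}) * prod p (U \<union> A) \<le> (\<Sum>u\<in>U. of_bool (u \<in> A) * prod p (U \<union> A))"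
    proof (cases "U \<inter> A = {}")
      case False
      then obtain u where u: "u \<in> U" "u \<in> A" by auto
      have "of_bool (u \<in> A) * prod p (U \<union> A) \<le> (\<Sum>u\<in>U. of_bool (u \<in> A) * prod p (U \<union> A))"
        using u fU prod_p_bounds by (intro member_le_sum) auto
      with u False show ?thesis by simp
    qed (auto intro!: sum_nonneg prod_p_bounds)
  qed
  also have "\<dots> = (\<Sum>u\<in>U. \<Sum>A\<in>{A\<in>\<A>. u \<in> A}. prod p (U \<union> A))"
    by (subst sum.swap) (intro sum.cong refl sum.mono_neutral_cong_right; auto simp: finite_\<A>)
  also have "\<dots> \<le> (\<Sum>u\<in>U. 2 ^ card U * exp m * prod p U)"
    using U by (intro sum_mono sum_through_le) auto
  also have "\<dots> = real (card U) * 2 ^ card U * exp m * prod p U" by simp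
  also have "\<dots> \<le> real c * 2 ^ c * exp m * prod p U"
    using U prod_p_bounds by (intro mult_right_mono mult_mono power_increasing) auto
  finally show ?thesis .
qed

text \<open>Each set after the first meets the union of its predecessors. Summing from the last set
  inwards therefore leaves only the sum over the first set, which is proportional to
  \<open>T\<close>. Chains of three sets arise from the Taylor remainder in Stein's equation, chains
  of four from the variance of \<open>stein_coeff\<close>.\<close>

definition chain3 :: real where
  "chain3 = (\<Sum>A\<in>\<A>. \<Sum>B\<in>\<A>. \<Sum>C\<in>\<A>. of_bool (A \<inter> B \<noteq> {}) * of_bool ((A \<union> B) \<inter> C \<noteq> {}) * prod p (A \<union> B \<union> C))"

definition chain4 :: real where
  "chain4 = (\<Sum>A\<in>\<A>. \<Sum>B\<in>\<A>. \<Sum>C\<in>\<A>. \<Sum>D\<in>\<A>. of_bool (A \<inter> B \<noteq> {}) * of_bool ((A \<union> B) \<inter> C \<noteq> {})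
     * of_bool ((A \<union> B \<union> C) \<inter> D \<noteq> {}) * prod p (A \<union> B \<union> C \<union> D))"

text \<open>Since \<open>k > 0\<close>, each set has a vertex and is counted when the sets through
  each single site are summed; the factor 2 is \<open>2 ^ card {u}\<close>.\<close>

lemma sum_one_le: "(\<Sum>A\<in>\<A>. prod p A) \<le> 2 * exp m * T"
proof -
  have "(\<Sum>A\<in>\<A>. prod p A) \<le> (\<Sum>A\<in>\<A>. \<Sum>u\<in>I. of_bool (u \<in> A) * prod p A)"
  proof (intro sum_mono)
    fix A assume A: "A \<in> \<A>"
    then obtain u where u: "u \<in> A" using \<A>_card[OF A] k_pos by (metis card_gt_0_iff ex_in_conv)
    have "of_bool (u \<in> A) * prod p A \<le> (\<Sum>u\<in>I. of_bool (u \<in> A) * prod p A)"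
      using u A \<A>_sub finite_I prod_p_bounds by (intro member_le_sum) auto
    with u show "prod p A \<le> (\<Sum>u\<in>I. of_bool (u \<in> A) * prod p A)" by simp
  qed
  also have "\<dots> = (\<Sum>u\<in>I. \<Sum>A\<in>{A\<in>\<A>. u \<in> A}. prod p ({u} \<union> A))"
    by (subst sum.swap) (intro sum.cong refl sum.mono_neutral_cong_right; auto simp: finite_\<A> insert_absorb)
  also have "\<dots> \<le> (\<Sum>u\<in>I. 2 ^ card {u} * exp m * prod p {u})"
    by (intro sum_mono sum_through_le) auto
  also have "\<dots> = 2 * exp m * sum p I" by (simp add: sum_distrib_left)
  also have "\<dots> \<le> 2 * exp m * T" using p_sum by simp
  finally show ?thesis .
qed

lemma card_Un_le2: "A \<in> \<A> \<Longrightarrow> B \<in> \<A> \<Longrightarrow> card (A \<union> B) \<le> 2 * k"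
  using card_Un_le[of A B] \<A>_card by simp

lemma card_Un_le3: "A \<in> \<A> \<Longrightarrow> B \<in> \<A> \<Longrightarrow> C \<in> \<A> \<Longrightarrow> card (A \<union> B \<union> C) \<le> 3 * k"
  using card_Un_le[of "A \<union> B" C] card_Un_le2[of A B] \<A>_card by simp

lemma sum_two_le: "(\<Sum>A\<in>\<A>. \<Sum>B\<in>\<A>. of_bool (A \<inter> B \<noteq> {}) * prod p (A \<union> B)) \<le> real k * 2 ^ k * exp m * (2 * exp m * T)"
proof -
  have "(\<Sum>A\<in>\<A>. \<Sum>B\<in>\<A>. of_bool (A \<inter> B \<noteq> {}) * prod p (A \<union> B)) \<le> (\<Sum>A\<in>\<A>. real k * 2 ^ k * exp m * prod p A)"
    by (rule sum_mono, rule sum_meeting_le) (simp_all add: \<A>_sub \<A>_card)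
  also have "\<dots> \<le> real k * 2 ^ k * exp m * (2 * exp m * T)"
    unfolding sum_distrib_left[symmetric] by (intro mult_left_mono sum_one_le) auto
  finally show ?thesis .
qed

lemma chain3_le: "chain3 \<le> real (2 * k) * 2 ^ (2 * k) * exp m * (real k * 2 ^ k * exp m * (2 * exp m * T))"
proof -
  have "chain3 \<le> (\<Sum>A\<in>\<A>. \<Sum>B\<in>\<A>. real (2 * k) * 2 ^ (2 * k) * exp m * (of_bool (A \<inter> B \<noteq> {}) * prod p (A \<union> B)))"
    unfolding chain3_def
  proof (intro sum_mono)
    fix A B assume AB: "A \<in> \<A>" "B \<in> \<A>"
    have "(\<Sum>C\<in>\<A>. of_bool (A \<inter> B \<noteq> {}) * of_bool ((A \<union> B) \<inter> C \<noteq> {}) * prod p (A \<union> B \<union> C))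
       = of_bool (A \<inter> B \<noteq> {}) * (\<Sum>C\<in>\<A>. of_bool ((A \<union> B) \<inter> C \<noteq> {}) * prod p (A \<union> B \<union> C))"
      by (simp add: sum_distrib_left mult.assoc)
    also have "\<dots> \<le> of_bool (A \<inter> B \<noteq> {}) * (real (2 * k) * 2 ^ (2 * k) * exp m * prod p (A \<union> B))"
      using AB \<A>_sub card_Un_le2 by (intro mult_left_mono sum_meeting_le) auto
    finally show "(\<Sum>C\<in>\<A>. of_bool (A \<inter> B \<noteq> {}) * of_bool ((A \<union> B) \<inter> C \<noteq> {}) * prod p (A \<union> B \<union> C))
       \<le> real (2 * k) * 2 ^ (2 * k) * exp m * (of_bool (A \<inter> B \<noteq> {}) * prod p (A \<union> B))"
      by (simp add: mult_ac)
  qed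
  also have "\<dots> = real (2 * k) * 2 ^ (2 * k) * exp m * (\<Sum>A\<in>\<A>. \<Sum>B\<in>\<A>. of_bool (A \<inter> B \<noteq> {}) * prod p (A \<union> B))"
    by (simp add: sum_distrib_left)
  also have "\<dots> \<le> real (2 * k) * 2 ^ (2 * k) * exp m * (real k * 2 ^ k * exp m * (2 * exp m * T))"
    by (intro mult_left_mono sum_two_le) auto
  finally show ?thesis .
qed

lemma chain4_le_chain3: "chain4 \<le> real (3 * k) * 2 ^ (3 * k) * exp m * chain3"
proof -
  have "chain4 \<le> (\<Sum>A\<in>\<A>. \<Sum>B\<in>\<A>. \<Sum>C\<in>\<A>. real (3 * k) * 2 ^ (3 * k) * exp m *
     (of_bool (A \<inter> B \<noteq> {}) * of_bool ((A \<union> B) \<inter> C \<noteq> {}) * prod p (A \<union> B \<union> C)))"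
    unfolding chain4_def
  proof (intro sum_mono)
    fix A B C assume ABC: "A \<in> \<A>" "B \<in> \<A>" "C \<in> \<A>"
    let ?b = "of_bool (A \<inter> B \<noteq> {}) * of_bool ((A \<union> B) \<inter> C \<noteq> {}) :: real"
    have "(\<Sum>D\<in>\<A>. ?b * of_bool ((A \<union> B \<union> C) \<inter> D \<noteq> {}) * prod p (A \<union> B \<union> C \<union> D))
       = ?b * (\<Sum>D\<in>\<A>. of_bool ((A \<union> B \<union> C) \<inter> D \<noteq> {}) * prod p (A \<union> B \<union> C \<union> D))"
      by (simp add: sum_distrib_left mult.assoc)
    also have "\<dots> \<le> ?b * (real (3 * k) * 2 ^ (3 * k) * exp m * prod p (A \<union> B \<union> C))"
      using ABC \<A>_sub card_Un_le3 by (intro mult_left_mono sum_meeting_le) auto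
    finally show "(\<Sum>D\<in>\<A>. ?b * of_bool ((A \<union> B \<union> C) \<inter> D \<noteq> {}) * prod p (A \<union> B \<union> C \<union> D))
       \<le> real (3 * k) * 2 ^ (3 * k) * exp m * (?b * prod p (A \<union> B \<union> C))"
      by (simp only: mult_ac)
  qed
  also have "\<dots> = real (3 * k) * 2 ^ (3 * k) * exp m * chain3"
    unfolding chain3_def sum_distrib_left ..
  finally show ?thesis .
qed

end

text \<open>A Lipschitz derivative takes the place of a bounded second derivative: the mean value
  bound is applied to \<open>F\<close> minus its tangent direction at \<open>x\<close>.\<close>

lemma taylor_lipschitz_derivative:
  fixes F F' :: "real \<Rightarrow> real"
  assumes F: "\<And>x. (F has_real_derivative F' x) (at x)" and L: "\<And>x y. \<bar>F' x - F' y\<bar> \<le> c * \<bar>x - y\<bar>"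
  shows "\<bar>F (x + d) - F x - F' x * d\<bar> \<le> c * d\<^sup>2"
proof -
  define G where "G y = F y - F' x * y" for y
  have dG: "(G has_real_derivative F' y - F' x) (at y)" for y
    unfolding G_def using F[of y] by (auto intro!: derivative_eq_intros)
  have c: "0 \<le> c" using L[of 1 0] abs_ge_zero[of "F' 1 - F' 0"] by simp
  have "norm (G (x + d) - G x) \<le> (c * \<bar>d\<bar>) * norm (x + d - x)"
  proof (rule field_differentiable_bound[of "closed_segment x (x + d)" G])
    fix y assume "y \<in> closed_segment x (x + d)"
    then have "\<bar>y - x\<bar> \<le> \<bar>d\<bar>" by (auto simp: closed_segment_eq_real_ivl split: if_splits)
    then have "c * \<bar>y - x\<bar> \<le> c * \<bar>d\<bar>" using c by (rule mult_left_mono)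
    then show "norm (F' y - F' x) \<le> c * \<bar>d\<bar>"
      using L[of y x] by simp
    show "(G has_real_derivative F' y - F' x) (at y within closed_segment x (x + d))"
      using dG DERIV_subset by blast
  qed auto
  moreover have "G (x + d) - G x = F (x + d) - F x - F' x * d" by (simp add: G_def algebra_simps)
  ultimately show ?thesis by (simp add: power2_eq_square mult.assoc)
qed

text \<open>Factors of \<open>T\<close> in the bounds for chains of two, three and four sets. Each
  further link contributes \<open>c * 2 ^ c * exp m\<close>, where \<open>c\<close> bounds the
  number of vertices collected so far; \<open>2 * exp m\<close> comes from the first set.\<close>

definition chain_const2 :: "nat \<Rightarrow> real \<Rightarrow> real" where
  "chain_const2 k m = real k * 2 ^ k * exp m * (2 * exp m)"

definition chain_const3 :: "nat \<Rightarrow> real \<Rightarrow> real" where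
  "chain_const3 k m = real (2 * k) * 2 ^ (2 * k) * exp m * chain_const2 k m"

definition chain_const4 :: "nat \<Rightarrow> real \<Rightarrow> real" where
  "chain_const4 k m = real (3 * k) * 2 ^ (3 * k) * exp m * chain_const3 k m"

section \<open>Stein's method by size bias\<close>

context bern_family
begin

definition count :: "'a set \<Rightarrow> real" where "count S = (\<Sum>A\<in>\<A>. of_bool (A \<subseteq> S))"

lemma E_count: "E count = (\<Sum>A\<in>\<A>. prod p A)"
  unfolding count_def bern_exp_sum using \<A>_sub by (intro sum.cong refl E_subset) auto

text \<open>The exact formula is kept besides the upper bound, because superadditivity rests on the
  nonnegativity of its individual summands.\<close>

lemma Var_count: "Var count = (\<Sum>A\<in>\<A>. \<Sum>B\<in>\<A>. prod p (A \<union> B) - prod p A * prod p B)"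
proof -
  have "Var count = Var (\<lambda>S. \<Sum>A\<in>\<A>. 1 * of_bool (id A \<subseteq> S))"
    by (simp add: count_def[abs_def])
  also have "\<dots> = (\<Sum>A\<in>\<A>. \<Sum>B\<in>\<A>. 1 * 1 * (prod p (id A \<union> id B) - prod p (id A) * prod p (id B)))"
    by (rule Var_sum) (use \<A>_sub in auto)
  finally show ?thesis by simp
qed

lemma Var_count_le: "Var count \<le> chain_const2 k m * T"
proof -
  have "Var count = Var (\<lambda>S. \<Sum>A\<in>\<A>. 1 * of_bool (id A \<subseteq> S))"
    by (simp add: count_def[abs_def])
  also have "\<dots> \<le> (\<Sum>A\<in>\<A>. \<Sum>B\<in>\<A>. of_bool (id A \<inter> id B \<noteq> {}) * (1 * 1 * prod p (id A \<union> id B)))"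
    by (rule Var_sum_le) (use \<A>_sub in auto)
  also have "\<dots> \<le> chain_const2 k m * T"
    using sum_two_le by (simp add: chain_const2_def mult.assoc)
  finally show ?thesis .
qed

lemma chain3_le': "chain3 \<le> chain_const3 k m * T"
  using chain3_le by (simp add: chain_const2_def chain_const3_def mult_ac)

lemma chain4_le': "chain4 \<le> chain_const4 k m * T"
proof -
  have "chain4 \<le> real (3 * k) * 2 ^ (3 * k) * exp m * chain3" by (rule chain4_le_chain3)
  also have "\<dots> \<le> real (3 * k) * 2 ^ (3 * k) * exp m * (chain_const3 k m * T)"
    by (intro mult_left_mono chain3_le') auto
  finally show ?thesis by (simp add: chain_const4_def mult_ac)
qed

definition add_cost :: "'a set \<Rightarrow> 'a set \<Rightarrow> real" where
  "add_cost A S = count (S \<union> A) - count S"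

text \<open>Sets disjoint from \<open>A\<close> are unaffected when \<open>A\<close> is occupied by
  force, so their indicators cancel. Of a set \<open>B\<close> meeting \<open>A\<close> only the
  part \<open>B - A\<close> must be occupied already.\<close>

lemma add_cost_eq:
  "add_cost A S = (\<Sum>B\<in>\<A>. of_bool (A \<inter> B \<noteq> {}) * of_bool (B - A \<subseteq> S))
     - (\<Sum>B\<in>\<A>. of_bool (A \<inter> B \<noteq> {}) * of_bool (B \<subseteq> S))"
  unfolding add_cost_def count_def sum_subtractf[symmetric]
proof (intro sum.cong refl)
  fix B
  show "of_bool (B \<subseteq> S \<union> A) - of_bool (B \<subseteq> S) =
    of_bool (A \<inter> B \<noteq> {}) * of_bool (B - A \<subseteq> S) - of_bool (A \<inter> B \<noteq> {}) * (of_bool (B \<subseteq> S) :: real)"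
    by (cases "A \<inter> B = {}") (auto simp: of_bool_def)
qed

lemma add_cost_bounds:
  "0 \<le> add_cost A S" "add_cost A S \<le> (\<Sum>B\<in>\<A>. of_bool (A \<inter> B \<noteq> {}) * of_bool (B - A \<subseteq> S))"
proof -
  show "0 \<le> add_cost A S"
    unfolding add_cost_def count_def by (simp, intro sum_mono) auto
  have "0 \<le> (\<Sum>B\<in>\<A>. of_bool (A \<inter> B \<noteq> {}) * of_bool (B \<subseteq> S) :: real)" by (intro sum_nonneg) auto
  then show "add_cost A S \<le> (\<Sum>B\<in>\<A>. of_bool (A \<inter> B \<noteq> {}) * of_bool (B - A \<subseteq> S))"
    unfolding add_cost_eq by linarith
qed

text \<open>The factor \<open>prod p A\<close> supplies the missing vertices: its product with the
  weight of \<open>B \<union> C - A\<close> is the weight of \<open>A \<union> B \<union> C\<close>.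
  Both \<open>B\<close> and \<open>C\<close> meet \<open>A\<close>; relaxing this to the chain
  condition makes the sum over \<open>A\<close> at most \<open>chain3\<close>.\<close>

lemma E_add_cost_sq:
  assumes A: "A \<in> \<A>"
  shows "prod p A * E (\<lambda>S. (add_cost A S)\<^sup>2) \<le>
    (\<Sum>B\<in>\<A>. \<Sum>C\<in>\<A>. of_bool (A \<inter> B \<noteq> {}) * of_bool ((A \<union> B) \<inter> C \<noteq> {}) * prod p (A \<union> B \<union> C))"
proof -
  have "E (\<lambda>S. (add_cost A S)\<^sup>2) \<le> E (\<lambda>S. (\<Sum>B\<in>\<A>. of_bool (A \<inter> B \<noteq> {}) * of_bool (B - A \<subseteq> S))\<^sup>2)"
    using add_cost_bounds by (intro E_mono power_mono) auto
  also have "\<dots> = E (\<lambda>S. \<Sum>B\<in>\<A>. \<Sum>C\<in>\<A>. of_bool (A \<inter> B \<noteq> {}) * of_bool (A \<inter> C \<noteq> {}) * of_bool (B \<union> C - A \<subseteq> S))"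
    unfolding power2_eq_square sum_product by (intro bern_exp_cong sum.cong refl) (auto simp: of_bool_def)
  also have "\<dots> = (\<Sum>B\<in>\<A>. \<Sum>C\<in>\<A>. of_bool (A \<inter> B \<noteq> {}) * of_bool (A \<inter> C \<noteq> {}) * prod p (B \<union> C - A))"
    unfolding bern_exp_sum bern_exp_cmult using \<A>_sub by (intro sum.cong refl) (subst E_subset, auto)
  finally have "prod p A * E (\<lambda>S. (add_cost A S)\<^sup>2) \<le> prod p A * \<dots>"
    using prod_p_bounds by (intro mult_left_mono) auto
  also have "\<dots> \<le> (\<Sum>B\<in>\<A>. \<Sum>C\<in>\<A>. of_bool (A \<inter> B \<noteq> {}) * of_bool ((A \<union> B) \<inter> C \<noteq> {}) * prod p (A \<union> B \<union> C))"
    unfolding sum_distrib_left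
  proof (intro sum_mono)
    fix B C assume BC: "B \<in> \<A>" "C \<in> \<A>"
    have "prod p A * prod p (B \<union> C - A) = prod p (A \<union> (B \<union> C - A))"
      using A BC finite_mem by (intro prod.union_disjoint[symmetric]) auto
    also have "A \<union> (B \<union> C - A) = A \<union> B \<union> C" by auto
    finally have eq: "prod p A * prod p (B \<union> C - A) = prod p (A \<union> B \<union> C)" .
    have "prod p A * (of_bool (A \<inter> B \<noteq> {}) * of_bool (A \<inter> C \<noteq> {}) * prod p (B \<union> C - A)) =
      of_bool (A \<inter> B \<noteq> {}) * of_bool (A \<inter> C \<noteq> {}) * prod p (A \<union> B \<union> C)"
      unfolding eq[symmetric] by (simp only: mult_ac)
    also have "\<dots> \<le> of_bool (A \<inter> B \<noteq> {}) * of_bool ((A \<union> B) \<inter> C \<noteq> {}) * prod p (A \<union> B \<union> C)"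
      using prod_p_bounds(1) by (intro mult_right_mono) auto
    finally show "prod p A * (of_bool (A \<inter> B \<noteq> {}) * of_bool (A \<inter> C \<noteq> {}) * prod p (B \<union> C - A))
       \<le> of_bool (A \<inter> B \<noteq> {}) * of_bool ((A \<union> B) \<inter> C \<noteq> {}) * prod p (A \<union> B \<union> C)" .
  qed
  finally show ?thesis .
qed

text \<open>Divided by the variance, this is the random coefficient of the derivative in the first
  order expansion of \<open>E (W * F (W))\<close>. Its mean is the variance, and its fluctuation is
  one of the two errors of the normal approximation.\<close>

definition stein_coeff :: "'a set \<Rightarrow> real" where
  "stein_coeff S = (\<Sum>A\<in>\<A>. prod p A * add_cost A S)"

lemma E_count_mult: "E (\<lambda>S. count S * g S) = (\<Sum>A\<in>\<A>. prod p A * E (\<lambda>S. g (S \<union> A)))"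
proof -
  have "E (\<lambda>S. count S * g S) = E (\<lambda>S. \<Sum>A\<in>\<A>. if A \<subseteq> S then g S else 0)"
    unfolding count_def sum_distrib_right by (intro bern_exp_cong sum.cong) auto
  also have "\<dots> = (\<Sum>A\<in>\<A>. prod p A * E (\<lambda>S. g (S \<union> A)))"
    unfolding bern_exp_sum using \<A>_sub finite_I by (intro sum.cong refl bern_exp_force) auto
  finally show ?thesis .
qed

text \<open>The size bias identity. Both the expectation of \<open>count * g\<close> and the product
  of expectations are sums with the same weights \<open>prod p A\<close>, so the centring turns
  \<open>g (S \<union> A)\<close> into an increment of \<open>g\<close>.\<close>

lemma E_centered_count_mult:
  "E (\<lambda>S. (count S - E count) * g S) = (\<Sum>A\<in>\<A>. prod p A * E (\<lambda>S. g (S \<union> A) - g S))"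
proof -
  have "E (\<lambda>S. (count S - E count) * g S) = E (\<lambda>S. count S * g S) - E count * E g"
    by (simp add: left_diff_distrib bern_exp_diff bern_exp_cmult)
  then show ?thesis
    by (simp add: E_count_mult E_count bern_exp_diff right_diff_distrib sum_subtractf sum_distrib_right)
qed

text \<open>The size bias identity for \<open>g = count\<close>.\<close>

lemma E_stein_coeff: "E stein_coeff = Var count"
proof -
  have "Var count = E (\<lambda>S. (count S - E count) * count S) - E count * E (\<lambda>S. count S - E count)"
    unfolding Var_eq by (simp add: power2_eq_square left_diff_distrib bern_exp_diff bern_exp_cmult E_const)
  also have "E (\<lambda>S. count S - E count) = 0" by (simp add: bern_exp_diff E_const)
  finally show ?thesis
    by (simp add: E_centered_count_mult stein_coeff_def[abs_def] bern_exp_sum bern_exp_cmult add_cost_def)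
qed

lemma prod_p_mult3_le:
  assumes "A \<in> \<A>" "C \<in> \<A>" "finite D"
  shows "prod p A * prod p C * prod p D \<le> prod p (A \<union> C \<union> D)"
proof -
  have "prod p A * prod p C * prod p D \<le> prod p (A \<union> C) * prod p D"
    using assms finite_mem prod_p_bounds by (intro mult_right_mono prod_p_mult_le) auto
  also have "\<dots> \<le> prod p (A \<union> C \<union> D)"
    using assms finite_mem by (intro prod_p_mult_le) auto
  finally show ?thesis .
qed

text \<open>The two inner sums over \<open>A'\<close> and \<open>B'\<close> are exchanged so that every set of the resulting
  chain \<open>A, B, B', A'\<close> meets the union of its predecessors.\<close>

lemma Var_pair_sum_le:
  assumes G: "\<And>A B. A \<in> \<A> \<Longrightarrow> B \<in> \<A> \<Longrightarrow> G A B \<subseteq> B" "\<And>A B. A \<in> \<A> \<Longrightarrow> B \<in> \<A> \<Longrightarrow> A \<union> G A B = A \<union> B"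
  shows "Var (\<lambda>S. \<Sum>u\<in>\<A>\<times>\<A>. (case u of (A, B) \<Rightarrow> prod p A * of_bool (A \<inter> B \<noteq> {})) *
     of_bool ((case u of (A, B) \<Rightarrow> G A B) \<subseteq> S)) \<le> chain4"
    (is "Var ?f \<le> _")
proof -
  let ?w = "\<lambda>A B. prod p A * of_bool (A \<inter> B \<noteq> {}) :: real"
  have "Var ?f \<le> (\<Sum>u\<in>\<A>\<times>\<A>. \<Sum>v\<in>\<A>\<times>\<A>.
      of_bool ((case u of (A, B) \<Rightarrow> G A B) \<inter> (case v of (A, B) \<Rightarrow> G A B) \<noteq> {}) *
      ((case u of (A, B) \<Rightarrow> ?w A B) * (case v of (A, B) \<Rightarrow> ?w A B) *
        prod p ((case u of (A, B) \<Rightarrow> G A B) \<union> (case v of (A, B) \<Rightarrow> G A B))))"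
    using \<A>_sub G(1) by (intro Var_sum_le) (fastforce intro!: mult_nonneg_nonneg prod_p_bounds)+
  also have "\<dots> = (\<Sum>A\<in>\<A>. \<Sum>B\<in>\<A>. \<Sum>A'\<in>\<A>. \<Sum>B'\<in>\<A>. of_bool (G A B \<inter> G A' B' \<noteq> {}) *
      (?w A B * ?w A' B' * prod p (G A B \<union> G A' B')))"
    unfolding sum.cartesian_product' by simp
  also have "\<dots> = (\<Sum>A\<in>\<A>. \<Sum>B\<in>\<A>. \<Sum>B'\<in>\<A>. \<Sum>A'\<in>\<A>. of_bool (G A B \<inter> G A' B' \<noteq> {}) *
      (?w A B * ?w A' B' * prod p (G A B \<union> G A' B')))"
    by (intro sum.cong refl sum.swap)
  also have "\<dots> \<le> chain4"
    unfolding chain4_def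
  proof (intro sum_mono)
    fix A B B' A' assume mem: "A \<in> \<A>" "B \<in> \<A>" "B' \<in> \<A>" "A' \<in> \<A>"
    let ?b = "of_bool (A \<inter> B \<noteq> {}) * of_bool ((A \<union> B) \<inter> B' \<noteq> {}) * of_bool ((A \<union> B \<union> B') \<inter> A' \<noteq> {}) :: real"
    show "of_bool (G A B \<inter> G A' B' \<noteq> {}) * (?w A B * ?w A' B' * prod p (G A B \<union> G A' B'))
       \<le> ?b * prod p (A \<union> B \<union> B' \<union> A')"
    proof (cases "G A B \<inter> G A' B' \<noteq> {} \<and> A \<inter> B \<noteq> {} \<and> A' \<inter> B' \<noteq> {}")
      case True
      have fin: "finite (G A B \<union> G A' B')" using G(1)[OF mem(1,2)] G(1)[OF mem(4,3)] mem finite_mem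
        by (meson finite_UnI finite_subset)
      \<comment> \<open>The sets \<open>G A B\<close> and \<open>G A' B'\<close> lie in
        \<open>B\<close> and \<open>B'\<close>, so a common site links \<open>B\<close> to
        \<open>B'\<close>; the indicator in the weight then links \<open>A'\<close> to
        \<open>B'\<close>.\<close>
      have "B \<inter> B' \<noteq> {}" using True G(1)[OF mem(1,2)] G(1)[OF mem(4,3)] by auto
      then have "?b = 1" using True by auto
      have "of_bool (G A B \<inter> G A' B' \<noteq> {}) * (?w A B * ?w A' B' * prod p (G A B \<union> G A' B'))
        = prod p A * prod p A' * prod p (G A B \<union> G A' B')" using True by simp
      also have "\<dots> \<le> prod p (A \<union> A' \<union> (G A B \<union> G A' B'))"
        by (rule prod_p_mult3_le[OF mem(1,4) fin])
      also have "A \<union> A' \<union> (G A B \<union> G A' B') = (A \<union> G A B) \<union> (A' \<union> G A' B')" by auto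
      also have "\<dots> = A \<union> B \<union> B' \<union> A'" using G(2)[OF mem(1,2)] G(2)[OF mem(4,3)] by auto
      finally show ?thesis unfolding \<open>?b = 1\<close> by simp
    next
      case False
      then have eq0: "of_bool (G A B \<inter> G A' B' \<noteq> {}) * (?w A B * ?w A' B' * prod p (G A B \<union> G A' B')) = 0"
        by auto
      show ?thesis unfolding eq0 by (intro mult_nonneg_nonneg prod_p_bounds(1)) auto
    qed
  qed
  finally show ?thesis .
qed

text \<open>By \<open>add_cost_eq\<close> the coefficient is a difference of two sums with
  nonnegative weights, over \<open>B - A\<close> and over \<open>B\<close>. Each has variance at
  most \<open>chain4\<close>, and the variance of a difference is at most twice the sum of the
  variances, hence the factor 4.\<close>

lemma Var_stein_coeff: "Var stein_coeff \<le> 4 * chain4"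
proof -
  define X where "X S = (\<Sum>u\<in>\<A>\<times>\<A>. (case u of (A, B) \<Rightarrow> prod p A * of_bool (A \<inter> B \<noteq> {})) *
     of_bool ((case u of (A, B) \<Rightarrow> B - A) \<subseteq> S))" for S
  define Y where "Y S = (\<Sum>u\<in>\<A>\<times>\<A>. (case u of (A, B) \<Rightarrow> prod p A * of_bool (A \<inter> B \<noteq> {})) *
     of_bool ((case u of (A, B) \<Rightarrow> B) \<subseteq> S))" for S
  have "stein_coeff S = X S - Y S" for S
    unfolding stein_coeff_def add_cost_eq X_def Y_def
    by (simp add: right_diff_distrib sum_subtractf sum_distrib_left sum.cartesian_product case_prod_unfold mult.assoc)
  then have "stein_coeff = (\<lambda>S. X S - Y S)" by auto
  then have "Var stein_coeff \<le> 2 * Var X + 2 * Var Y" using Var_diff_le by simp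
  moreover have "Var X \<le> chain4" unfolding X_def[abs_def] by (rule Var_pair_sum_le) auto
  moreover have "Var Y \<le> chain4" unfolding Y_def[abs_def] by (rule Var_pair_sum_le) auto
  ultimately show ?thesis by simp
qed

text \<open>Stein's equation turns the error into the expectation of
  \<open>F' (W) - W * F (W)\<close>. The size bias identity replaces \<open>W * F (W)\<close> by
  \<open>F' (W) * V\<close> up to a Taylor remainder, and \<open>V\<close> has mean 1; the two terms
  of the bound are the remainder and the fluctuation of \<open>V\<close>.\<close>

theorem stein_bound:
  fixes h :: "real \<Rightarrow> real"
  assumes h: "\<And>x. (h has_real_derivative h' x) (at x)" and h': "\<And>x. \<bar>h' x\<bar> \<le> 1"
    and var: "Var count > 0"
  defines "\<sigma> \<equiv> sqrt (Var count)"
  shows "\<bar>E (\<lambda>S. h ((count S - E count) / \<sigma>)) - integral\<^sup>L std_normal_distribution h\<bar>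
    \<le> 27 * (chain_const3 k m * T) / \<sigma> ^ 3 + 54 * sqrt (chain_const4 k m * T) / \<sigma>\<^sup>2"
proof -
  have \<sigma>: "\<sigma> > 0" "\<sigma>\<^sup>2 = Var count" using var by (simp_all add: \<sigma>_def)
  obtain F F' where F: "\<And>x. (F has_real_derivative F' x) (at x)" "\<And>x. \<bar>F' x\<bar> \<le> 27"
    "\<And>x y. \<bar>F' x - F' y\<bar> \<le> 27 * \<bar>x - y\<bar>"
    "\<And>x. F' x - x * F x = h x - integral\<^sup>L std_normal_distribution h"
    using stein_solution[OF h h'] by metis
  define W where "W S = (count S - E count) / \<sigma>" for S
  define V where "V S = stein_coeff S / \<sigma>\<^sup>2" for S
  have WA: "W (S \<union> A) = W S + add_cost A S / \<sigma>" for S A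
    using \<sigma> by (simp add: W_def add_cost_def field_simps)
  have "E (\<lambda>S. W S * F (W S)) = (1 / \<sigma>) * E (\<lambda>S. (count S - E count) * F (W S))"
    unfolding bern_exp_cmult[symmetric] by (simp add: W_def)
  also have "\<dots> = (1 / \<sigma>) * (\<Sum>A\<in>\<A>. prod p A * E (\<lambda>S. F (W S + add_cost A S / \<sigma>) - F (W S)))"
    by (simp add: E_centered_count_mult WA)
  finally have EWF: "E (\<lambda>S. W S * F (W S)) = \<dots>" .
  have "E (\<lambda>S. F' (W S) * V S) = (1 / \<sigma>) * (\<Sum>A\<in>\<A>. prod p A * E (\<lambda>S. F' (W S) * (add_cost A S / \<sigma>)))"
    unfolding V_def stein_coeff_def bern_exp_cmult[symmetric] bern_exp_sum[symmetric] sum_distrib_left sum_divide_distrib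
    using \<sigma> by (intro bern_exp_cong sum.cong refl) (simp add: power2_eq_square)
  with EWF have "E (\<lambda>S. W S * F (W S)) - E (\<lambda>S. F' (W S) * V S) = (1 / \<sigma>) * (\<Sum>A\<in>\<A>. prod p A *
      E (\<lambda>S. F (W S + add_cost A S / \<sigma>) - F (W S) - F' (W S) * (add_cost A S / \<sigma>)))"
    by (simp only: bern_exp_diff right_diff_distrib sum_subtractf)
  \<comment> \<open>The increment of \<open>W\<close> under forcing \<open>A\<close> is
    \<open>add_cost A S / \<sigma>\<close>, so the Taylor remainder is at most 27 times its
    square.\<close>
  also have "\<bar>\<dots>\<bar> \<le> (1 / \<sigma>) * (\<Sum>A\<in>\<A>. (27 / \<sigma>\<^sup>2) * (prod p A * E (\<lambda>S. (add_cost A S)\<^sup>2)))"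
    unfolding abs_mult
  proof (intro mult_mono sum_abs[THEN order_trans] sum_mono)
    fix A assume "A \<in> \<A>"
    have "\<bar>E (\<lambda>S. F (W S + add_cost A S / \<sigma>) - F (W S) - F' (W S) * (add_cost A S / \<sigma>))\<bar>
       \<le> E (\<lambda>S. \<bar>F (W S + add_cost A S / \<sigma>) - F (W S) - F' (W S) * (add_cost A S / \<sigma>)\<bar>)"
      by (rule E_abs)
    also have "\<dots> \<le> E (\<lambda>S. (27 / \<sigma>\<^sup>2) * (add_cost A S)\<^sup>2)"
    proof (rule E_mono)
      fix S
      show "\<bar>F (W S + add_cost A S / \<sigma>) - F (W S) - F' (W S) * (add_cost A S / \<sigma>)\<bar> \<le> (27 / \<sigma>\<^sup>2) * (add_cost A S)\<^sup>2"
        using taylor_lipschitz_derivative[OF F(1,3), of "W S" "add_cost A S / \<sigma>"] by (simp add: power_divide)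
    qed
    finally show "\<bar>prod p A * E (\<lambda>S. F (W S + add_cost A S / \<sigma>) - F (W S) - F' (W S) * (add_cost A S / \<sigma>))\<bar>
       \<le> (27 / \<sigma>\<^sup>2) * (prod p A * E (\<lambda>S. (add_cost A S)\<^sup>2))"
      using mult_left_mono[OF _ prod_p_bounds(1)[of A]] prod_p_bounds(1)[of A]
      unfolding bern_exp_cmult abs_mult by (simp only: abs_of_nonneg mult.left_commute)
  qed (use \<sigma> in \<open>auto intro!: sum_nonneg\<close>)
  also have "\<dots> \<le> (1 / \<sigma>) * ((27 / \<sigma>\<^sup>2) * chain3)"
    unfolding sum_distrib_left[symmetric] chain3_def
    using \<sigma> var by (intro mult_left_mono sum_mono E_add_cost_sq) auto
  also have "\<dots> \<le> (1 / \<sigma>) * ((27 / \<sigma>\<^sup>2) * (chain_const3 k m * T))"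
    using \<sigma> var by (intro mult_left_mono chain3_le') auto
  also have "\<dots> = 27 * (chain_const3 k m * T) / \<sigma> ^ 3"
    by (simp add: power2_eq_square power3_eq_cube)
  finally have 1: "\<bar>E (\<lambda>S. W S * F (W S)) - E (\<lambda>S. F' (W S) * V S)\<bar> \<le> 27 * (chain_const3 k m * T) / \<sigma> ^ 3" .
  \<comment> \<open>As \<open>V\<close> has mean 1 by \<open>E_stein_coeff\<close>, the
    Cauchy-Schwarz inequality bounds the mean of \<open>|V - 1|\<close> by a standard deviation. The
    constant 54 is \<open>27 * sqrt 4\<close>.\<close>
  have "\<bar>E (\<lambda>S. F' (W S) * (V S - 1))\<bar> \<le> E (\<lambda>S. \<bar>F' (W S) * (V S - 1)\<bar>)" by (rule E_abs)
  also have "\<dots> \<le> E (\<lambda>S. (27 / \<sigma>\<^sup>2) * \<bar>stein_coeff S - E stein_coeff\<bar>)"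
  proof (rule E_mono)
    fix S
    have "V S - 1 = (stein_coeff S - E stein_coeff) / \<sigma>\<^sup>2"
      using var by (simp add: V_def E_stein_coeff \<sigma>(2) diff_divide_distrib)
    moreover have "\<bar>F' (W S)\<bar> * (\<bar>stein_coeff S - E stein_coeff\<bar> / \<sigma>\<^sup>2) \<le> 27 * (\<bar>stein_coeff S - E stein_coeff\<bar> / \<sigma>\<^sup>2)"
      using F(2) by (intro mult_right_mono) auto
    ultimately show "\<bar>F' (W S) * (V S - 1)\<bar> \<le> (27 / \<sigma>\<^sup>2) * \<bar>stein_coeff S - E stein_coeff\<bar>"
      by (simp add: abs_mult abs_div)
  qed
  also have "\<dots> \<le> (27 / \<sigma>\<^sup>2) * sqrt (Var stein_coeff)"
    unfolding bern_exp_cmult Var_def using \<sigma> var by (intro mult_left_mono E_abs_sqrt) auto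
  also have "\<dots> \<le> (27 / \<sigma>\<^sup>2) * sqrt (4 * (chain_const4 k m * T))"
    using Var_stein_coeff chain4_le' \<sigma> var by (intro mult_left_mono real_sqrt_le_mono) auto
  also have "\<dots> = 54 * sqrt (chain_const4 k m * T) / \<sigma>\<^sup>2"
    by (simp add: real_sqrt_mult)
  finally have 2: "\<bar>E (\<lambda>S. F' (W S) * (V S - 1))\<bar> \<le> 54 * sqrt (chain_const4 k m * T) / \<sigma>\<^sup>2" .
  have "E (\<lambda>S. h (W S)) - integral\<^sup>L std_normal_distribution h
      = E (\<lambda>S. h (W S) - integral\<^sup>L std_normal_distribution h)"
    by (simp add: bern_exp_diff E_const)
  also have "\<dots> = E (\<lambda>S. F' (W S) - W S * F (W S))" unfolding F(4) ..
  also have "\<dots> = - (E (\<lambda>S. W S * F (W S)) - E (\<lambda>S. F' (W S) * V S)) - E (\<lambda>S. F' (W S) * (V S - 1))"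
    by (simp add: bern_exp_diff right_diff_distrib)
  finally show ?thesis using 1 2 unfolding W_def by linarith
qed

end

section \<open>Poisson processes and clique counts\<close>

context poisson_process
begin

text \<open>Measurability of a count is part of the independence assumption, applied to a family
  consisting of a single set.\<close>

lemma count_measurable [measurable]:
  assumes "B \<in> sets \<mu>" shows "(\<lambda>\<omega>. emeasure (\<eta> \<omega>) B) \<in> borel_measurable M"
proof -
  have "indep_vars (\<lambda>_. borel) (\<lambda>i \<omega>. emeasure (\<eta> \<omega>) B) {..<Suc 0}"
    using assms by (intro indep_counts) (auto simp: disjoint_family_on_def)
  then have "\<forall>i\<in>{..<Suc 0}. random_variable borel (\<lambda>\<omega>. emeasure (\<eta> \<omega>) B)"
    unfolding indep_vars_def2 by (rule conjunct1)
  then show ?thesis by blast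
qed

lemma proper:
  assumes single: "\<And>z. z \<in> space \<mu> \<Longrightarrow> {z} \<in> sets \<mu>"
  obtains \<kappa> :: "'w \<Rightarrow> enat" and Z :: "nat \<Rightarrow> 'w \<Rightarrow> 'a" where
    "\<kappa> \<in> measurable M (count_space UNIV)" "\<And>n. Z n \<in> measurable M \<mu>"
    "\<And>\<omega>. \<omega> \<in> space M \<Longrightarrow> points (\<eta> \<omega>) = {Z n \<omega> |n. enat n < \<kappa> \<omega>}"
    "\<And>\<omega> B. \<omega> \<in> space M \<Longrightarrow> B \<in> sets \<mu> \<Longrightarrow>
       emeasure (\<eta> \<omega>) B = emeasure (count_space UNIV) {n. enat n < \<kappa> \<omega> \<and> Z n \<omega> \<in> B}"
proof -
  from point_process[unfolded point_process_def]
  obtain \<kappa> :: "'w \<Rightarrow> enat" and Z :: "nat \<Rightarrow> 'w \<Rightarrow> 'a" where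
    \<kappa>: "\<kappa> \<in> measurable M (count_space UNIV)" and Z0: "\<forall>n. Z n \<in> measurable M \<mu>" and
    *: "\<forall>\<omega>\<in>space M. sets (\<eta> \<omega>) = sets \<mu> \<and> (\<forall>B\<in>sets \<mu>.
       emeasure (\<eta> \<omega>) B = emeasure (count_space UNIV) {n. enat n < \<kappa> \<omega> \<and> Z n \<omega> \<in> B})"
    by (elim exE conjE)
  have Z: "Z n \<in> measurable M \<mu>" for n using Z0 by (rule spec)
  have sets: "sets (\<eta> \<omega>) = sets \<mu>" if "\<omega> \<in> space M" for \<omega>
    using bspec[OF * that] by (rule conjunct1)
  have em: "emeasure (\<eta> \<omega>) B = emeasure (count_space UNIV) {n. enat n < \<kappa> \<omega> \<and> Z n \<omega> \<in> B}"
    if "\<omega> \<in> space M" "B \<in> sets \<mu>" for \<omega> B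
    using bspec[OF conjunct2[OF bspec[OF * that(1)]] that(2)] .
  have pts: "points (\<eta> \<omega>) = {Z n \<omega> |n. enat n < \<kappa> \<omega>}" if \<omega>: "\<omega> \<in> space M" for \<omega>
  proof (intro set_eqI iffI)
    fix z assume "z \<in> points (\<eta> \<omega>)"
    then have pos: "emeasure (\<eta> \<omega>) {z} \<noteq> 0" by (simp add: points_def)
    \<comment> \<open>A set that is not measurable has measure 0 by default, so a positive value
      forces measurability.\<close>
    then have "{z} \<in> sets \<mu>" using emeasure_neq_0_sets sets[OF \<omega>] by blast
    have "{n. enat n < \<kappa> \<omega> \<and> Z n \<omega> \<in> {z}} \<noteq> {}"
    proof
      assume "{n. enat n < \<kappa> \<omega> \<and> Z n \<omega> \<in> {z}} = {}"
      with em[OF \<omega> \<open>{z} \<in> sets \<mu>\<close>] pos show False by (simp only: emeasure_empty)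
    qed
    then show "z \<in> {Z n \<omega> |n. enat n < \<kappa> \<omega>}" by auto
  next
    fix z assume "z \<in> {Z n \<omega> |n. enat n < \<kappa> \<omega>}"
    then obtain n where n: "z = Z n \<omega>" "enat n < \<kappa> \<omega>" by auto
    then have "{z} \<in> sets \<mu>" using single measurable_space[OF Z \<omega>] by auto
    moreover have "{n. enat n < \<kappa> \<omega> \<and> Z n \<omega> \<in> {z}} \<noteq> {}" using n by auto
    ultimately show "z \<in> points (\<eta> \<omega>)"
      unfolding points_def using em[OF \<omega>] by (simp add: emeasure_count_space zero_less_iff_neq_zero)
  qed
  show ?thesis by (rule that[OF \<kappa> Z pts em])
qed

text \<open>Only an inequality, since points of the process may coincide and are then counted with
  multiplicity.\<close>

lemma points_card:
  assumes single: "\<And>z. z \<in> space \<mu> \<Longrightarrow> {z} \<in> sets \<mu>"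
    and \<omega>: "\<omega> \<in> space M" and B: "B \<in> sets \<mu>" and fin: "emeasure (\<eta> \<omega>) B < \<infinity>"
  shows "finite (points (\<eta> \<omega>) \<inter> B)" "of_nat (card (points (\<eta> \<omega>) \<inter> B)) \<le> emeasure (\<eta> \<omega>) B"
proof -
  obtain \<kappa> :: "'w \<Rightarrow> enat" and Z :: "nat \<Rightarrow> 'w \<Rightarrow> 'a" where
    "\<kappa> \<in> measurable M (count_space UNIV)" and Z: "\<And>n. Z n \<in> measurable M \<mu>" and
    pts: "\<And>\<omega>. \<omega> \<in> space M \<Longrightarrow> points (\<eta> \<omega>) = {Z n \<omega> |n. enat n < \<kappa> \<omega>}" and
    em: "\<And>\<omega> B. \<omega> \<in> space M \<Longrightarrow> B \<in> sets \<mu> \<Longrightarrow>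
       emeasure (\<eta> \<omega>) B = emeasure (count_space UNIV) {n. enat n < \<kappa> \<omega> \<and> Z n \<omega> \<in> B}"
    by (rule proper, erule single) (rule that; assumption)
  let ?N = "{n. enat n < \<kappa> \<omega> \<and> Z n \<omega> \<in> B}"
  have eq: "points (\<eta> \<omega>) \<inter> B = (\<lambda>n. Z n \<omega>) ` ?N" using pts[OF \<omega>] by auto
  have f: "finite ?N" using fin unfolding em[OF \<omega> B] by (auto simp: emeasure_count_space split: if_splits)
  show "finite (points (\<eta> \<omega>) \<inter> B)" unfolding eq using f by simp
  show "of_nat (card (points (\<eta> \<omega>) \<inter> B)) \<le> emeasure (\<eta> \<omega>) B"
    unfolding eq em[OF \<omega> B] using f card_image_le[OF f] by (simp add: emeasure_count_space)
qed

lemma points_empty_iff: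
  assumes single: "\<And>z. z \<in> space \<mu> \<Longrightarrow> {z} \<in> sets \<mu>"
    and \<omega>: "\<omega> \<in> space M" and B: "B \<in> sets \<mu>"
  shows "emeasure (\<eta> \<omega>) B = 0 \<longleftrightarrow> points (\<eta> \<omega>) \<inter> B = {}"
proof -
  obtain \<kappa> :: "'w \<Rightarrow> enat" and Z :: "nat \<Rightarrow> 'w \<Rightarrow> 'a" where
    "\<kappa> \<in> measurable M (count_space UNIV)" and Z: "\<And>n. Z n \<in> measurable M \<mu>" and
    pts: "\<And>\<omega>. \<omega> \<in> space M \<Longrightarrow> points (\<eta> \<omega>) = {Z n \<omega> |n. enat n < \<kappa> \<omega>}" and
    em: "\<And>\<omega> B. \<omega> \<in> space M \<Longrightarrow> B \<in> sets \<mu> \<Longrightarrow>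
       emeasure (\<eta> \<omega>) B = emeasure (count_space UNIV) {n. enat n < \<kappa> \<omega> \<and> Z n \<omega> \<in> B}"
    by (rule proper, erule single) (rule that; assumption)
  have *: "emeasure (count_space UNIV) N = 0 \<longleftrightarrow> N = {}" for N :: "nat set"
    by (cases "finite N") auto
  show ?thesis unfolding em[OF \<omega> B] pts[OF \<omega>] * by blast
qed

lemma points_subset:
  assumes single: "\<And>z. z \<in> space \<mu> \<Longrightarrow> {z} \<in> sets \<mu>" and \<omega>: "\<omega> \<in> space M"
  shows "points (\<eta> \<omega>) \<subseteq> space \<mu>"
proof -
  obtain \<kappa> :: "'w \<Rightarrow> enat" and Z :: "nat \<Rightarrow> 'w \<Rightarrow> 'a" where
    "\<kappa> \<in> measurable M (count_space UNIV)" and Z: "\<And>n. Z n \<in> measurable M \<mu>" and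
    pts: "\<And>\<omega>. \<omega> \<in> space M \<Longrightarrow> points (\<eta> \<omega>) = {Z n \<omega> |n. enat n < \<kappa> \<omega>}" and
    em: "\<And>\<omega> B. \<omega> \<in> space M \<Longrightarrow> B \<in> sets \<mu> \<Longrightarrow>
       emeasure (\<eta> \<omega>) B = emeasure (count_space UNIV) {n. enat n < \<kappa> \<omega> \<and> Z n \<omega> \<in> B}"
    by (rule proper, erule single) (rule that; assumption)
  show ?thesis unfolding pts[OF \<omega>] using measurable_space[OF Z \<omega>] by auto
qed

lemma prob_count_0:
  assumes "B \<in> sets \<mu>" "emeasure \<mu> B < \<infinity>"
  shows "prob {\<omega> \<in> space M. emeasure (\<eta> \<omega>) B = 0} = exp (- measure \<mu> B)"
  using poisson_count[OF assms, of 0] by simp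

text \<open>From \<open>exp (- m) >= 1 - m\<close> follows
  \<open>1 - (1 + m) * exp (- m) <= 1 - (1 + m) * (1 - m)\<close>. That the bound is quadratic
  matters: summed over a partition into small sets it becomes negligible.\<close>

lemma prob_count_ge_2:
  assumes B: "B \<in> sets \<mu>" "emeasure \<mu> B < \<infinity>"
  shows "prob {\<omega> \<in> space M. emeasure (\<eta> \<omega>) B \<noteq> 0 \<and> emeasure (\<eta> \<omega>) B \<noteq> 1} \<le> (measure \<mu> B)\<^sup>2"
proof -
  let ?m = "measure \<mu> B"
  let ?A = "\<lambda>n. {\<omega> \<in> space M. emeasure (\<eta> \<omega>) B = of_nat n}"
  have meas: "?A n \<in> events" for n using B(1) by measurable
  have "{\<omega> \<in> space M. emeasure (\<eta> \<omega>) B \<noteq> 0 \<and> emeasure (\<eta> \<omega>) B \<noteq> 1} = space M - (?A 0 \<union> ?A 1)"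
    by auto
  moreover have "?A 0 \<union> ?A 1 \<in> events" using meas by (intro sets.Un)
  ultimately have "prob {\<omega> \<in> space M. emeasure (\<eta> \<omega>) B \<noteq> 0 \<and> emeasure (\<eta> \<omega>) B \<noteq> 1} = 1 - prob (?A 0 \<union> ?A 1)"
    by (simp only: prob_compl)
  also have "prob (?A 0 \<union> ?A 1) = prob (?A 0) + prob (?A 1)"
    using meas[of 0] meas[of 1] by (intro finite_measure_Union) auto
  also have "prob (?A 0) = exp (- ?m)" using poisson_count[OF B, of 0] by simp
  also have "prob (?A 1) = ?m * exp (- ?m)" using poisson_count[OF B, of 1] by simp
  also have "1 - (exp (- ?m) + ?m * exp (- ?m)) \<le> ?m\<^sup>2"
  proof -
    have "(1 + ?m) * (1 + - ?m) \<le> (1 + ?m) * exp (- ?m)"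
      by (intro mult_left_mono exp_ge_add_one_self) auto
    then show ?thesis by (simp add: algebra_simps power2_eq_square)
  qed
  finally show ?thesis .
qed

text \<open>The Poisson weights add up to 1, so the count is almost surely finite; the generating
  function of the Poisson law is finite at every \<open>a\<close>. The value \<open>a = 4\<close>
  gives the square of the dominating function used in the limit.\<close>

lemma nn_integral_power_count:
  assumes B: "B \<in> sets \<mu>" "emeasure \<mu> B < \<infinity>" and a: "a > 0"
  shows "AE \<omega> in M. emeasure (\<eta> \<omega>) B < \<infinity>"
    and "integrable M (\<lambda>\<omega>. a powr enn2real (emeasure (\<eta> \<omega>) B))"
proof -
  let ?m = "measure \<mu> B"
  let ?A = "\<lambda>n. {\<omega> \<in> space M. emeasure (\<eta> \<omega>) B = of_nat n}"
  have meas [measurable]: "?A n \<in> events" for n using B(1) by measurable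
  have sums: "(\<lambda>n. (b * ?m) ^ n / fact n * exp (- ?m)) sums (exp (b * ?m) * exp (- ?m))" for b
    using sums_mult2[OF exp_converges[of "b * ?m"], of "exp (- ?m)"] by (simp add: divide_inverse mult_ac)
  have sums1: "(\<lambda>n. prob (?A n)) sums 1"
    using sums[of 1] poisson_count[OF B] by (simp add: exp_minus)
  have "(\<lambda>n. prob (?A n)) sums prob (\<Union>n. ?A n)"
    by (intro finite_measure_UNION) (auto simp: disjoint_family_on_def)
  then have "prob (\<Union>n. ?A n) = 1" using sums1 sums_unique2 by blast
  then have AE: "AE \<omega> in M. \<omega> \<in> (\<Union>n. ?A n)" by (subst (asm) prob_eq_1) auto
  then show "AE \<omega> in M. emeasure (\<eta> \<omega>) B < \<infinity>" by eventually_elim (auto simp: of_nat_less_top)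
  have [measurable]: "(\<lambda>\<omega>. a powr enn2real (emeasure (\<eta> \<omega>) B)) \<in> borel_measurable M"
    using B by measurable
  have "(\<integral>\<^sup>+\<omega>. ennreal (a powr enn2real (emeasure (\<eta> \<omega>) B)) \<partial>M) =
    (\<integral>\<^sup>+\<omega>. (\<Sum>n. ennreal (a ^ n) * indicator (?A n) \<omega>) \<partial>M)"
  proof (rule nn_integral_cong_AE, rule AE_mp[OF AE], rule AE_I2, rule impI)
    fix \<omega> assume "\<omega> \<in> (\<Union>n. ?A n)"
    then obtain n where n: "\<omega> \<in> ?A n" by auto
    have "ennreal (a ^ i) * indicator (?A i) \<omega> = 0" if "i \<notin> {n}" for i
      using n that by (auto simp: indicator_def)
    then have "(\<Sum>i. ennreal (a ^ i) * indicator (?A i) \<omega>) = (\<Sum>i\<in>{n}. ennreal (a ^ i) * indicator (?A i) \<omega>)"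
      by (intro suminf_finite) simp_all
    also have "\<dots> = ennreal (a ^ n)" using n by simp
    also have "\<dots> = ennreal (a powr enn2real (emeasure (\<eta> \<omega>) B))"
    proof -
      have "enn2real (emeasure (\<eta> \<omega>) B) = real n" using n by simp
      then show ?thesis using a by (simp only: powr_realpow)
    qed
    finally show "ennreal (a powr enn2real (emeasure (\<eta> \<omega>) B)) = (\<Sum>n. ennreal (a ^ n) * indicator (?A n) \<omega>)" ..
  qed
  also have "\<dots> = (\<Sum>n. \<integral>\<^sup>+\<omega>. ennreal (a ^ n) * indicator (?A n) \<omega> \<partial>M)"
    by (rule nn_integral_suminf) auto
  also have "\<dots> = (\<Sum>n. ennreal ((a * ?m) ^ n / fact n * exp (- ?m)))"
  proof (intro suminf_cong)
    fix n
    have "(\<integral>\<^sup>+\<omega>. ennreal (a ^ n) * indicator (?A n) \<omega> \<partial>M) = ennreal (a ^ n) * ennreal (prob (?A n))"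
      by (simp add: nn_integral_cmult_indicator emeasure_eq_measure)
    also have "\<dots> = ennreal ((a * ?m) ^ n / fact n * exp (- ?m))"
      unfolding poisson_count[OF B] using a
      by (subst ennreal_mult[symmetric]) (auto simp: power_mult_distrib)
    finally show "(\<integral>\<^sup>+\<omega>. ennreal (a ^ n) * indicator (?A n) \<omega> \<partial>M) = ennreal ((a * ?m) ^ n / fact n * exp (- ?m))" .
  qed
  also have "\<dots> = ennreal (exp (a * ?m) * exp (- ?m))"
    using sums[of a] a by (subst suminf_ennreal2) (auto simp: sums_iff)
  finally show "integrable M (\<lambda>\<omega>. a powr enn2real (emeasure (\<eta> \<omega>) B))"
    by (intro integrableI_nonneg) auto
qed

text \<open>The only place where independence of the counts is used: disjoint cells are occupied
  independently, so the set of occupied cells follows the product Bernoulli law.\<close>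

lemma occupied_cells:
  fixes C :: "'c \<Rightarrow> 'a set"
  assumes V: "finite V" and C: "\<And>c. c \<in> V \<Longrightarrow> C c \<in> sets \<mu>" "\<And>c. c \<in> V \<Longrightarrow> emeasure \<mu> (C c) < \<infinity>"
    and disj: "disjoint_family_on C V"
    and p: "\<And>c. c \<in> V \<Longrightarrow> p c = 1 - exp (- measure \<mu> (C c))"
  defines "occ \<equiv> \<lambda>\<omega>. {c \<in> V. emeasure (\<eta> \<omega>) (C c) \<noteq> 0}"
  shows "(\<lambda>\<omega>. g (occ \<omega>) :: real) \<in> borel_measurable M" "(\<integral>\<omega>. g (occ \<omega>) \<partial>M) = bern_exp p V g"
proof -
  \<comment> \<open>Independence is assumed for families indexed by initial segments of the
    naturals, so the cells are enumerated.\<close>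
  obtain b where b: "bij_betw b {..<card V} V"
    using ex_bij_betw_nat_finite[OF V] by (auto simp: atLeast0LessThan)
  have bV: "b i \<in> V" if "i < card V" for i using b that by (auto simp: bij_betw_def)
  have ind: "indep_vars (\<lambda>_. borel) (\<lambda>i \<omega>. emeasure (\<eta> \<omega>) (C (b i))) {..<card V}"
  proof (rule indep_counts)
    show "disjoint_family_on (\<lambda>i. C (b i)) {..<card V}"
      using disj b bV unfolding disjoint_family_on_def bij_betw_def inj_on_def by blast
  qed (use C bV in auto)
  have occ_prob: "{\<omega> \<in> space M. occ \<omega> = S} \<in> events \<and> prob {\<omega> \<in> space M. occ \<omega> = S} = bern_weight p V S"
    if S: "S \<subseteq> V" for S
  proof -
    define X :: "'c \<Rightarrow> ennreal set" where "X c = (if c \<in> S then - {0} else {0})" for c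
    have X: "X c \<in> sets borel" for c by (simp add: X_def)
    define Y where "Y c = {\<omega> \<in> space M. emeasure (\<eta> \<omega>) (C c) \<in> X c}" for c
    have Y: "Y c \<in> events" if "c \<in> V" for c unfolding Y_def using C(1)[OF that] X by measurable
    have PY: "prob (Y c) = (if c \<in> S then p c else 1 - p c)" if c: "c \<in> V" for c
    proof (cases "c \<in> S")
      case False
      then have "Y c = {\<omega> \<in> space M. emeasure (\<eta> \<omega>) (C c) = 0}" by (auto simp: Y_def X_def)
      then show ?thesis using False prob_count_0[OF C(1)[OF c] C(2)[OF c]] p[OF c] by simp
    next
      case True
      have e: "{\<omega> \<in> space M. emeasure (\<eta> \<omega>) (C c) = 0} \<in> events" using C(1)[OF c] by measurable
      have "Y c = space M - {\<omega> \<in> space M. emeasure (\<eta> \<omega>) (C c) = 0}" using True by (auto simp: Y_def X_def)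
      then have "prob (Y c) = 1 - prob {\<omega> \<in> space M. emeasure (\<eta> \<omega>) (C c) = 0}"
        using prob_compl[OF e] by simp
      then show ?thesis using True prob_count_0[OF C(1)[OF c] C(2)[OF c]] p[OF c] by simp
    qed
    show ?thesis
    \<comment> \<open>The product formula for independent variables requires a nonempty index
      set.\<close>
    proof (cases "V = {}")
      case True
      then have "{\<omega> \<in> space M. occ \<omega> = S} = space M" using S by (auto simp: occ_def)
      then show ?thesis using True S by (simp add: bern_weight_def prob_space)
    next
      case False
      have "card V \<noteq> 0" using False V by simp
      then have ne: "{..<card V} \<noteq> {}" by (metis lessThan_iff empty_iff gr0I)
      have eq: "{\<omega> \<in> space M. occ \<omega> = S} = (\<Inter>c\<in>V. Y c)"
      proof (intro set_eqI iffI)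
        fix \<omega> assume "\<omega> \<in> (\<Inter>c\<in>V. Y c)"
        then have "\<omega> \<in> space M" "\<And>c. c \<in> V \<Longrightarrow> emeasure (\<eta> \<omega>) (C c) \<in> X c"
          using False by (auto simp: Y_def)
        then show "\<omega> \<in> {\<omega> \<in> space M. occ \<omega> = S}"
          using S by (force simp: occ_def X_def split: if_splits)
      qed (use S in \<open>auto simp: occ_def X_def Y_def\<close>)
      have "(\<Inter>c\<in>V. Y c) = (\<Inter>i\<in>{..<card V}. (\<lambda>\<omega>. emeasure (\<eta> \<omega>) (C (b i))) -` X (b i) \<inter> space M)"
      proof -
        have Y': "Y c = (\<lambda>\<omega>. emeasure (\<eta> \<omega>) (C c)) -` X c \<inter> space M" for c by (auto simp: Y_def)
        have "(\<Inter>i\<in>{..<card V}. Y (b i)) = (\<Inter>c\<in>b ` {..<card V}. Y c)" by simp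
        also have "b ` {..<card V} = V" by (rule bij_betw_imp_surj_on[OF b])
        finally show ?thesis unfolding Y' ..
      qed
      also have "prob \<dots> = (\<Prod>i\<in>{..<card V}. prob ((\<lambda>\<omega>. emeasure (\<eta> \<omega>) (C (b i))) -` X (b i) \<inter> space M))"
        using X ne by (intro indep_varsD[OF ind]) auto
      also have "\<dots> = (\<Prod>i\<in>{..<card V}. prob (Y (b i)))"
        by (intro prod.cong refl arg_cong[where f = prob]) (auto simp: Y_def)
      also have "\<dots> = (\<Prod>c\<in>V. prob (Y c))"
        by (rule prod.reindex_bij_betw[OF b])
      also have "\<dots> = (\<Prod>c\<in>V. if c \<in> S then p c else 1 - p c)"
        using PY by (intro prod.cong) auto
      also have "\<dots> = bern_weight p V S"
      proof -
        have "V = S \<union> (V - S)" using S by auto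
        then have "(\<Prod>c\<in>V. if c \<in> S then p c else 1 - p c) =
          (\<Prod>c\<in>S. if c \<in> S then p c else 1 - p c) * (\<Prod>c\<in>V - S. if c \<in> S then p c else 1 - p c)"
          using V S by (metis (no_types, lifting) prod.subset_diff mult.commute)
        then show ?thesis by (simp add: bern_weight_def)
      qed
      finally show ?thesis unfolding eq using V False Y by auto
    qed
  qed
  have rep: "g (occ \<omega>) = (\<Sum>S\<in>Pow V. g S * indicator {\<omega> \<in> space M. occ \<omega> = S} \<omega>)" if "\<omega> \<in> space M" for \<omega>
  proof -
    have "(\<Sum>S\<in>Pow V. g S * indicator {\<omega> \<in> space M. occ \<omega> = S} \<omega>) = (\<Sum>S\<in>Pow V. if S = occ \<omega> then g S else 0)"
      using that by (intro sum.cong) (auto simp: indicator_def)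
    also have "\<dots> = g (occ \<omega>)" using V by (subst sum.delta) (auto simp: occ_def)
    finally show ?thesis by simp
  qed
  have m: "(\<lambda>\<omega>. \<Sum>S\<in>Pow V. g S * indicator {\<omega> \<in> space M. occ \<omega> = S} \<omega>) \<in> borel_measurable M"
    using occ_prob by (intro borel_measurable_sum borel_measurable_times borel_measurable_indicator) auto
  then show "(\<lambda>\<omega>. g (occ \<omega>)) \<in> borel_measurable M"
    using rep by (subst measurable_cong[OF rep]) auto
  have "(\<integral>\<omega>. g (occ \<omega>) \<partial>M) = (\<integral>\<omega>. (\<Sum>S\<in>Pow V. g S * indicator {\<omega> \<in> space M. occ \<omega> = S} \<omega>) \<partial>M)"
    using rep by (intro Bochner_Integration.integral_cong) auto
  also have "\<dots> = (\<Sum>S\<in>Pow V. \<integral>\<omega>. g S * indicator {\<omega> \<in> space M. occ \<omega> = S} \<omega> \<partial>M)"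
  proof (intro Bochner_Integration.integral_sum integrable_mult_right)
    fix S assume "S \<in> Pow V"
    then show "integrable M (indicat_real {\<omega> \<in> space M. occ \<omega> = S})"
      using occ_prob[of S] by (intro integrable_real_indicator) (auto simp: emeasure_eq_measure)
  qed
  also have "\<dots> = (\<Sum>S\<in>Pow V. g S * bern_weight p V S)"
    using occ_prob by (intro sum.cong refl) (auto simp: inf.absorb1)
  finally show "(\<integral>\<omega>. g (occ \<omega>) \<partial>M) = bern_exp p V g"
    by (simp add: bern_exp_def mult.commute)
qed

end

section \<open>Cliques as sets of marked points, and measurability of their number\<close>

definition clique_sets :: "nat \<Rightarrow> ('v::real_normed_vector \<times> real) set \<Rightarrow> ('v \<times> real) set set" where
  "clique_sets k P = {B. B \<subseteq> P \<and> card B = k \<and>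
     (\<forall>z\<in>B. \<forall>z'\<in>B. z \<noteq> z' \<longrightarrow> norm (fst z - fst z') \<le> min (snd z) (snd z'))}"

lemma vec_nth_measurable [measurable]: "(\<lambda>x :: real ^ 'n. x $ j) \<in> borel_measurable borel"
  by (intro borel_measurable_continuous_onI continuous_intros)

text \<open>Projection to the locations is a bijection from sets of marked points to the sets
  counted. Injectivity of \<open>fst\<close> makes the radius of a location unique, and nonnegative
  radii supply the diagonal condition \<open>0 <= R x\<close>, which \<open>clique_sets\<close>
  omits.\<close>

lemma num_cliques_eq_card:
  fixes m :: "((real ^ 'n) \<times> real) measure" and t :: real
  defines "P \<equiv> points m \<inter> (window t \<times> UNIV)"
  assumes fin: "finite P" and inj: "inj_on fst P" and nonneg: "\<And>z. z \<in> P \<Longrightarrow> 0 \<le> snd z"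
  shows "num_cliques k t m = card (clique_sets k P)"
proof -
  let ?N = "{A. A \<subseteq> window t \<and> finite A \<and> card A = k \<and>
     (\<exists>R. (\<forall>x\<in>A. (x, R x) \<in> points m) \<and> (\<forall>x\<in>A. \<forall>y\<in>A. norm (x - y) \<le> R x))}"
  have "bij_betw ((`) fst) (clique_sets k P) ?N"
    unfolding bij_betw_def
  proof (intro conjI equalityI subsetI)
    show "inj_on ((`) fst) (clique_sets k P)"
    proof (rule inj_onI)
      fix B B' assume "B \<in> clique_sets k P" "B' \<in> clique_sets k P" "fst ` B = fst ` B'"
      then show "B = B'" using inj unfolding clique_sets_def
        by (metis (no_types, lifting) inj_on_image_eq_iff mem_Collect_eq)
    qed
  next
    fix A assume "A \<in> (`) fst ` clique_sets k P"
    then obtain B where B0: "B \<in> clique_sets k P" and A: "A = fst ` B" by (rule imageE)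
    have B: "B \<subseteq> P" "card B = k" using B0 by (simp_all add: clique_sets_def)
    have adj: "norm (fst z - fst z') \<le> min (snd z) (snd z')" if "z \<in> B" "z' \<in> B" "z \<noteq> z'" for z z'
      using B0 that unfolding clique_sets_def by blast
    have injB: "inj_on fst B" using inj B inj_on_subset by blast
    define R where "R x = snd (the_inv_into B fst x)" for x
    have R: "R (fst z) = snd z" if "z \<in> B" for z
      unfolding R_def using the_inv_into_f_f[OF injB that] by simp
    have "card A = k" using B A injB card_image by auto
    moreover have "\<forall>x\<in>A. (x, R x) \<in> points m"
      using B A R by (auto simp: P_def)
    moreover have "\<forall>x\<in>A. \<forall>y\<in>A. norm (x - y) \<le> R x"
    proof (intro ballI)
      fix x y assume "x \<in> A" "y \<in> A"
      then obtain z z' where z: "z \<in> B" "z' \<in> B" "x = fst z" "y = fst z'" using A by auto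
      show "norm (x - y) \<le> R x"
        using adj[OF z(1,2)] nonneg[of z] B z R by (cases "z = z'") auto
    qed
    moreover have "A \<subseteq> window t" "finite A" using A B fin finite_subset[OF B(1) fin] by (auto simp: P_def)
    ultimately show "A \<in> ?N" by blast
  next
    fix A assume N: "A \<in> ?N"
    then have A: "A \<subseteq> window t" "finite A" "card A = k" by simp_all
    from N have "\<exists>R. (\<forall>x\<in>A. (x, R x) \<in> points m) \<and> (\<forall>x\<in>A. \<forall>y\<in>A. norm (x - y) \<le> R x)" by simp
    then obtain R where R': "\<forall>x\<in>A. (x, R x) \<in> points m" "\<forall>x\<in>A. \<forall>y\<in>A. norm (x - y) \<le> R x"
      by (elim exE conjE)
    have R: "\<And>x. x \<in> A \<Longrightarrow> (x, R x) \<in> points m" "\<And>x y. x \<in> A \<Longrightarrow> y \<in> A \<Longrightarrow> norm (x - y) \<le> R x"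
      using R' by blast+
    let ?B = "(\<lambda>x. (x, R x)) ` A"
    have "card ?B = k" using A by (subst card_image) (auto simp: inj_on_def)
    moreover have "?B \<subseteq> P" using A R by (auto simp: P_def)
    moreover have "norm (x - y) \<le> min (R x) (R y)" if "x \<in> A" "y \<in> A" for x y
      using R(2)[OF that] R(2)[OF that(2,1)] by (simp add: norm_minus_commute)
    ultimately have "?B \<in> clique_sets k P" unfolding clique_sets_def by auto
    moreover have "A = fst ` ?B" by force
    ultimately show "A \<in> (`) fst ` clique_sets k P" by blast
  qed
  then show ?thesis unfolding num_cliques_def by (rule bij_betw_same_card[symmetric])
qed

locale poisson_cliques = poisson_process M "lborel \<Otimes>\<^sub>M \<nu>" \<eta> + \<nu>: prob_space \<nu>
  for M :: "'w measure" and \<nu> :: "real measure" and \<eta> :: "'w \<Rightarrow> ((real ^ 'n) \<times> real) measure" +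
  assumes sets_\<nu>: "sets \<nu> = sets (restrict_space borel {0..})"
begin

abbreviation \<mu> :: "((real ^ 'n) \<times> real) measure" where "\<mu> \<equiv> lborel \<Otimes>\<^sub>M \<nu>"

lemma space_\<nu>: "space \<nu> = {0..}"
  using sets_eq_imp_space_eq[OF sets_\<nu>] by (simp add: space_restrict_space)

lemma space_\<mu>: "space \<mu> = UNIV \<times> {0..}"
  by (simp add: space_pair_measure space_\<nu>)

lemma measurable_\<nu> [measurable]: "(\<lambda>r. r) \<in> borel_measurable \<nu>"
proof -
  have "(\<lambda>r. r) \<in> borel_measurable (restrict_space borel {0::real..})"
    by (rule measurable_restrict_space1) simp
  then show ?thesis using measurable_cong_sets[OF sets_\<nu> refl] by blast
qed

lemma snd_measurable [measurable]: "snd \<in> borel_measurable \<mu>"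
  using measurable_compose[OF measurable_snd measurable_\<nu>] by simp

lemma fst_measurable [measurable]: "fst \<in> borel_measurable \<mu>"
  using measurable_fst[of lborel \<nu>] by simp

lemma singleton_sets: "z \<in> space \<mu> \<Longrightarrow> {z} \<in> sets \<mu>"
proof -
  assume z: "z \<in> space \<mu>"
  have "{snd z} \<in> sets \<nu>"
    using z unfolding sets_\<nu> space_\<mu> by (auto simp: sets_restrict_space image_iff intro!: bexI[of _ "{snd z}"])
  then have "{fst z} \<times> {snd z} \<in> sets \<mu>" by (intro pair_measureI) auto
  also have "{fst z} \<times> {snd z} = {z}" by (cases z) auto
  finally show ?thesis .
qed

text \<open>Sets of locations are represented by lists of indices of points, a countable type.
  Coincidence of locations is expressed by vanishing norms, which makes validity of a list and
  equality of two location sets measurable events. The final identity holds for every outcome,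
  including those with infinitely many cliques, because \<open>card\<close> is then 0 on both
  sides.\<close>

lemma num_cliques_measurable [measurable]: "(\<lambda>\<omega>. num_cliques k t (\<eta> \<omega>)) \<in> measurable M (count_space UNIV)"
proof -
  obtain \<kappa> :: "'w \<Rightarrow> enat" and Z :: "nat \<Rightarrow> 'w \<Rightarrow> (real ^ 'n) \<times> real" where
    \<kappa> [measurable]: "\<kappa> \<in> measurable M (count_space UNIV)" and Z [measurable]: "\<And>n. Z n \<in> measurable M \<mu>" and
    pts: "\<And>\<omega>. \<omega> \<in> space M \<Longrightarrow> points (\<eta> \<omega>) = {Z n \<omega> |n. enat n < \<kappa> \<omega>}" and
    em: "\<And>\<omega> B. \<omega> \<in> space M \<Longrightarrow> B \<in> sets \<mu> \<Longrightarrow>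
       emeasure (\<eta> \<omega>) B = emeasure (count_space UNIV) {n. enat n < \<kappa> \<omega> \<and> Z n \<omega> \<in> B}"
    by (rule proper, erule singleton_sets) (rule that; assumption)
  define x where "x n \<omega> = fst (Z n \<omega>)" for n \<omega>
  define r where "r n \<omega> = snd (Z n \<omega>)" for n \<omega>
  have x [measurable]: "x n \<in> borel_measurable M" for n
    unfolding x_def using measurable_compose[OF Z fst_measurable] .
  have r [measurable]: "r n \<in> borel_measurable M" for n
    unfolding r_def using measurable_compose[OF Z snd_measurable] .
  define valid where "valid is \<omega> \<longleftrightarrow> length is = k \<and> (\<forall>i\<in>set is. enat i < \<kappa> \<omega>) \<and> (\<forall>i\<in>set is. x i \<omega> \<in> window t) \<and>
     (\<forall>a\<in>{..<k}. \<forall>b\<in>{..<k}. a \<noteq> b \<longrightarrow> norm (x (is ! a) \<omega> - x (is ! b) \<omega>) > 0) \<and>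
     (\<forall>i\<in>set is. \<forall>j\<in>set is. norm (x i \<omega> - x j \<omega>) \<le> r i \<omega>)" for "is" \<omega>
  define same where "same is js \<omega> \<longleftrightarrow> (\<forall>i\<in>set is. \<exists>j\<in>set js. norm (x i \<omega> - x j \<omega>) = 0) \<and>
     (\<forall>j\<in>set js. \<exists>i\<in>set is. norm (x j \<omega> - x i \<omega>) = 0)" for "is" js \<omega>
  have win: "x i \<omega> \<in> window t \<longleftrightarrow> (\<forall>j. - (t powr (1 / real CARD('n))) \<le> x i \<omega> $ j \<and> x i \<omega> $ j \<le> t powr (1 / real CARD('n)))" for i \<omega>
    by (simp add: window_def)
  have xj [measurable]: "(\<lambda>\<omega>. x i \<omega> $ j) \<in> borel_measurable M" for i j
    using measurable_compose[OF x vec_nth_measurable] .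
  have valid_m [measurable]: "{\<omega> \<in> space M. valid is \<omega>} \<in> sets M" for "is"
    unfolding valid_def win by measurable
  have same_m [measurable]: "{\<omega> \<in> space M. same is js \<omega>} \<in> sets M" for "is" js
    unfolding same_def by measurable
  \<comment> \<open>Each clique is counted at the smallest code among the valid lists that represent
    it.\<close>
  define Q where "Q \<omega> = {n. valid (from_nat n) \<omega> \<and> (\<forall>m<n. \<not> (valid (from_nat m) \<omega> \<and> same (from_nat m) (from_nat n) \<omega>))}" for \<omega>
  have Qm: "(\<lambda>\<omega>. card (Q \<omega>)) \<in> measurable M (count_space UNIV)"
  proof (rule measurable_card)
    fix n show "{\<omega> \<in> space M. n \<in> Q \<omega>} \<in> sets M"
      unfolding Q_def by simp measurable
  qed
  have eq: "num_cliques k t (\<eta> \<omega>) = card (Q \<omega>)" if \<omega>: "\<omega> \<in> space M" for \<omega>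
  proof -
    define pos where "pos is = (\<lambda>i. x i \<omega>) ` set is" for "is"
    have same: "same is js \<omega> \<longleftrightarrow> pos is = pos js" for "is" js
    proof -
      have "same is js \<omega> \<longleftrightarrow> (\<forall>i\<in>set is. x i \<omega> \<in> pos js) \<and> (\<forall>j\<in>set js. x j \<omega> \<in> pos is)"
        by (simp add: same_def pos_def image_iff)
      also have "\<dots> \<longleftrightarrow> pos is = pos js" unfolding pos_def by blast
      finally show ?thesis .
    qed
    let ?N = "{A. A \<subseteq> window t \<and> finite A \<and> card A = k \<and>
      (\<exists>R. (\<forall>x\<in>A. (x, R x) \<in> points (\<eta> \<omega>)) \<and> (\<forall>x\<in>A. \<forall>y\<in>A. norm (x - y) \<le> R x))}"
    have N: "?N = pos ` {is. valid is \<omega>}"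
    proof (intro equalityI subsetI)
      fix A assume N: "A \<in> ?N"
      then have A: "A \<subseteq> window t" "finite A" "card A = k" by simp_all
      from N have "\<exists>R. (\<forall>x\<in>A. (x, R x) \<in> points (\<eta> \<omega>)) \<and> (\<forall>x\<in>A. \<forall>y\<in>A. norm (x - y) \<le> R x)" by simp
      then obtain R where R': "\<forall>x\<in>A. (x, R x) \<in> points (\<eta> \<omega>)" "\<forall>x\<in>A. \<forall>y\<in>A. norm (x - y) \<le> R x"
        by (elim exE conjE)
      have R: "\<And>x. x \<in> A \<Longrightarrow> (x, R x) \<in> points (\<eta> \<omega>)" "\<And>x y. x \<in> A \<Longrightarrow> y \<in> A \<Longrightarrow> norm (x - y) \<le> R x"
        using R' by blast+
      have "\<exists>n. enat n < \<kappa> \<omega> \<and> Z n \<omega> = (a, R a)" if "a \<in> A" for a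
        using R(1)[OF that] unfolding pts[OF \<omega>] by auto
      then obtain f where f: "\<And>a. a \<in> A \<Longrightarrow> enat (f a) < \<kappa> \<omega> \<and> Z (f a) \<omega> = (a, R a)" by metis
      obtain ys where ys: "set ys = A" "distinct ys" using A(2) finite_distinct_list by blast
      have len: "length ys = k" using ys A(3) distinct_card by fastforce
      have xf: "x (f a) \<omega> = a" "r (f a) \<omega> = R a" if "a \<in> A" for a
        using f[OF that] by (auto simp: x_def r_def)
      have nth: "ys ! a \<in> A" if "a < k" for a using ys len that nth_mem by blast
      have "valid (map f ys) \<omega>"
        unfolding valid_def
      proof (intro conjI)
        show "\<forall>a\<in>{..<k}. \<forall>b\<in>{..<k}. a \<noteq> b \<longrightarrow> norm (x (map f ys ! a) \<omega> - x (map f ys ! b) \<omega>) > 0"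
        proof (intro ballI impI)
          fix a b assume ab: "a \<in> {..<k}" "b \<in> {..<k}" "a \<noteq> b"
          then have "ys ! a \<noteq> ys ! b" using ys(2) len by (simp add: nth_eq_iff_index_eq)
          then show "norm (x (map f ys ! a) \<omega> - x (map f ys ! b) \<omega>) > 0"
            using ab len xf nth by simp
        qed
      qed (use len ys f xf A(1) R(2) in auto)
      moreover have "pos (map f ys) = A" unfolding pos_def using ys xf by force
      ultimately show "A \<in> pos ` {is. valid is \<omega>}" by blast
    next
      fix A assume "A \<in> pos ` {is. valid is \<omega>}"
      then obtain "is" where v: "valid is \<omega>" and A: "A = pos is" by auto
      have len: "length is = k" using v by (simp add: valid_def)
      have xne: "x (is ! a) \<omega> \<noteq> x (is ! b) \<omega>" if "a < k" "b < k" "a \<noteq> b" for a b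
        using v that unfolding valid_def by fastforce
      have inj: "inj_on (\<lambda>i. x i \<omega>) (set is)"
      proof (rule inj_onI)
        fix i j assume "i \<in> set is" "j \<in> set is" "x i \<omega> = x j \<omega>"
        then show "i = j" using xne len by (metis in_set_conv_nth)
      qed
      have "distinct is" unfolding distinct_conv_nth using xne len by metis
      then have cA: "card A = k" unfolding A pos_def using card_image[OF inj] len distinct_card by metis
      define R where "R y = r (the_inv_into (set is) (\<lambda>i. x i \<omega>) y) \<omega>" for y
      have R: "R (x i \<omega>) = r i \<omega>" if "i \<in> set is" for i
        unfolding R_def using the_inv_into_f_f[OF inj that] by simp
      have "\<forall>y\<in>A. (y, R y) \<in> points (\<eta> \<omega>)"
      proof
        fix y assume "y \<in> A"
        then obtain i where i: "i \<in> set is" "y = x i \<omega>" by (auto simp: A pos_def)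
        then have "(y, R y) = Z i \<omega>" using R by (simp add: x_def r_def)
        moreover have "enat i < \<kappa> \<omega>" using v i by (simp add: valid_def)
        ultimately show "(y, R y) \<in> points (\<eta> \<omega>)" unfolding pts[OF \<omega>] by auto
      qed
      moreover have "\<forall>y\<in>A. \<forall>y'\<in>A. norm (y - y') \<le> R y"
        using v R by (auto simp: A pos_def valid_def)
      moreover have "A \<subseteq> window t" "finite A" using v by (auto simp: A pos_def valid_def)
      ultimately show "A \<in> ?N" using cA by blast
    qed
    have "bij_betw (\<lambda>n. pos (from_nat n)) (Q \<omega>) (pos ` {is. valid is \<omega>})"
      unfolding bij_betw_def
    proof (intro conjI equalityI subsetI)
      show "inj_on (\<lambda>n. pos (from_nat n)) (Q \<omega>)"
      proof (rule inj_onI)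
        fix m n assume mn: "m \<in> Q \<omega>" "n \<in> Q \<omega>" "pos (from_nat m) = pos (from_nat n)"
        show "m = n"
        proof (rule ccontr)
          assume "m \<noteq> n"
          then consider "m < n" | "n < m" by linarith
          then show False using mn unfolding Q_def same by cases auto
        qed
      qed
    next
      fix A assume "A \<in> (\<lambda>n. pos (from_nat n)) ` Q \<omega>"
      then show "A \<in> pos ` {is. valid is \<omega>}" unfolding Q_def by auto
    next
      fix A assume "A \<in> pos ` {is. valid is \<omega>}"
      then obtain "is" where v: "valid is \<omega>" "A = pos is" by auto
      define n where "n = (LEAST n. valid (from_nat n) \<omega> \<and> pos (from_nat n) = A)"
      have ex: "valid (from_nat (to_nat is)) \<omega> \<and> pos (from_nat (to_nat is)) = A" using v by simp
      have n: "valid (from_nat n) \<omega>" "pos (from_nat n) = A"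
        using LeastI[of "\<lambda>n. valid (from_nat n) \<omega> \<and> pos (from_nat n) = A", OF ex] by (auto simp: n_def)
      have less: "\<not> (valid (from_nat m) \<omega> \<and> pos (from_nat m) = A)" if "m < n" for m
        using not_less_Least[of m "\<lambda>n. valid (from_nat n) \<omega> \<and> pos (from_nat n) = A"] that unfolding n_def by blast
      have "n \<in> Q \<omega>" unfolding Q_def same mem_Collect_eq n(2) using n(1) less by blast
      with n show "A \<in> (\<lambda>n. pos (from_nat n)) ` Q \<omega>" by auto
    qed
    then show ?thesis unfolding num_cliques_def N by (rule bij_betw_same_card[symmetric])
  qed
  show ?thesis by (rule measurable_cong[THEN iffD2, OF eq Qm])
qed

end

section \<open>Discretisation of the clique count\<close>

definition cube :: "real \<Rightarrow> (real ^ 'n) set" where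
  "cube s = {x. \<forall>j. x $ j \<in> {- s..s}}"

definition site :: "real \<Rightarrow> real \<Rightarrow> nat \<Rightarrow> (real ^ 'n) \<times> real \<Rightarrow> ('n \<Rightarrow> int) \<times> int" where
  "site s h q z = (\<lambda>j. \<lfloor>(fst z $ j + s) / h\<rfloor>, \<lfloor>snd z * real q\<rfloor>)"

definition sites :: "int \<Rightarrow> nat \<Rightarrow> (('n::finite \<Rightarrow> int) \<times> int) set" where
  "sites K q = {c. (\<forall>j. fst c j \<in> {0..<K}) \<and> snd c \<in> {0..<(int q)\<^sup>2}}"

text \<open>The slack \<open>CARD('n) * h\<close> makes sites adjacent whenever they contain adjacent points.\<close>

definition site_adj :: "real \<Rightarrow> nat \<Rightarrow> ('n::finite \<Rightarrow> int) \<times> int \<Rightarrow> ('n \<Rightarrow> int) \<times> int \<Rightarrow> bool" where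
  "site_adj h q c c' \<longleftrightarrow>
     norm ((\<chi> j. h * real_of_int (fst c j - fst c' j)) :: real ^ 'n)
       \<le> min (real_of_int (snd c + 1)) (real_of_int (snd c' + 1)) / real q + real CARD('n) * h"

definition site_cliques :: "nat \<Rightarrow> real \<Rightarrow> nat \<Rightarrow> (('n::finite \<Rightarrow> int) \<times> int) set \<Rightarrow> (('n \<Rightarrow> int) \<times> int) set set" where
  "site_cliques k h q V = {A. A \<subseteq> V \<and> card A = k \<and> (\<forall>c\<in>A. \<forall>c'\<in>A. c \<noteq> c' \<longrightarrow> site_adj h q c c')}"

lemma finite_sites: "finite (sites K q :: (('n::finite \<Rightarrow> int) \<times> int) set)"
proof -
  have "(sites K q :: (('n \<Rightarrow> int) \<times> int) set) \<subseteq> (PiE UNIV (\<lambda>_. {0..<K})) \<times> {0..<(int q)\<^sup>2}"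
    by (auto simp: sites_def PiE_def)
  then show ?thesis by (rule finite_subset) (auto intro!: finite_cartesian_product finite_PiE)
qed

lemma site_coord:
  assumes "h > 0"
  shows "h * real_of_int (fst (site s h q z) j) \<le> fst z $ j + s"
    "fst z $ j + s < h * real_of_int (fst (site s h q z) j) + h"
proof -
  define y where "y = (fst z $ j + s) / h"
  define v where "v = real_of_int \<lfloor>y\<rfloor>"
  have fst: "real_of_int (fst (site s h q z) j) = v" by (simp add: site_def v_def y_def)
  have "v \<le> y" "y < v + 1" unfolding v_def by linarith+
  then have "h * v \<le> h * y" "h * y < h * (v + 1)" using assms by simp_all
  moreover have "h * y = fst z $ j + s" using assms by (simp add: y_def)
  ultimately show "h * real_of_int (fst (site s h q z) j) \<le> fst z $ j + s"
    "fst z $ j + s < h * real_of_int (fst (site s h q z) j) + h"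
    unfolding fst by (simp_all add: distrib_left)
qed

lemma site_radius:
  assumes "q > 0"
  shows "real_of_int (snd (site s h q z)) / real q \<le> snd z"
    "snd z \<le> real_of_int (snd (site s h q z) + 1) / real q"
    "real_of_int (snd (site s h q z) + 1) / real q \<le> snd z + 1 / real q"
proof -
  define v where "v = real_of_int \<lfloor>snd z * real q\<rfloor>"
  have snd: "real_of_int (snd (site s h q z)) = v" "real_of_int (snd (site s h q z) + 1) = v + 1"
    by (simp_all add: site_def v_def)
  have q: "0 < real q" using assms by simp
  have "v \<le> snd z * real q" "snd z * real q \<le> v + 1" unfolding v_def by linarith+
  then have *: "v / real q \<le> snd z" "snd z \<le> (v + 1) / real q"
    by (simp_all only: pos_divide_le_eq[OF q] pos_le_divide_eq[OF q])
  then show "real_of_int (snd (site s h q z)) / real q \<le> snd z"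
    "snd z \<le> real_of_int (snd (site s h q z) + 1) / real q"
    unfolding snd by simp_all
  show "real_of_int (snd (site s h q z) + 1) / real q \<le> snd z + 1 / real q"
    unfolding snd add_divide_distrib using *(1) by simp
qed

text \<open>Each coordinate is rounded down by an amount in \<open>[0, h)\<close>, so the errors of
  two points differ by less than \<open>h\<close> in every coordinate.\<close>

lemma site_dist:
  fixes z z' :: "(real ^ 'n) \<times> real"
  assumes h: "h > 0"
  shows "\<bar>norm (fst z - fst z') - norm ((\<chi> j. h * real_of_int (fst (site s h q z) j - fst (site s h q z') j)) :: real ^ 'n)\<bar>
    \<le> real CARD('n) * h"
proof -
  let ?v = "(\<chi> j. h * real_of_int (fst (site s h q z) j - fst (site s h q z') j)) :: real ^ 'n"
  have "\<bar>norm (fst z - fst z') - norm ?v\<bar> \<le> norm (fst z - fst z' - ?v)"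
    by (rule norm_triangle_ineq3)
  also have "\<dots> \<le> (\<Sum>j\<in>UNIV. \<bar>(fst z - fst z' - ?v) $ j\<bar>)" by (rule norm_le_l1_cart)
  also have "\<dots> \<le> (\<Sum>j\<in>(UNIV :: 'n set). h)"
  proof (rule sum_mono)
    fix j
    show "\<bar>(fst z - fst z' - ?v) $ j\<bar> \<le> h"
      using site_coord[OF h, where s = s and q = q and z = z and j = j]
        site_coord[OF h, where s = s and q = q and z = z' and j = j]
      by (simp add: algebra_simps abs_le_iff)
  qed
  finally show ?thesis by simp
qed

lemma eventually_small:
  fixes a b :: real
  assumes "b > 0"
  shows "\<forall>\<^sub>F q in sequentially. q > 0 \<and> a / real q < b"
proof -
  have "(\<lambda>q. a / real q) \<longlonglongrightarrow> 0" by real_asymp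
  from order_tendstoD(2)[OF this assms] eventually_gt_at_top[of 0] show ?thesis
    by eventually_elim simp
qed

text \<open>Adjacent points lie in adjacent sites for every positive \<open>q\<close>, thanks to the
  slack and the rounding up of radii. Points that are not adjacent miss the condition by a positive
  amount, which the errors of rounding eventually fail to bridge.\<close>

lemma eventually_site_adj:
  fixes z z' :: "(real ^ 'n) \<times> real"
  assumes L: "L > 0"
  shows "\<forall>\<^sub>F q in sequentially. site_adj (L / real q) q (site s (L / real q) q z) (site s (L / real q) q z')
    \<longleftrightarrow> norm (fst z - fst z') \<le> min (snd z) (snd z')"
proof (cases "norm (fst z - fst z') \<le> min (snd z) (snd z')")
  case True
  show ?thesis
  proof (rule eventually_mono[OF eventually_gt_at_top[of 0]])
    fix q :: nat assume q: "q > 0"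
    let ?h = "L / real q"
    have h: "?h > 0" using L q by simp
    have "min (snd z) (snd z') \<le> min (real_of_int (snd (site s ?h q z) + 1)) (real_of_int (snd (site s ?h q z') + 1)) / real q"
      using site_radius(2)[OF q, where s = s and h = ?h and z = z] site_radius(2)[OF q, where s = s and h = ?h and z = z'] by (auto simp: min_def)
    then show "site_adj ?h q (site s ?h q z) (site s ?h q z') \<longleftrightarrow> norm (fst z - fst z') \<le> min (snd z) (snd z')"
      using True site_dist[OF h, of z z' s q] unfolding site_adj_def by linarith
  qed
next
  case False
  define \<delta> where "\<delta> = norm (fst z - fst z') - min (snd z) (snd z')"
  have "\<delta> > 0" using False unfolding \<delta>_def by linarith
  \<comment> \<open>The total error is \<open>1 / q\<close> for the radius and twice
    \<open>CARD('n) * L / q\<close>, once for the distance and once for the slack.\<close>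
  then show ?thesis
  proof (rule eventually_mono[OF eventually_small[of \<delta> "1 + 2 * (real CARD('n) * L)"]], elim conjE)
    fix q :: nat assume q: "q > 0" and small: "(1 + 2 * (real CARD('n) * L)) / real q < \<delta>"
    let ?h = "L / real q"
    have h: "?h > 0" using L q by simp
    have m: "min a b / real q = min (a / real q) (b / real q)" for a b :: real
      by (simp add: min_divide_distrib_right)
    have "min (real_of_int (snd (site s ?h q z) + 1)) (real_of_int (snd (site s ?h q z') + 1)) / real q \<le> min (snd z) (snd z') + 1 / real q"
      using site_radius(3)[OF q, where s = s and h = ?h and z = z] site_radius(3)[OF q, where s = s and h = ?h and z = z']
      unfolding m by linarith
    moreover have "1 / real q + 2 * (real CARD('n) * ?h) < \<delta>" using small by (simp add: add_divide_distrib)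
    moreover have "A \<le> M + e \<Longrightarrow> e + 2 * C < D - M \<Longrightarrow> \<bar>D - B\<bar> \<le> C \<Longrightarrow> \<not> B \<le> A + C" for A M e C D B :: real
      by linarith
    ultimately have "\<not> site_adj ?h q (site s ?h q z) (site s ?h q z')"
      using site_dist[OF h, of z z' s q] unfolding site_adj_def \<delta>_def by blast
    then show "site_adj ?h q (site s ?h q z) (site s ?h q z') \<longleftrightarrow> norm (fst z - fst z') \<le> min (snd z) (snd z')"
      using False by simp
  qed
qed

lemma eventually_site_neq:
  fixes z z' :: "(real ^ 'n) \<times> real"
  assumes L: "L > 0" and neq: "fst z \<noteq> fst z'"
  shows "\<forall>\<^sub>F q in sequentially. site s (L / real q) q z \<noteq> site s (L / real q) q z'"
proof (rule eventually_mono[OF eventually_small[of "norm (fst z - fst z')" "real CARD('n) * L"]])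
  show "0 < norm (fst z - fst z')" using neq by simp
  fix q assume "0 < q \<and> real CARD('n) * L / real q < norm (fst z - fst z')"
  then have q: "q > 0" and small: "real CARD('n) * (L / real q) < norm (fst z - fst z')" by auto
  have h: "L / real q > 0" using L q by simp
  show "site s (L / real q) q z \<noteq> site s (L / real q) q z'"
  proof
    assume eq: "site s (L / real q) q z = site s (L / real q) q z'"
    have "((\<chi> j. L / real q * real_of_int (fst (site s (L / real q) q z) j - fst (site s (L / real q) q z') j)) :: real ^ 'n) = 0"
      unfolding eq by (simp add: vec_eq_iff)
    with site_dist[OF h, of z z' s q] small show False by simp
  qed
qed

lemma eventually_site_mem:
  fixes z :: "(real ^ 'n) \<times> real"
  assumes L: "L > 0" and z: "fst z \<in> cube s" "0 \<le> snd z"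
  shows "\<forall>\<^sub>F q in sequentially. site s (L / real q) q z \<in> sites (\<lfloor>2 * s / (L / real q)\<rfloor> + 1) q"
proof (rule eventually_mono[OF eventually_small[of 1 "snd z"]])
  fix q assume "0 < q \<and> snd z / real q < 1"
  then have q: "q > 0" and r: "snd z < real q" by auto
  have h: "L / real q > 0" using L q by simp
  have "snd z * real q < real q * real q" using r q by simp
  then have "\<lfloor>snd z * real q\<rfloor> < (int q)\<^sup>2"
    by (simp add: floor_less_iff power2_eq_square)
  moreover have "0 \<le> (fst z $ j + s) / (L / real q)" "(fst z $ j + s) / (L / real q) \<le> 2 * s / (L / real q)" for j
  proof -
    have "- s \<le> fst z $ j" "fst z $ j \<le> s" using z(1) by (auto simp: cube_def)
    then have *: "0 \<le> fst z $ j + s" "fst z $ j + s \<le> 2 * s" by linarith+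
    show "0 \<le> (fst z $ j + s) / (L / real q)" using *(1) h by (rule divide_nonneg_pos)
    show "(fst z $ j + s) / (L / real q) \<le> 2 * s / (L / real q)"
      using *(2) less_imp_le[OF h] by (rule divide_right_mono)
  qed
  then have "0 \<le> \<lfloor>(fst z $ j + s) / (L / real q)\<rfloor>" "\<lfloor>(fst z $ j + s) / (L / real q)\<rfloor> < \<lfloor>2 * s / (L / real q)\<rfloor> + 1" for j
    using floor_mono by (simp, smt (verit) floor_mono)
  ultimately show "site s (L / real q) q z \<in> sites (\<lfloor>2 * s / (L / real q)\<rfloor> + 1) q"
    using z(2) q unfolding sites_def site_def by auto
qed simp

lemma card_site_cliques_image:
  fixes f :: "(real ^ 'n) \<times> real \<Rightarrow> ('n \<Rightarrow> int) \<times> int"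
  assumes inj: "inj_on f P"
    and adj: "\<And>z z'. z \<in> P \<Longrightarrow> z' \<in> P \<Longrightarrow> site_adj h q (f z) (f z') \<longleftrightarrow> norm (fst z - fst z') \<le> min (snd z) (snd z')"
  shows "card (site_cliques k h q (f ` P)) = card (clique_sets k P)"
proof -
  have "bij_betw ((`) f) (clique_sets k P) (site_cliques k h q (f ` P))"
    unfolding bij_betw_def
  proof (intro conjI equalityI subsetI)
    show "inj_on ((`) f) (clique_sets k P)"
    proof (rule inj_onI)
      fix B B' assume "B \<in> clique_sets k P" "B' \<in> clique_sets k P" "f ` B = f ` B'"
      then show "B = B'" using inj unfolding clique_sets_def
        by (metis (no_types, lifting) inj_on_image_eq_iff mem_Collect_eq)
    qed
  next
    fix A assume "A \<in> (`) f ` clique_sets k P"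
    then obtain B where B0: "B \<in> clique_sets k P" and A: "A = f ` B" by (rule imageE)
    have B: "B \<subseteq> P" "card B = k" using B0 by (simp_all add: clique_sets_def)
    have "card A = k" unfolding A using card_image[OF inj_on_subset[OF inj B(1)]] B(2) by simp
    moreover have "site_adj h q c c'" if cc: "c \<in> A" "c' \<in> A" "c \<noteq> c'" for c c'
    proof -
      obtain z z' where z: "z \<in> B" "z' \<in> B" "c = f z" "c' = f z'" using cc A by auto
      then have "z \<noteq> z'" using cc by auto
      then have "norm (fst z - fst z') \<le> min (snd z) (snd z')"
        using B0 z unfolding clique_sets_def by blast
      moreover have "z \<in> P" "z' \<in> P" using z(1,2) B(1) by auto
      ultimately show ?thesis unfolding z(3,4) using adj by blast
    qed
    ultimately show "A \<in> site_cliques k h q (f ` P)" using A B by (auto simp: site_cliques_def)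
  next
    fix A assume A: "A \<in> site_cliques k h q (f ` P)"
    then have "A \<subseteq> f ` P" by (simp add: site_cliques_def)
    then obtain B where B: "B \<subseteq> P" "A = f ` B" using subset_imageE by blast
    have "card A = k" using A by (simp add: site_cliques_def)
    then have "card B = k" using card_image[OF inj_on_subset[OF inj B(1)]] B(2) by simp
    moreover have "norm (fst z - fst z') \<le> min (snd z) (snd z')" if z: "z \<in> B" "z' \<in> B" "z \<noteq> z'" for z z'
    proof -
      have "f z \<noteq> f z'" using inj B z by (metis inj_onD subsetD)
      moreover have "\<forall>c\<in>A. \<forall>c'\<in>A. c \<noteq> c' \<longrightarrow> site_adj h q c c'" using A by (simp add: site_cliques_def)
      ultimately have "site_adj h q (f z) (f z')" using z B(2) by blast
      moreover have "z \<in> P" "z' \<in> P" using z(1,2) B(1) by auto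
      ultimately show ?thesis using adj by blast
    qed
    ultimately have "B \<in> clique_sets k P" using B by (simp add: clique_sets_def)
    then show "A \<in> (`) f ` clique_sets k P" using B by blast
  qed
  then show ?thesis by (rule bij_betw_same_card[symmetric])
qed

text \<open>A fixed finite configuration imposes finitely many conditions, each of which holds
  eventually; from then on \<open>site\<close> is a graph isomorphism onto its image.\<close>

lemma eventually_site_cliques:
  fixes P :: "((real ^ 'n) \<times> real) set"
  assumes L: "L > 0" and fin: "finite P" and P: "P \<subseteq> cube s \<times> {0..}" and inj: "inj_on fst P"
  shows "\<forall>\<^sub>F q in sequentially. site s (L / real q) q ` P \<subseteq> sites (\<lfloor>2 * s / (L / real q)\<rfloor> + 1) q \<and>
    card (site_cliques k (L / real q) q (site s (L / real q) q ` P)) = card (clique_sets k P)"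
proof -
  have 1: "\<forall>\<^sub>F q in sequentially. \<forall>z\<in>P. site s (L / real q) q z \<in> sites (\<lfloor>2 * s / (L / real q)\<rfloor> + 1) q"
    using P L by (intro eventually_ball_finite[OF fin] ballI eventually_site_mem) auto
  have 2: "\<forall>\<^sub>F q in sequentially. \<forall>z\<in>P. \<forall>z'\<in>P. site_adj (L / real q) q (site s (L / real q) q z) (site s (L / real q) q z')
    \<longleftrightarrow> norm (fst z - fst z') \<le> min (snd z) (snd z')"
    using L by (intro eventually_ball_finite[OF fin] ballI eventually_site_adj)
  have 3: "\<forall>\<^sub>F q in sequentially. \<forall>z\<in>P. \<forall>z'\<in>P. z \<noteq> z' \<longrightarrow> site s (L / real q) q z \<noteq> site s (L / real q) q z'"
  proof (intro eventually_ball_finite[OF fin] ballI)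
    fix z z' assume z: "z \<in> P" "z' \<in> P"
    show "\<forall>\<^sub>F q in sequentially. z \<noteq> z' \<longrightarrow> site s (L / real q) q z \<noteq> site s (L / real q) q z'"
    proof (cases "z = z'")
      case False
      then have "fst z \<noteq> fst z'" using inj z by (auto dest: inj_onD)
      from eventually_site_neq[OF L this, of s] show ?thesis by eventually_elim simp
    qed simp
  qed
  from 1 2 3 show ?thesis
  proof eventually_elim
    case (elim q)
    have "inj_on (site s (L / real q) q) P" using elim(3) by (intro inj_onI) blast
    then have "card (site_cliques k (L / real q) q (site s (L / real q) q ` P)) = card (clique_sets k P)"
      by (rule card_site_cliques_image) (rule elim(2)[rule_format])
    moreover have "site s (L / real q) q ` P \<subseteq> sites (\<lfloor>2 * s / (L / real q)\<rfloor> + 1) q"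
      using elim(1) by blast
    ultimately show ?case by simp
  qed
qed

text \<open>Dominated convergence. As \<open>Xq\<close> eventually equals \<open>X\<close>,
  pointwise convergence of \<open>f q\<close> suffices; \<open>f\<close> depends on \<open>q\<close>
  because the standardisation uses the mean and variance of the discrete model.\<close>

lemma (in prob_space) expectation_eventually_eq:
  fixes X :: "'a \<Rightarrow> real" and Xq :: "nat \<Rightarrow> 'a \<Rightarrow> real" and f :: "nat \<Rightarrow> real \<Rightarrow> real"
  assumes Xq [measurable]: "\<And>q. Xq q \<in> borel_measurable M" and X [measurable]: "X \<in> borel_measurable M"
    and ev: "AE \<omega> in M. \<forall>\<^sub>F q in sequentially. Xq q \<omega> = X \<omega>"
    and D: "integrable M D" and [measurable]: "\<And>q. f q \<in> borel_measurable borel" "g \<in> borel_measurable borel"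
    and f: "\<And>x. (\<lambda>q. f q x) \<longlonglongrightarrow> g x"
    and bd: "\<And>q. AE \<omega> in M. \<bar>f q (Xq q \<omega>)\<bar> \<le> D \<omega>"
  shows "integrable M (\<lambda>\<omega>. g (X \<omega>))" "(\<lambda>q. \<integral>\<omega>. f q (Xq q \<omega>) \<partial>M) \<longlonglongrightarrow> (\<integral>\<omega>. g (X \<omega>) \<partial>M)"
proof -
  have lim: "AE \<omega> in M. (\<lambda>q. f q (Xq q \<omega>)) \<longlonglongrightarrow> g (X \<omega>)"
    using ev
  proof eventually_elim
    case (elim \<omega>)
    show ?case
      by (rule Lim_transform_eventually[OF f[of "X \<omega>"]], rule eventually_mono[OF elim]) simp
  qed
  have D': "\<And>q. AE \<omega> in M. norm (f q (Xq q \<omega>)) \<le> D \<omega>" using bd by simp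
  show "integrable M (\<lambda>\<omega>. g (X \<omega>))"
    by (rule integrable_dominated_convergence[OF _ _ D lim D']) measurable
  show "(\<lambda>q. \<integral>\<omega>. f q (Xq q \<omega>) \<partial>M) \<longlonglongrightarrow> (\<integral>\<omega>. g (X \<omega>) \<partial>M)"
    by (rule integral_dominated_convergence[OF _ _ D lim D']) measurable
qed

section \<open>Volumes of cubes\<close>

lemma emeasure_lborel_cube:
  assumes "0 \<le> h"
  shows "emeasure lborel (cbox (\<chi> j. a j) (\<chi> j. a j + h) :: (real ^ 'n) set) = ennreal (h ^ CARD('n))"
proof -
  let ?C = "cbox (\<chi> j. a j) (\<chi> j. a j + h) :: (real ^ 'n) set"
  have ne: "?C \<noteq> {}" using assms by (auto simp: interval_ne_empty_cart)
  have "emeasure lborel ?C = ennreal (measure lborel ?C)"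
    using emeasure_lborel_cbox_finite[of "(\<chi> j. a j) :: real ^ 'n" "\<chi> j. a j + h"]
    by (intro emeasure_eq_ennreal_measure) simp
  also have "measure lborel ?C = (\<Prod>i\<in>UNIV. ((\<chi> j. a j + h) :: real ^ 'n) $ i - ((\<chi> j. a j) :: real ^ 'n) $ i)"
    by (rule content_cbox_cart[OF ne])
  also have "\<dots> = h ^ CARD('n)" by simp
  finally show ?thesis .
qed

lemma emeasure_lborel_half_open_cube:
  assumes "0 \<le> h"
  shows "emeasure lborel {x :: real ^ 'n. \<forall>j. a j \<le> x $ j \<and> x $ j < a j + h} = ennreal (h ^ CARD('n))"
proof (rule antisym)
  let ?H = "{x :: real ^ 'n. \<forall>j. a j \<le> x $ j \<and> x $ j < a j + h}"
  have m: "?H \<in> sets lborel" by measurable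
  have "emeasure lborel ?H \<le> emeasure lborel (cbox (\<chi> j. a j) (\<chi> j. a j + h) :: (real ^ 'n) set)"
    by (rule emeasure_mono) (auto simp: mem_box_cart less_imp_le)
  then show "emeasure lborel ?H \<le> ennreal (h ^ CARD('n))" by (simp only: emeasure_lborel_cube[OF assms])
  have "emeasure lborel (cbox (\<chi> j. a j) (\<chi> j. a j + h) :: (real ^ 'n) set) = emeasure lborel (box (\<chi> j. a j) (\<chi> j. a j + h) :: (real ^ 'n) set)"
    by (simp only: emeasure_lborel_box_eq emeasure_lborel_cbox_eq)
  also have "\<dots> \<le> emeasure lborel ?H"
    using m by (intro emeasure_mono) (auto simp: mem_box_cart less_imp_le)
  finally show "ennreal (h ^ CARD('n)) \<le> emeasure lborel ?H" by (simp only: emeasure_lborel_cube[OF assms])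
qed

lemma cube_cbox: "(cube s :: (real ^ 'n) set) = cbox (\<chi> j. - s) (\<chi> j. - s + 2 * s)"
  by (auto simp: cube_def mem_box_cart)

lemma emeasure_cube: "0 \<le> s \<Longrightarrow> emeasure lborel (cube s :: (real ^ 'n) set) = ennreal ((2 * s) ^ CARD('n))"
  unfolding cube_cbox by (rule emeasure_lborel_cube) simp

lemma cube_borel [measurable]: "(cube s :: (real ^ 'n) set) \<in> sets borel"
  unfolding cube_cbox by simp

lemma window_cube: "(window t :: (real ^ 'n) set) = cube (t powr (1 / real CARD('n)))"
  by (simp add: window_def cube_def)

section \<open>Cells of the marked space and distinctness of locations\<close>

context poisson_cliques
begin

sublocale \<mu>: pair_sigma_finite lborel \<nu>
  by unfold_locales

definition strip :: "real \<Rightarrow> ((real ^ 'n) \<times> real) set" where "strip s = cube s \<times> {0..}"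

definition cell :: "real \<Rightarrow> real \<Rightarrow> nat \<Rightarrow> ('n \<Rightarrow> int) \<times> int \<Rightarrow> ((real ^ 'n) \<times> real) set" where
  "cell s h q c = {z \<in> space \<mu>. fst z \<in> cube s \<and> site s h q z = c}"

lemma strip_sets [measurable]: "strip s \<in> sets \<mu>"
proof -
  have "space \<nu> \<in> sets \<nu>" by simp
  then show ?thesis unfolding strip_def space_\<nu> by (intro pair_measureI) auto
qed

lemma emeasure_strip: "0 \<le> s \<Longrightarrow> emeasure \<mu> (strip s) = ennreal ((2 * s) ^ CARD('n))"
proof -
  assume s: "0 \<le> s"
  have "emeasure \<mu> (cube s \<times> space \<nu>) = emeasure lborel (cube s :: (real ^ 'n) set) * emeasure \<nu> (space \<nu>)"
    by (rule \<nu>.emeasure_pair_measure_Times) auto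
  then show ?thesis by (simp add: strip_def space_\<nu>[symmetric] \<nu>.emeasure_space_1 emeasure_cube[OF s])
qed

lemma cell_sets [measurable]: "cell s h q c \<in> sets \<mu>"
proof -
  have xj [measurable]: "(\<lambda>z. fst z $ j) \<in> borel_measurable \<mu>" for j
    using measurable_compose[OF fst_measurable vec_nth_measurable] .
  have "cell s h q c = {z \<in> space \<mu>. (\<forall>j. - s \<le> fst z $ j \<and> fst z $ j \<le> s) \<and>
      (\<forall>j. \<lfloor>(fst z $ j + s) / h\<rfloor> = fst c j) \<and> \<lfloor>snd z * real q\<rfloor> = snd c}"
    by (auto simp: cell_def cube_def site_def prod_eq_iff fun_eq_iff)
  also have "\<dots> \<in> sets \<mu>" by measurable
  finally show ?thesis .
qed

lemma cell_subset_strip: "cell s h q c \<subseteq> strip s"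
  by (auto simp: cell_def strip_def space_\<mu>)

lemma emeasure_strip_finite: "0 \<le> s \<Longrightarrow> emeasure \<mu> (strip s) < \<infinity>"
  by (simp add: emeasure_strip)

lemma emeasure_cell_finite: "0 \<le> s \<Longrightarrow> emeasure \<mu> (cell s h q c) < \<infinity>"
  using emeasure_mono[OF cell_subset_strip strip_sets] emeasure_strip_finite[of s] by (rule le_less_trans)

lemma disjoint_cells: "disjoint_family_on (cell s h q) V"
  by (auto simp: disjoint_family_on_def cell_def)

lemma sum_measure_cells_le:
  assumes "finite V" "\<And>c. c \<in> V \<Longrightarrow> cell s h q c \<subseteq> B" "B \<in> sets \<mu>" "emeasure \<mu> B \<le> ennreal b" "0 \<le> b" "0 \<le> s"
  shows "(\<Sum>c\<in>V. measure \<mu> (cell s h q c)) \<le> b"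
proof -
  have "(\<Sum>c\<in>V. emeasure \<mu> (cell s h q c)) = emeasure \<mu> (\<Union>c\<in>V. cell s h q c)"
    using assms(1) by (intro sum_emeasure image_subsetI cell_sets disjoint_cells)
  also have "\<dots> \<le> emeasure \<mu> B"
    using assms(2,3) by (intro emeasure_mono) auto
  also have "\<dots> \<le> ennreal b" by (rule assms(4))
  finally have "(\<Sum>c\<in>V. emeasure \<mu> (cell s h q c)) \<le> ennreal b" .
  moreover have "emeasure \<mu> (cell s h q c) = ennreal (measure \<mu> (cell s h q c))" for c
    using emeasure_cell_finite[OF assms(6), of h q c] by (intro emeasure_eq_ennreal_measure) auto
  ultimately have "ennreal (\<Sum>c\<in>V. measure \<mu> (cell s h q c)) \<le> ennreal b" by (simp add: sum_ennreal)
  then show ?thesis using assms(5) by simp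
qed

lemma AE_finite_strip:
  assumes "0 \<le> s"
  shows "AE \<omega> in M. emeasure (\<eta> \<omega>) (strip s) < \<infinity>"
  by (rule nn_integral_power_count(1)[OF strip_sets emeasure_strip_finite[OF assms], of 1]) simp

lemma points_nonneg: "\<omega> \<in> space M \<Longrightarrow> points (\<eta> \<omega>) \<subseteq> UNIV \<times> {0..}"
  using points_subset[OF singleton_sets] unfolding space_\<mu> .

lemma points_strip: "\<omega> \<in> space M \<Longrightarrow> points (\<eta> \<omega>) \<inter> (cube s \<times> UNIV) = points (\<eta> \<omega>) \<inter> strip s"
  using points_nonneg[of \<omega>] by (auto simp: strip_def)

text \<open>Two points with the same location would lie in a common slab \<open>C \<times> [0, \<infinity>)\<close> of every
  grid. The expected number of slabs with at least two points is at most the sum of the squared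
  intensities, which vanishes with the mesh.\<close>

lemma AE_distinct_locations:
  assumes s: "0 < s"
  shows "AE \<omega> in M. inj_on fst (points (\<eta> \<omega>) \<inter> strip s)"
proof -
  define slab where "slab q v = {z \<in> space \<mu>. (\<forall>j. - s \<le> fst z $ j \<and> fst z $ j \<le> s) \<and> (\<forall>j. \<lfloor>(fst z $ j + s) * real q\<rfloor> = v j)}"
    for q :: nat and v :: "'n \<Rightarrow> int"
  define Vs where "Vs q = (PiE UNIV (\<lambda>_. {0..\<lfloor>2 * s * real q\<rfloor>}) :: ('n \<Rightarrow> int) set)" for q :: nat
  have finV: "finite (Vs q)" for q unfolding Vs_def by (intro finite_PiE) auto
  have xj [measurable]: "(\<lambda>z. fst z $ j) \<in> borel_measurable \<mu>" for j
    using measurable_compose[OF fst_measurable vec_nth_measurable] .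
  have slab_sets [measurable]: "slab q v \<in> sets \<mu>" for q v unfolding slab_def by measurable
  have slab_strip: "slab q v \<subseteq> strip s" for q v by (auto simp: slab_def strip_def space_\<mu> cube_def)
  have slab_fin: "emeasure \<mu> (slab q v) < \<infinity>" for q v
    using emeasure_mono[OF slab_strip strip_sets] emeasure_strip_finite[of s] s by (meson le_less_trans less_imp_le)
  have em: "emeasure \<mu> (slab q v) = ennreal (measure \<mu> (slab q v))" for q v
    using slab_fin[of q v] by (intro emeasure_eq_ennreal_measure) auto
  have small: "measure \<mu> (slab q v) \<le> (1 / real q) ^ CARD('n)" if q: "q > 0" for q v
  proof -
    let ?H = "{x :: real ^ 'n. \<forall>j. - s + of_int (v j) / real q \<le> x $ j \<and> x $ j < - s + of_int (v j) / real q + 1 / real q}"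
    have H: "?H \<in> sets lborel" by measurable
    have "slab q v \<subseteq> ?H \<times> space \<nu>"
    proof
      fix z assume z: "z \<in> slab q v"
      have "of_int (v j) \<le> (fst z $ j + s) * real q \<and> (fst z $ j + s) * real q < of_int (v j) + 1" for j
      proof -
        have "\<lfloor>(fst z $ j + s) * real q\<rfloor> = v j" using z by (simp add: slab_def)
        then show ?thesis by (simp add: floor_eq_iff)
      qed
      then have "of_int (v j) / real q \<le> fst z $ j + s \<and> fst z $ j + s < (of_int (v j) + 1) / real q" for j
        using q by (simp only: pos_divide_le_eq pos_less_divide_eq of_nat_0_less_iff)
      then have "fst z \<in> ?H" by (simp add: add_divide_distrib algebra_simps)
      moreover have "snd z \<in> space \<nu>" using z by (auto simp: slab_def space_\<mu> space_\<nu>)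
      ultimately show "z \<in> ?H \<times> space \<nu>" by (auto simp: mem_Times_iff)
    qed
    then have "emeasure \<mu> (slab q v) \<le> emeasure \<mu> (?H \<times> space \<nu>)"
      using H by (intro emeasure_mono pair_measureI) auto
    also have "\<dots> = emeasure lborel ?H * emeasure \<nu> (space \<nu>)"
      using H by (intro \<nu>.emeasure_pair_measure_Times) auto
    also have "\<dots> = ennreal ((1 / real q) ^ CARD('n))"
      using emeasure_lborel_half_open_cube[of "1 / real q" "\<lambda>j. - s + of_int (v j) / real q"]
      by (simp add: \<nu>.emeasure_space_1)
    finally show ?thesis unfolding em by (simp add: ennreal_le_iff)
  qed
  define Bad where "Bad q = (\<Union>v\<in>Vs q. {\<omega> \<in> space M. emeasure (\<eta> \<omega>) (slab q v) \<noteq> 0 \<and> emeasure (\<eta> \<omega>) (slab q v) \<noteq> 1})" for q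
  have one: "{\<omega> \<in> space M. emeasure (\<eta> \<omega>) (slab q v) \<noteq> 0 \<and> emeasure (\<eta> \<omega>) (slab q v) \<noteq> 1} \<in> events" for q v
  proof -
    have [measurable]: "(\<lambda>\<omega>. emeasure (\<eta> \<omega>) (slab q v)) \<in> borel_measurable M" by (rule count_measurable[OF slab_sets])
    show ?thesis by measurable
  qed
  have Bad_ev: "Bad q \<in> events" for q
    unfolding Bad_def using finV one by (intro sets.finite_UN) auto
  have Bad_le: "prob (Bad q) \<le> (2 * s) ^ CARD('n) * (1 / real q)" if q: "q > 0" for q
  proof -
    have "prob (Bad q) \<le> (\<Sum>v\<in>Vs q. prob {\<omega> \<in> space M. emeasure (\<eta> \<omega>) (slab q v) \<noteq> 0 \<and> emeasure (\<eta> \<omega>) (slab q v) \<noteq> 1})"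
      unfolding Bad_def using finV one by (intro finite_measure_subadditive_finite) auto
    \<comment> \<open>One factor of the squared intensity is at most \<open>1 / q\<close>; the other
      sums to the volume of the window.\<close>
    also have "\<dots> \<le> (\<Sum>v\<in>Vs q. measure \<mu> (slab q v) * (1 / real q))"
    proof (rule sum_mono)
      fix v
      have "(1 / real q) ^ CARD('n) \<le> (1 / real q) ^ 1"
        using q by (intro power_decreasing) auto
      then have "measure \<mu> (slab q v) \<le> 1 / real q" using small[OF q, of v] by simp
      then have "(measure \<mu> (slab q v))\<^sup>2 \<le> measure \<mu> (slab q v) * (1 / real q)"
        unfolding power2_eq_square by (intro mult_left_mono) auto
      with prob_count_ge_2[OF slab_sets slab_fin, of q v]
      show "prob {\<omega> \<in> space M. emeasure (\<eta> \<omega>) (slab q v) \<noteq> 0 \<and> emeasure (\<eta> \<omega>) (slab q v) \<noteq> 1} \<le> measure \<mu> (slab q v) * (1 / real q)"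
        by linarith
    qed
    also have "\<dots> = (\<Sum>v\<in>Vs q. measure \<mu> (slab q v)) * (1 / real q)" by (rule sum_distrib_right[symmetric])
    also have "\<dots> \<le> (2 * s) ^ CARD('n) * (1 / real q)"
    proof (rule mult_right_mono)
      have "disjoint_family_on (slab q) (Vs q)"
        unfolding disjoint_family_on_def slab_def by (auto simp: fun_eq_iff)
      then have "(\<Sum>v\<in>Vs q. emeasure \<mu> (slab q v)) = emeasure \<mu> (\<Union>v\<in>Vs q. slab q v)"
        using finV by (intro sum_emeasure image_subsetI slab_sets)
      also have "\<dots> \<le> emeasure \<mu> (strip s)" using slab_strip by (intro emeasure_mono strip_sets UN_least)
      also have "\<dots> = ennreal ((2 * s) ^ CARD('n))" using s by (intro emeasure_strip) simp
      finally have "ennreal (\<Sum>v\<in>Vs q. measure \<mu> (slab q v)) \<le> ennreal ((2 * s) ^ CARD('n))"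
        unfolding em by (simp add: sum_ennreal)
      then show "(\<Sum>v\<in>Vs q. measure \<mu> (slab q v)) \<le> (2 * s) ^ CARD('n)" using s by simp
    qed simp
    finally show ?thesis .
  qed
  \<comment> \<open>A single mesh that separates the points is enough, so the exceptional set is the
    intersection over all meshes. The successor avoids \<open>q = 0\<close>.\<close>
  define N where "N = (\<Inter>q. Bad (Suc q))"
  have N_ev: "N \<in> events" unfolding N_def using Bad_ev by (intro sets.countable_INT) auto
  have "prob N \<le> 0"
  proof (rule LIMSEQ_le_const)
    show "(\<lambda>q. (2 * s) ^ CARD('n) * (1 / real (Suc q))) \<longlonglongrightarrow> 0"
      using tendsto_mult[OF tendsto_const LIMSEQ_inverse_real_of_nat, of "(2 * s) ^ CARD('n)"]
      by (simp add: divide_inverse)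
    show "\<exists>N0. \<forall>q\<ge>N0. prob N \<le> (2 * s) ^ CARD('n) * (1 / real (Suc q))"
    proof (intro exI allI impI)
      fix q :: nat
      have "prob N \<le> prob (Bad (Suc q))" using Bad_ev by (intro finite_measure_mono) (auto simp: N_def)
      also have "\<dots> \<le> (2 * s) ^ CARD('n) * (1 / real (Suc q))" by (rule Bad_le) simp
      finally show "prob N \<le> (2 * s) ^ CARD('n) * (1 / real (Suc q))" .
    qed
  qed
  then have "prob N = 0" using measure_nonneg[of M N] by linarith
  then have "AE \<omega> in M. \<omega> \<notin> N" using N_ev by (simp add: prob_eq_0)
  then show ?thesis
  proof (rule AE_mp, intro AE_I2 impI)
    fix \<omega> assume \<omega>: "\<omega> \<in> space M" and "\<omega> \<notin> N"
    then obtain q' where q': "\<omega> \<notin> Bad (Suc q')" by (auto simp: N_def)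
    define q where "q = Suc q'"
    have slab01: "emeasure (\<eta> \<omega>) (slab q v) \<le> 1" if "v \<in> Vs q" for v
      using q' that \<omega> unfolding Bad_def q_def by auto
    show "inj_on fst (points (\<eta> \<omega>) \<inter> strip s)"
    proof (rule inj_onI)
      fix z z' assume z: "z \<in> points (\<eta> \<omega>) \<inter> strip s" "z' \<in> points (\<eta> \<omega>) \<inter> strip s" "fst z = fst z'"
      define v where "v = (\<lambda>j. \<lfloor>(fst z $ j + s) * real q\<rfloor>)"
      have cz: "fst z \<in> cube s" "fst z' \<in> cube s" and sp: "z \<in> space \<mu>" "z' \<in> space \<mu>"
        using z by (auto simp: strip_def space_\<mu>)
      have c: "- s \<le> fst z $ j \<and> fst z $ j \<le> s" for j using cz(1) by (simp add: cube_def)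
      have vV: "v \<in> Vs q"
      proof -
        have "0 \<le> (fst z $ j + s) * real q" and le: "(fst z $ j + s) * real q \<le> 2 * s * real q" for j
          using c[of j] by (auto intro!: mult_nonneg_nonneg mult_right_mono)
        then have "0 \<le> v j" for j by (simp add: v_def)
        moreover have "v j \<le> \<lfloor>2 * s * real q\<rfloor>" for j unfolding v_def by (rule floor_mono[OF le])
        ultimately show ?thesis by (simp add: Vs_def PiE_iff)
      qed
      have zs: "z \<in> slab q v" "z' \<in> slab q v"
        using sp c z(3) by (auto simp: slab_def v_def)
      have fin: "emeasure (\<eta> \<omega>) (slab q v) < \<infinity>" using slab01[OF vV] by (auto simp: less_top intro: le_less_trans)
      have "of_nat (card (points (\<eta> \<omega>) \<inter> slab q v)) \<le> emeasure (\<eta> \<omega>) (slab q v)"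
        by (rule points_card(2)[OF _ \<omega> slab_sets fin]) (rule singleton_sets)
      also have "\<dots> \<le> of_nat 1" using slab01[OF vV] by simp
      finally have "card (points (\<eta> \<omega>) \<inter> slab q v) \<le> 1" by (simp only: of_nat_le_iff)
      moreover have "finite (points (\<eta> \<omega>) \<inter> slab q v)"
        by (rule points_card(1)[OF _ \<omega> slab_sets fin]) (rule singleton_sets)
      ultimately show "z = z'" using z zs by (auto simp: card_le_Suc0_iff_eq)
    qed
  qed
qed

end

text \<open>The summand \<open>1 + 2 * CARD('n)\<close> absorbs all errors of rounding as soon as
  \<open>h\<close> and \<open>1 / q\<close> are at most 1; \<open>cell_near\<close> shows how.
  \<open>m\<close> becomes the degree bound of the finite graphs.\<close>

locale poisson_cliques_degree = poisson_cliques M \<nu> \<eta>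
  for M :: "'w measure" and \<nu> :: "real measure" and \<eta> :: "'w \<Rightarrow> ((real ^ 'n) \<times> real) measure" +
  fixes m :: real
  assumes degree: "(\<integral>\<^sup>+ r. ennreal ((2 * (r + (1 + 2 * real CARD('n)))) ^ CARD('n)) \<partial>\<nu>) \<le> ennreal m" and m_nonneg: "0 \<le> m"
begin

definition near :: "real ^ 'n \<Rightarrow> ((real ^ 'n) \<times> real) set" where
  "near y = {z \<in> space \<mu>. norm (fst z - y) \<le> snd z + (1 + 2 * real CARD('n))}"

lemma near_sets [measurable]: "near y \<in> sets \<mu>"
  unfolding near_def by measurable

lemma emeasure_near: "emeasure \<mu> (near y) \<le> ennreal m"
proof -
  let ?\<kappa> = "1 + 2 * real CARD('n)"
  have "emeasure \<mu> (near y) = (\<integral>\<^sup>+ r. emeasure lborel ((\<lambda>x. (x, r)) -` near y) \<partial>\<nu>)"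
    by (rule \<mu>.emeasure_pair_measure_alt2[OF near_sets])
  also have "\<dots> \<le> (\<integral>\<^sup>+ r. ennreal ((2 * (r + ?\<kappa>)) ^ CARD('n)) \<partial>\<nu>)"
  proof (rule nn_integral_mono)
    fix r assume "r \<in> space \<nu>"
    then have r: "0 \<le> 2 * (r + ?\<kappa>)" by (simp add: space_\<nu>)
    have "(\<lambda>x. (x, r)) -` near y \<subseteq> cbox (\<chi> j. y $ j - (r + ?\<kappa>)) (\<chi> j. y $ j - (r + ?\<kappa>) + 2 * (r + ?\<kappa>))"
    proof
      fix x assume "x \<in> (\<lambda>x. (x, r)) -` near y"
      then have "norm (x - y) \<le> r + ?\<kappa>" by (simp add: near_def)
      then have "\<bar>(x - y) $ j\<bar> \<le> r + ?\<kappa>" for j using component_le_norm_cart[of "x - y" j] by linarith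
      then have *: "\<bar>x $ j - y $ j\<bar> \<le> r + ?\<kappa>" for j by simp
      have "y $ j - (r + ?\<kappa>) \<le> x $ j" for j using *[of j] by linarith
      moreover have "x $ j \<le> y $ j - (r + ?\<kappa>) + 2 * (r + ?\<kappa>)" for j using *[of j] by (simp add: abs_le_iff algebra_simps)
      ultimately show "x \<in> cbox (\<chi> j. y $ j - (r + ?\<kappa>)) (\<chi> j. y $ j - (r + ?\<kappa>) + 2 * (r + ?\<kappa>))"
        by (simp add: mem_box_cart)
    qed
    then have "emeasure lborel ((\<lambda>x. (x, r)) -` near y) \<le> emeasure lborel (cbox (\<chi> j. y $ j - (r + ?\<kappa>)) (\<chi> j. y $ j - (r + ?\<kappa>) + 2 * (r + ?\<kappa>)) :: (real ^ 'n) set)"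
      by (rule emeasure_mono) simp
    then show "emeasure lborel ((\<lambda>x. (x, r)) -` near y) \<le> ennreal ((2 * (r + ?\<kappa>)) ^ CARD('n))"
      by (simp only: emeasure_lborel_cube[OF r])
  qed
  also have "\<dots> \<le> ennreal m" by (rule degree)
  finally show ?thesis .
qed

definition siteprob :: "real \<Rightarrow> real \<Rightarrow> nat \<Rightarrow> ('n \<Rightarrow> int) \<times> int \<Rightarrow> real" where
  "siteprob s h q c = 1 - exp (- measure \<mu> (cell s h q c))"

definition site_nbs :: "int \<Rightarrow> real \<Rightarrow> nat \<Rightarrow> ('n \<Rightarrow> int) \<times> int \<Rightarrow> (('n \<Rightarrow> int) \<times> int) set" where
  "site_nbs K h q c = {c' \<in> sites K q. c' \<noteq> c \<and> site_adj h q c c'}"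

lemma siteprob_le: "siteprob s h q c \<le> measure \<mu> (cell s h q c)"
  unfolding siteprob_def using exp_ge_add_one_self[of "- measure \<mu> (cell s h q c)"] by linarith

text \<open>The triangle inequality between a point, the corner of its cell and the corner of
  \<open>c\<close>. Rounding the location and the slack of \<open>site_adj\<close> cost
  \<open>CARD('n) * h\<close> each, rounding the radius costs \<open>1 / q\<close>.\<close>

lemma cell_near:
  assumes h: "0 < h" "h \<le> 1" and q: "q > 0" and adj: "site_adj h q c c'"
  shows "cell s h q c' \<subseteq> near (\<chi> j. - s + h * real_of_int (fst c j))"
proof
  fix z assume z: "z \<in> cell s h q c'"
  let ?d = "real CARD('n)"
  define y :: "real ^ 'n" where "y = (\<chi> j. - s + h * real_of_int (fst c j))"
  define y' :: "real ^ 'n" where "y' = (\<chi> j. - s + h * real_of_int (fst c' j))"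
  have sz: "site s h q z = c'" using z by (simp add: cell_def)
  have "norm (fst z - y') \<le> (\<Sum>j\<in>UNIV. \<bar>(fst z - y') $ j\<bar>)" by (rule norm_le_l1_cart)
  also have "\<dots> \<le> (\<Sum>j\<in>(UNIV :: 'n set). h)"
  proof (rule sum_mono)
    fix j
    show "\<bar>(fst z - y') $ j\<bar> \<le> h"
      using site_coord[OF h(1), where s = s and q = q and z = z and j = j] unfolding sz y'_def
      by (simp add: abs_le_iff)
  qed
  finally have 1: "norm (fst z - y') \<le> ?d * h" by simp
  have "y - y' = (\<chi> j. h * real_of_int (fst c j - fst c' j))"
    by (simp add: y_def y'_def vec_eq_iff right_diff_distrib)
  then have "norm (y - y') \<le> min (real_of_int (snd c + 1)) (real_of_int (snd c' + 1)) / real q + ?d * h"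
    using adj unfolding site_adj_def by simp
  \<comment> \<open>Of the two radii only that of the neighbour is kept. This makes the bound
    uniform in the radius of \<open>c\<close> and leaves an integral over the radius of the
    neighbour.\<close>
  also have "min (real_of_int (snd c + 1)) (real_of_int (snd c' + 1)) / real q \<le> real_of_int (snd c' + 1) / real q"
    by (intro divide_right_mono) auto
  also have "real_of_int (snd c' + 1) / real q \<le> snd z + 1 / real q"
    using site_radius(3)[OF q, where s = s and h = h and z = z] unfolding sz .
  finally have 2: "norm (y - y') \<le> snd z + 1 / real q + ?d * h" by simp
  have "norm (fst z - y) \<le> norm (fst z - y') + norm (y - y')"
    using norm_triangle_ineq4[of "fst z - y'" "y - y'"] by simp
  moreover have "?d * h \<le> ?d * 1" using h by (intro mult_left_mono) auto
  moreover have "1 / real q \<le> 1" using q by simp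
  ultimately have "norm (fst z - y) \<le> snd z + (1 + 2 * ?d)" using 1 2 by linarith
  then show "z \<in> near (\<chi> j. - s + h * real_of_int (fst c j))"
    using z unfolding near_def y_def by (simp add: cell_def)
qed

text \<open>The probability of occupation is at most the intensity of the cell, and cells are
  disjoint. Hence the weight of a neighbourhood is at most the measure of \<open>near\<close>, and
  the total weight is at most the volume of the window, whatever the mesh.\<close>

lemma family:
  assumes s: "0 < s" and h: "0 < h" "h \<le> 1" and q: "q > 0" and k: "k > 0"
  shows "bern_family (sites K q) (siteprob s h q) (site_cliques k h q (sites K q)) (site_nbs K h q) m ((2 * s) ^ CARD('n)) k"
proof
  show "finite (sites K q :: (('n \<Rightarrow> int) \<times> int) set)" by (rule finite_sites)
  show "0 \<le> siteprob s h q c" "siteprob s h q c \<le> 1" for c by (simp_all add: siteprob_def)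
  show "A \<subseteq> sites K q" "card A = k" if "A \<in> site_cliques k h q (sites K q)" for A :: "(('n \<Rightarrow> int) \<times> int) set"
    using that by (simp_all add: site_cliques_def)
  show "k > 0" by (rule k)
  show "A \<subseteq> insert u (site_nbs K h q u)" if "A \<in> site_cliques k h q (sites K q)" "u \<in> A" for A u
  proof
    fix c assume c: "c \<in> A"
    have "A \<subseteq> sites K q" "\<forall>c\<in>A. \<forall>c'\<in>A. c \<noteq> c' \<longrightarrow> site_adj h q c c'"
      using that(1) by (simp_all add: site_cliques_def)
    then show "c \<in> insert u (site_nbs K h q u)" using that(2) c by (auto simp: site_nbs_def)
  qed
  show "site_nbs K h q u \<subseteq> sites K q" for u by (auto simp: site_nbs_def)
  show "sum (siteprob s h q) (site_nbs K h q u) \<le> m" for u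
  proof -
    have "sum (siteprob s h q) (site_nbs K h q u) \<le> (\<Sum>c\<in>site_nbs K h q u. measure \<mu> (cell s h q c))"
      by (intro sum_mono siteprob_le)
    also have "\<dots> \<le> m"
    proof (rule sum_measure_cells_le[OF _ _ near_sets emeasure_near m_nonneg])
      show "finite (site_nbs K h q u)" by (rule finite_subset[OF _ finite_sites[of K q]]) (auto simp: site_nbs_def)
      show "cell s h q c \<subseteq> near (\<chi> j. - s + h * real_of_int (fst u j))" if "c \<in> site_nbs K h q u" for c
        using that by (intro cell_near[OF h q]) (simp add: site_nbs_def)
      show "0 \<le> s" using s by simp
    qed
    finally show ?thesis .
  qed
  show "sum (siteprob s h q) (sites K q) \<le> (2 * s) ^ CARD('n)"
  proof -
    have "sum (siteprob s h q) (sites K q) \<le> (\<Sum>c\<in>sites K q. measure \<mu> (cell s h q c))"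
      by (intro sum_mono siteprob_le)
    also have "\<dots> \<le> (2 * s) ^ CARD('n)"
      using s by (intro sum_measure_cells_le[OF finite_sites cell_subset_strip strip_sets]) (auto simp: emeasure_strip)
    finally show ?thesis .
  qed
qed

text \<open>The additional index accommodates the right faces of the window, where the quotient
  attains its maximum \<open>2 * s / (L / q)\<close>.\<close>

definition grid :: "real \<Rightarrow> real \<Rightarrow> nat \<Rightarrow> (('n \<Rightarrow> int) \<times> int) set" where
  "grid s L q = sites (\<lfloor>2 * s / (L / real q)\<rfloor> + 1) q"

definition occ :: "real \<Rightarrow> real \<Rightarrow> nat \<Rightarrow> 'w \<Rightarrow> (('n \<Rightarrow> int) \<times> int) set" where
  "occ s L q \<omega> = {c \<in> grid s L q. emeasure (\<eta> \<omega>) (cell s (L / real q) q c) \<noteq> 0}"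

definition ncl :: "nat \<Rightarrow> real \<Rightarrow> nat \<Rightarrow> (('n \<Rightarrow> int) \<times> int) set \<Rightarrow> real" where
  "ncl k L q S = real (card (site_cliques k (L / real q) q S))"

lemma finite_grid: "finite (grid s L q)"
  unfolding grid_def by (rule finite_sites)

lemma occ_image:
  assumes \<omega>: "\<omega> \<in> space M"
  shows "occ s L q \<omega> = grid s L q \<inter> site s (L / real q) q ` (points (\<eta> \<omega>) \<inter> strip s)"
proof -
  have "emeasure (\<eta> \<omega>) (cell s (L / real q) q c) = 0 \<longleftrightarrow> points (\<eta> \<omega>) \<inter> cell s (L / real q) q c = {}" for c
    by (rule points_empty_iff[OF _ \<omega> cell_sets]) (rule singleton_sets)
  moreover have "points (\<eta> \<omega>) \<inter> cell s (L / real q) q c = {} \<longleftrightarrow> c \<notin> site s (L / real q) q ` (points (\<eta> \<omega>) \<inter> strip s)" for c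
    using points_nonneg[OF \<omega>] by (auto simp: cell_def strip_def space_\<mu>)
  ultimately show ?thesis unfolding occ_def by auto
qed

lemma occ_integral:
  assumes s: "0 < s"
  shows "(\<lambda>\<omega>. g (occ s L q \<omega>) :: real) \<in> borel_measurable M"
    "(\<integral>\<omega>. g (occ s L q \<omega>) \<partial>M) = bern_exp (siteprob s (L / real q) q) (grid s L q) g"
proof -
  have c: "emeasure \<mu> (cell s (L / real q) q c) < \<infinity>" for c using s by (intro emeasure_cell_finite) simp
  show "(\<lambda>\<omega>. g (occ s L q \<omega>) :: real) \<in> borel_measurable M"
    unfolding occ_def
    by (rule occupied_cells(1)[OF finite_grid cell_sets c disjoint_cells, where p = "siteprob s (L / real q) q"])
      (rule siteprob_def)
  show "(\<integral>\<omega>. g (occ s L q \<omega>) \<partial>M) = bern_exp (siteprob s (L / real q) q) (grid s L q) g"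
    unfolding occ_def
    by (rule occupied_cells(2)[OF finite_grid cell_sets c disjoint_cells]) (rule siteprob_def)
qed

definition dom :: "real \<Rightarrow> 'w \<Rightarrow> real" where
  "dom s \<omega> = 2 powr enn2real (emeasure (\<eta> \<omega>) (strip s))"

lemma dom_ge_1: "1 \<le> dom s \<omega>"
  unfolding dom_def by (intro ge_one_powr_ge_zero) auto

lemma dom_sq_integrable: "0 < s \<Longrightarrow> integrable M (\<lambda>\<omega>. (dom s \<omega>)\<^sup>2)"
proof -
  assume s: "0 < s"
  have "(dom s \<omega>)\<^sup>2 = 4 powr enn2real (emeasure (\<eta> \<omega>) (strip s))" for \<omega>
  proof -
    have "(2 * 2) powr a = 2 powr a * 2 powr (a :: real)" for a by (rule powr_mult; simp)
    then show ?thesis unfolding dom_def power2_eq_square by simp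
  qed
  then show ?thesis
    using nn_integral_power_count(2)[OF strip_sets emeasure_strip_finite, of s 4] s by simp
qed

lemma ncl_le_dom:
  assumes s: "0 < s" and \<omega>: "\<omega> \<in> space M" and fin: "emeasure (\<eta> \<omega>) (strip s) < \<infinity>"
  shows "ncl k L q (occ s L q \<omega>) \<le> dom s \<omega>"
proof -
  let ?P = "points (\<eta> \<omega>) \<inter> strip s"
  have fP: "finite ?P" by (rule points_card(1)[OF _ \<omega> strip_sets fin]) (rule singleton_sets)
  have cP: "of_nat (card ?P) \<le> emeasure (\<eta> \<omega>) (strip s)"
    by (rule points_card(2)[OF _ \<omega> strip_sets fin]) (rule singleton_sets)
  then have cP': "real (card ?P) \<le> enn2real (emeasure (\<eta> \<omega>) (strip s))"
    using enn2real_mono[OF cP] fin by simp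
  have fo: "finite (occ s L q \<omega>)" by (rule finite_subset[OF _ finite_grid[of s L q]]) (auto simp: occ_def)
  have co: "card (occ s L q \<omega>) \<le> card ?P"
    unfolding occ_image[OF \<omega>]
    by (rule order_trans[OF card_mono card_image_le]) (use fP in auto)
  have "card (site_cliques k (L / real q) q (occ s L q \<omega>)) \<le> card (Pow (occ s L q \<omega>))"
    using fo by (intro card_mono) (auto simp: site_cliques_def)
  also have "\<dots> = 2 ^ card (occ s L q \<omega>)" using fo by (rule card_Pow)
  finally have "ncl k L q (occ s L q \<omega>) \<le> real (2 ^ card (occ s L q \<omega>))"
    unfolding ncl_def by (simp only: of_nat_le_iff)
  also have "\<dots> = 2 powr real (card (occ s L q \<omega>))" by (simp add: powr_realpow)
  also have "\<dots> \<le> dom s \<omega>"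
    unfolding dom_def using co cP' by (intro powr_mono) auto
  finally show ?thesis .
qed

lemma eventually_ncl:
  assumes t: "0 < t" and L: "0 < L"
  defines "s \<equiv> t powr (1 / real CARD('n))"
  shows "AE \<omega> in M. \<forall>\<^sub>F q in sequentially. ncl k L q (occ s L q \<omega>) = real (num_cliques k t (\<eta> \<omega>))"
proof -
  have s: "0 < s" using t by (simp add: s_def)
  show ?thesis
    using AE_finite_strip[OF less_imp_le[OF s]] AE_distinct_locations[OF s] AE_space
  proof (eventually_elim)
    case (elim \<omega>)
    let ?P = "points (\<eta> \<omega>) \<inter> strip s"
    have \<omega>: "\<omega> \<in> space M" by fact
    have fP: "finite ?P" by (rule points_card(1)[OF _ \<omega> strip_sets]) (use elim singleton_sets in auto)
    have win: "points (\<eta> \<omega>) \<inter> (window t \<times> UNIV) = ?P"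
      unfolding window_cube s_def[symmetric] by (rule points_strip[OF \<omega>])
    have "num_cliques k t (\<eta> \<omega>) = card (clique_sets k ?P)"
      unfolding win[symmetric]
    proof (rule num_cliques_eq_card)
      show "finite (points (\<eta> \<omega>) \<inter> (window t \<times> UNIV))" "inj_on fst (points (\<eta> \<omega>) \<inter> (window t \<times> UNIV))"
        unfolding win by fact+
      show "0 \<le> snd z" if "z \<in> points (\<eta> \<omega>) \<inter> (window t \<times> UNIV)" for z
        using that unfolding win by (auto simp: strip_def)
    qed
    moreover have "\<forall>\<^sub>F q in sequentially. site s (L / real q) q ` ?P \<subseteq> sites (\<lfloor>2 * s / (L / real q)\<rfloor> + 1) q \<and>
        card (site_cliques k (L / real q) q (site s (L / real q) q ` ?P)) = card (clique_sets k ?P)"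
      by (rule eventually_site_cliques[OF L fP]) (use elim in \<open>auto simp: strip_def\<close>)
    then have "\<forall>\<^sub>F q in sequentially. ncl k L q (occ s L q \<omega>) = real (card (clique_sets k ?P))"
    proof eventually_elim
      case (elim q)
      have "occ s L q \<omega> = site s (L / real q) q ` ?P"
        unfolding occ_image[OF \<omega>] grid_def using elim by auto
      then show ?case using elim by (simp add: ncl_def)
    qed
    ultimately show ?case by simp
  qed
qed

abbreviation cliques :: "nat \<Rightarrow> real \<Rightarrow> 'w \<Rightarrow> real" where
  "cliques k t \<omega> \<equiv> real (num_cliques k t (\<eta> \<omega>))"

lemma cliques_borel [measurable]: "cliques k t \<in> borel_measurable M"
  using measurable_compose[OF num_cliques_measurable, of real borel k t] by simp

text \<open>One statement for the mean, the second moment and the standardised test functions. As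
  \<open>dom\<close> is at least 1 and square integrable, quadratic growth of \<open>f q\<close>,
  uniformly in \<open>q\<close>, provides the dominating function.\<close>

lemma bern_exp_tendsto:
  assumes t: "0 < t" and L: "0 < L"
    and f: "\<And>q. f q \<in> borel_measurable borel" "fl \<in> borel_measurable borel" "\<And>x. (\<lambda>q. f q x) \<longlonglongrightarrow> fl x"
    and bd: "\<And>q x w. 1 \<le> w \<Longrightarrow> 0 \<le> x \<Longrightarrow> x \<le> w \<Longrightarrow> \<bar>f q x\<bar> \<le> b * w\<^sup>2"
  defines "s \<equiv> t powr (1 / real CARD('n))"
  shows "integrable M (\<lambda>\<omega>. fl (cliques k t \<omega>))"
    "(\<lambda>q. bern_exp (siteprob s (L / real q) q) (grid s L q) (\<lambda>S. f q (ncl k L q S))) \<longlonglongrightarrow> expct M (\<lambda>\<omega>. fl (cliques k t \<omega>))"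
proof -
  have s: "0 < s" using t by (simp add: s_def)
  have Xq: "(\<lambda>\<omega>. ncl k L q (occ s L q \<omega>)) \<in> borel_measurable M" for q
    by (rule occ_integral(1)[OF s])
  have D: "integrable M (\<lambda>\<omega>. b * (dom s \<omega>)\<^sup>2)" using dom_sq_integrable[OF s] by (rule integrable_mult_right)
  have bd': "AE \<omega> in M. \<bar>f q (ncl k L q (occ s L q \<omega>))\<bar> \<le> b * (dom s \<omega>)\<^sup>2" for q
    using AE_finite_strip[OF less_imp_le[OF s]] AE_space
  proof eventually_elim
    case (elim \<omega>)
    show ?case by (rule bd[OF dom_ge_1 _ ncl_le_dom[OF s elim(2,1)]]) (simp add: ncl_def)
  qed
  note lim = expectation_eventually_eq[where X = "cliques k t" and Xq = "\<lambda>q \<omega>. ncl k L q (occ s L q \<omega>)" and f = f and g = fl,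
      OF Xq cliques_borel eventually_ncl[OF t L, folded s_def] D f(1,2,3) bd']
  show "integrable M (\<lambda>\<omega>. fl (cliques k t \<omega>))" by (rule lim(1))
  show "(\<lambda>q. bern_exp (siteprob s (L / real q) q) (grid s L q) (\<lambda>S. f q (ncl k L q S))) \<longlonglongrightarrow> expct M (\<lambda>\<omega>. fl (cliques k t \<omega>))"
  proof -
    have "(\<integral>\<omega>. f q (ncl k L q (occ s L q \<omega>)) \<partial>M) = bern_exp (siteprob s (L / real q) q) (grid s L q) (\<lambda>S. f q (ncl k L q S))" for q
      by (rule occ_integral(2)[OF s])
    with lim(2) show ?thesis unfolding expct_def by simp
  qed
qed

end

section \<open>Moments and normal approximation\<close>

lemma close_integrals:
  fixes g h :: "real \<Rightarrow> real"
  assumes "prob_space P" "sets P = sets borel" "integrable P h" "g \<in> borel_measurable borel" "\<And>x. \<bar>h x - g x\<bar> \<le> e"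
  shows "\<bar>(\<integral>x. g x \<partial>P) - (\<integral>x. h x \<partial>P)\<bar> \<le> e"
proof -
  interpret P: prob_space P by fact
  have gm: "g \<in> borel_measurable P" using assms(4) by (simp add: measurable_cong_sets[OF assms(2) refl])
  have hm: "h \<in> borel_measurable P" using assms(3) by simp
  have d: "integrable P (\<lambda>x. g x - h x)"
  proof (rule P.integrable_const_bound[where B = e])
    show "AE x in P. norm (g x - h x) \<le> e" using assms(5) by (simp add: abs_minus_commute)
  qed (use gm hm in measurable)
  have "integrable P g" using Bochner_Integration.integrable_add[OF d assms(3)] by simp
  then have "(\<integral>x. g x \<partial>P) - (\<integral>x. h x \<partial>P) = (\<integral>x. g x - h x \<partial>P)"
    using assms(3) by simp
  also have "\<bar>\<dots>\<bar> \<le> (\<integral>x. e \<partial>P)"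
  proof (rule integral_abs_bound[THEN order_trans], rule integral_mono)
    show "integrable P (\<lambda>x. \<bar>g x - h x\<bar>)" using d by (rule integrable_abs)
    show "\<bar>g x - h x\<bar> \<le> e" for x using assms(5)[of x] by (simp add: abs_minus_commute)
  qed simp
  also have "\<dots> = e" by (simp add: P.prob_space)
  finally show ?thesis .
qed

context poisson_cliques_degree
begin

lemma side_power: "0 < t \<Longrightarrow> (2 * t powr (1 / real CARD('n))) ^ CARD('n) = 2 ^ CARD('n) * t"
  by (simp add: power_mult_distrib powr_realpow[symmetric] powr_powr)

lemma cliques_moments:
  assumes t: "0 < t" and L: "0 < L"
  defines "s \<equiv> t powr (1 / real CARD('n))"
  shows "integrable M (cliques k t)" "integrable M (\<lambda>\<omega>. (cliques k t \<omega>)\<^sup>2)"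
    "(\<lambda>q. bern_exp (siteprob s (L / real q) q) (grid s L q) (ncl k L q)) \<longlonglongrightarrow> expct M (cliques k t)"
    "(\<lambda>q. bern_exp (siteprob s (L / real q) q) (grid s L q) (\<lambda>S. (ncl k L q S)\<^sup>2)) \<longlonglongrightarrow> expct M (\<lambda>\<omega>. (cliques k t \<omega>)\<^sup>2)"
proof -
  have b1: "\<bar>x\<bar> \<le> 1 * w\<^sup>2" if "1 \<le> w" "0 \<le> x" "x \<le> w" for x w :: real
  proof -
    have "w \<le> w\<^sup>2" using that(1) by (simp add: power2_eq_square)
    with that show ?thesis by simp
  qed
  have b2: "\<bar>x\<^sup>2\<bar> \<le> 1 * w\<^sup>2" if "1 \<le> w" "0 \<le> x" "x \<le> w" for x w :: real
    using that by (simp add: power_mono)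
  note 1 = bern_exp_tendsto[OF t L, where f = "\<lambda>q x. x" and fl = "\<lambda>x. x" and b = 1 and k = k, folded s_def, OF _ _ _ b1]
  note 2 = bern_exp_tendsto[OF t L, where f = "\<lambda>q x. x\<^sup>2" and fl = "\<lambda>x. x\<^sup>2" and b = 1 and k = k, folded s_def, OF _ _ _ b2]
  show "integrable M (cliques k t)" using 1(1) by simp
  show "integrable M (\<lambda>\<omega>. (cliques k t \<omega>)\<^sup>2)" using 2(1) by simp
  show "(\<lambda>q. bern_exp (siteprob s (L / real q) q) (grid s L q) (ncl k L q)) \<longlonglongrightarrow> expct M (cliques k t)"
    using 1(2) by simp
  show "(\<lambda>q. bern_exp (siteprob s (L / real q) q) (grid s L q) (\<lambda>S. (ncl k L q S)\<^sup>2)) \<longlonglongrightarrow> expct M (\<lambda>\<omega>. (cliques k t \<omega>)\<^sup>2)"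
    using 2(2) by simp
qed

lemma var_eq: "0 < t \<Longrightarrow> var M (cliques k t) = expct M (\<lambda>\<omega>. (cliques k t \<omega>)\<^sup>2) - (expct M (cliques k t))\<^sup>2"
  unfolding var_def expct_def
  by (rule variance_eq) (use cliques_moments(1,2)[of t 1 k] in auto)

definition grid_var :: "nat \<Rightarrow> real \<Rightarrow> real \<Rightarrow> nat \<Rightarrow> real" where
  "grid_var k s L q = bern_exp (siteprob s (L / real q) q) (grid s L q) (\<lambda>S. (ncl k L q S)\<^sup>2)
     - (bern_exp (siteprob s (L / real q) q) (grid s L q) (ncl k L q))\<^sup>2"

lemma grid_var_tendsto:
  assumes "0 < t" "0 < L"
  shows "(\<lambda>q. grid_var k (t powr (1 / real CARD('n))) L q) \<longlonglongrightarrow> var M (cliques k t)"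
  unfolding grid_var_def var_eq[OF assms(1)]
  by (intro tendsto_intros cliques_moments[OF assms])

lemma grid_family:
  assumes s: "0 < s" and L: "0 < L" and q: "q > 0" "L \<le> real q" and k: "k > 0"
  shows "bern_family (grid s L q) (siteprob s (L / real q) q) (site_cliques k (L / real q) q (grid s L q))
     (site_nbs (\<lfloor>2 * s / (L / real q)\<rfloor> + 1) (L / real q) q) m ((2 * s) ^ CARD('n)) k"
  unfolding grid_def using assms by (intro family) auto

lemma count_ncl:
  assumes fam: "bern_family (grid s L q) p (site_cliques k (L / real q) q (grid s L q)) Nb m' T k" and S: "S \<subseteq> grid s L q"
  shows "bern_family.count (site_cliques k (L / real q) q (grid s L q)) S = ncl k L q S"
proof -
  interpret F: bern_family "grid s L q" p "site_cliques k (L / real q) q (grid s L q)" Nb m' T k by fact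
  have "F.count S = real (card {A \<in> site_cliques k (L / real q) q (grid s L q). A \<subseteq> S})"
    unfolding F.count_def using F.finite_\<A> by (simp add: sum.If_cases of_bool_def Int_def)
  also have "{A \<in> site_cliques k (L / real q) q (grid s L q). A \<subseteq> S} = site_cliques k (L / real q) q S"
    using S by (auto simp: site_cliques_def)
  finally show ?thesis by (simp add: ncl_def)
qed

lemma grid_var_eq:
  assumes s: "0 < s" and L: "0 < L" and q: "q > 0" "L \<le> real q" and k: "k > 0"
  defines "\<A> \<equiv> site_cliques k (L / real q) q (grid s L q)" and "p \<equiv> siteprob s (L / real q) q"
  shows "grid_var k s L q = (\<Sum>A\<in>\<A>. \<Sum>B\<in>\<A>. prod p (A \<union> B) - prod p A * prod p B)"
    and "grid_var k s L q \<le> chain_const2 k m * (2 * s) ^ CARD('n)"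
    and "\<And>A B. A \<in> \<A> \<Longrightarrow> B \<in> \<A> \<Longrightarrow> prod p A * prod p B \<le> prod p (A \<union> B)"
    and "finite \<A>"
proof -
  note fam = grid_family[OF s L q k]
  interpret F: bern_family "grid s L q" p \<A> "site_nbs (\<lfloor>2 * s / (L / real q)\<rfloor> + 1) (L / real q) q" m "(2 * s) ^ CARD('n)" k
    unfolding \<A>_def p_def by (rule fam)
  have c: "F.count S = ncl k L q S" if "S \<subseteq> grid s L q" for S
    unfolding \<A>_def by (rule count_ncl[OF fam that])
  have e1: "F.E F.count = F.E (ncl k L q)" by (rule bern_exp_cong) (rule c)
  have e2: "F.E (\<lambda>S. (F.count S)\<^sup>2) = F.E (\<lambda>S. (ncl k L q S)\<^sup>2)" by (rule bern_exp_cong) (simp only: c)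
  have "F.Var F.count = F.E (\<lambda>S. (ncl k L q S)\<^sup>2) - (F.E (ncl k L q))\<^sup>2"
    unfolding F.Var_eq e1 e2 ..
  then have v: "grid_var k s L q = F.Var F.count"
    by (simp only: grid_var_def p_def)
  show "grid_var k s L q = (\<Sum>A\<in>\<A>. \<Sum>B\<in>\<A>. prod p (A \<union> B) - prod p A * prod p B)"
    unfolding v by (rule F.Var_count)
  show "grid_var k s L q \<le> chain_const2 k m * (2 * s) ^ CARD('n)"
    unfolding v by (rule F.Var_count_le)
  show "prod p A * prod p B \<le> prod p (A \<union> B)" if "A \<in> \<A>" "B \<in> \<A>" for A B
    by (rule F.prod_p_mult_le; rule F.finite_mem) (use that in auto)
  show "finite \<A>" by (rule F.finite_\<A>)
qed

lemma eventually_fine: "\<forall>\<^sub>F q in sequentially. q > 0 \<and> L \<le> real q"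
  using eventually_gt_at_top[of 0] eventually_ge_at_top[of "nat \<lceil>L\<rceil>"]
  by eventually_elim linarith

lemma var_le:
  assumes t: "0 < t" and k: "k > 0"
  shows "var M (cliques k t) \<le> chain_const2 k m * (2 ^ CARD('n) * t)"
proof (rule tendsto_upperbound[OF grid_var_tendsto[OF t, of 1 k]])
  show "\<forall>\<^sub>F q in sequentially. grid_var k (t powr (1 / real CARD('n))) 1 q \<le> chain_const2 k m * (2 ^ CARD('n) * t)"
    using eventually_fine[of 1]
  proof eventually_elim
    case (elim q)
    then show ?case
      using grid_var_eq(2)[of "t powr (1 / real CARD('n))" 1 q k] t k unfolding side_power[OF t] by simp
  qed
qed simp_all

text \<open>The bound of \<open>stein_bound\<close> for the volume \<open>2 ^ CARD('n) * t\<close>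
  of the window. The standard deviation is an argument, so that the limit in the mesh can be taken
  by continuity.\<close>

definition stein_const :: "nat \<Rightarrow> real \<Rightarrow> real \<Rightarrow> real" where
  "stein_const k t \<sigma> = 27 * (chain_const3 k m * (2 ^ CARD('n) * t)) / \<sigma> ^ 3
     + 54 * sqrt (chain_const4 k m * (2 ^ CARD('n) * t)) / \<sigma>\<^sup>2"

lemma stein_limit:
  fixes h :: "real \<Rightarrow> real"
  assumes t: "0 < t" and k: "k > 0" and var: "var M (cliques k t) > 0"
    and h: "\<And>x. (h has_real_derivative h' x) (at x)" and h': "\<And>x. \<bar>h' x\<bar> \<le> 1"
  shows "integrable M (\<lambda>\<omega>. h (standardize M (cliques k t) \<omega>))"
    and "\<bar>(\<integral>\<omega>. h (standardize M (cliques k t) \<omega>) \<partial>M) - integral\<^sup>L std_normal_distribution h\<bar>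
      \<le> stein_const k t (sqrt (var M (cliques k t)))"
proof -
  define s where "s = t powr (1 / real CARD('n))"
  define \<sigma> where "\<sigma> = sqrt (var M (cliques k t))"
  define e where "e = expct M (cliques k t)"
  define \<sigma>q where "\<sigma>q q = sqrt (grid_var k s 1 q)" for q
  define eq where "eq q = bern_exp (siteprob s (1 / real q) q) (grid s 1 q) (ncl k 1 q)" for q
  have s: "0 < s" using t by (simp add: s_def)
  have \<sigma>: "0 < \<sigma>" using var by (simp add: \<sigma>_def)
  have \<sigma>lim: "\<sigma>q \<longlonglongrightarrow> \<sigma>"
    unfolding \<sigma>q_def \<sigma>_def s_def by (intro tendsto_real_sqrt grid_var_tendsto t) simp
  have elim: "eq \<longlonglongrightarrow> e"
    unfolding eq_def e_def s_def by (rule cliques_moments(3)[OF t]) simp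
  have cont: "isCont h x" for x using h DERIV_isCont by blast
  have hm [measurable]: "h \<in> borel_measurable borel"
    by (intro borel_measurable_continuous_onI) (simp add: continuous_at_imp_continuous_on cont)
  have lip: "\<bar>h x - h y\<bar> \<le> \<bar>x - y\<bar>" for x y
    using field_differentiable_bound[of UNIV h h' 1 x y] h h' by auto
  \<comment> \<open>A bound for the discrete means that is uniform in \<open>q\<close>, since
    domination is required for every \<open>q\<close>.\<close>
  obtain K where K: "\<And>q. \<bar>eq q\<bar> \<le> K" "0 < K"
    using convergent_imp_Bseq[OF convergentI[OF elim]] by (auto simp: Bseq_def)
  \<comment> \<open>For coarse meshes the discrete variance may be small or 0. The maximum with
    \<open>\<sigma> / 2\<close> keeps the quotient dominated for all \<open>q\<close>, and
    eventually it equals the discrete standard deviation, because this tends to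
    \<open>\<sigma>\<close>.\<close>
  define f where "f q x = h ((x - eq q) / max (\<sigma>q q) (\<sigma> / 2))" for q x
  define f0 where "f0 x = h ((x - e) / \<sigma>)" for x
  have mlim: "(\<lambda>q. max (\<sigma>q q) (\<sigma> / 2)) \<longlonglongrightarrow> \<sigma>"
    using tendsto_max[OF \<sigma>lim tendsto_const[of "\<sigma> / 2"]] \<sigma> by simp
  have flim: "(\<lambda>q. f q x) \<longlonglongrightarrow> f0 x" for x
    unfolding f_def f0_def using \<sigma>
    by (intro isCont_tendsto_compose[OF cont] tendsto_intros elim mlim) simp
  have fm: "f q \<in> borel_measurable borel" "f0 \<in> borel_measurable borel" for q
    unfolding f_def f0_def by measurable
  have bd: "\<bar>f q x\<bar> \<le> (\<bar>h 0\<bar> + (1 + K) / (\<sigma> / 2)) * w\<^sup>2" if w: "1 \<le> w" "0 \<le> x" "x \<le> w" for q x w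
  proof -
    let ?y = "(x - eq q) / max (\<sigma>q q) (\<sigma> / 2)"
    have ww: "1 \<le> w\<^sup>2" "w \<le> w\<^sup>2" using w(1) by (simp_all add: power2_eq_square mult_ge1_I)
    have "\<bar>x - eq q\<bar> \<le> w + K" using K(1)[of q] w by linarith
    also have "\<dots> \<le> w\<^sup>2 + K * w\<^sup>2" using ww K(2) by (intro add_mono) auto
    finally have num: "\<bar>x - eq q\<bar> \<le> (1 + K) * w\<^sup>2" by (simp add: algebra_simps)
    have "\<bar>?y\<bar> = \<bar>x - eq q\<bar> / max (\<sigma>q q) (\<sigma> / 2)" using \<sigma> by (simp add: abs_div)
    also have "\<dots> \<le> ((1 + K) * w\<^sup>2) / (\<sigma> / 2)" using num \<sigma> K(2) by (intro frac_le) auto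
    finally have y: "\<bar>?y\<bar> \<le> (1 + K) / (\<sigma> / 2) * w\<^sup>2" by (simp only: times_divide_eq_left)
    have "\<bar>h ?y - h 0\<bar> \<le> \<bar>?y\<bar>" using lip[of ?y 0] by (simp only: diff_zero)
    then have "\<bar>f q x\<bar> \<le> \<bar>h 0\<bar> + \<bar>?y\<bar>" unfolding f_def by linarith
    also have "\<dots> \<le> \<bar>h 0\<bar> * w\<^sup>2 + (1 + K) / (\<sigma> / 2) * w\<^sup>2"
      using ww(1) y by (intro add_mono) (auto simp: mult_le_cancel_left1)
    finally show ?thesis by (simp add: distrib_right)
  qed
  note lim = bern_exp_tendsto[OF t zero_less_one fm(1) fm(2) flim bd, of k, folded s_def]
  have f0: "f0 (cliques k t \<omega>) = h (standardize M (cliques k t) \<omega>)" for \<omega>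
    by (simp add: f0_def standardize_def e_def \<sigma>_def)
  show "integrable M (\<lambda>\<omega>. h (standardize M (cliques k t) \<omega>))" using lim(1) unfolding f0 .
  let ?I = "integral\<^sup>L std_normal_distribution h"
  let ?b = "\<lambda>\<sigma>. stein_const k t \<sigma>"
  have half: "\<sigma> / 2 < \<sigma>" using \<sigma> by simp
  have "(\<lambda>q. \<bar>bern_exp (siteprob s (1 / real q) q) (grid s 1 q) (\<lambda>S. f q (ncl k 1 q S)) - ?I\<bar>)
     \<longlonglongrightarrow> \<bar>(\<integral>\<omega>. h (standardize M (cliques k t) \<omega>) \<partial>M) - ?I\<bar>"
    using lim(2) unfolding f0 expct_def by (intro tendsto_rabs tendsto_diff tendsto_const)
  moreover have "(\<lambda>q. ?b (\<sigma>q q)) \<longlonglongrightarrow> ?b \<sigma>"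
    unfolding stein_const_def using \<sigma> by (intro tendsto_intros \<sigma>lim) auto
  moreover have "\<forall>\<^sub>F q in sequentially. \<bar>bern_exp (siteprob s (1 / real q) q) (grid s 1 q) (\<lambda>S. f q (ncl k 1 q S)) - ?I\<bar> \<le> ?b (\<sigma>q q)"
    using eventually_fine[of 1] order_tendstoD(1)[OF \<sigma>lim half]
  proof eventually_elim
    case (elim q)
    then have q: "q > 0" "1 \<le> real q" and big: "\<sigma> / 2 < \<sigma>q q" by auto
    let ?p = "siteprob s (1 / real q) q" and ?\<A> = "site_cliques k (1 / real q) q (grid s 1 q)"
    note fam = grid_family[OF s zero_less_one q k]
    interpret F: bern_family "grid s 1 q" ?p ?\<A> "site_nbs (\<lfloor>2 * s / (1 / real q)\<rfloor> + 1) (1 / real q) q" m "(2 * s) ^ CARD('n)" k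
      by (rule fam)
    have c: "F.count S = ncl k 1 q S" if "S \<subseteq> grid s 1 q" for S
      by (rule count_ncl[OF fam that])
    have e1: "F.E F.count = eq q" unfolding eq_def by (rule bern_exp_cong) (rule c)
    have e2: "F.E (\<lambda>S. (F.count S)\<^sup>2) = F.E (\<lambda>S. (ncl k 1 q S)\<^sup>2)" by (rule bern_exp_cong) (simp only: c)
    have v: "F.Var F.count = grid_var k s 1 q"
      unfolding grid_var_def F.Var_eq e1 e2 eq_def ..
    have vpos: "F.Var F.count > 0" using big \<sigma> unfolding v \<sigma>q_def
      by (meson half_gt_zero less_trans real_sqrt_gt_0_iff)
    have "F.E (\<lambda>S. f q (ncl k 1 q S)) = F.E (\<lambda>S. h ((F.count S - F.E F.count) / sqrt (F.Var F.count)))"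
      using big unfolding f_def e1 v \<sigma>q_def[symmetric] by (intro bern_exp_cong) (simp add: c)
    then show ?case
      using F.stein_bound[OF h h' vpos] unfolding v \<sigma>q_def[symmetric] stein_const_def
      by (simp only: side_power[OF t, folded s_def])
  qed
  ultimately show "\<bar>(\<integral>\<omega>. h (standardize M (cliques k t) \<omega>) \<partial>M) - ?I\<bar> \<le> stein_const k t (sqrt (var M (cliques k t)))"
    unfolding \<sigma>_def[symmetric] using tendsto_le[OF sequentially_bot] by blast
qed

lemma wasserstein_le:
  assumes t: "0 < t" and k: "k > 0" and var: "var M (cliques k t) > 0"
  shows "wasserstein (distr M borel (standardize M (cliques k t))) std_normal_distribution
    \<le> ennreal (stein_const k t (sqrt (var M (cliques k t))))"
  unfolding wasserstein_def
proof (rule SUP_least)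
  fix g :: "real \<Rightarrow> real" assume "g \<in> {g. 1-lipschitz_on UNIV g}"
  then have g: "1-lipschitz_on UNIV g" by simp
  let ?b = "stein_const k t (sqrt (var M (cliques k t)))"
  let ?P = "distr M borel (standardize M (cliques k t))"
  have gm: "g \<in> borel_measurable borel"
    using lipschitz_on_continuous_on[OF g] by (rule borel_measurable_continuous_onI)
  have W [measurable]: "standardize M (cliques k t) \<in> borel_measurable M"
    unfolding standardize_def[abs_def] by measurable
  have "\<bar>(\<integral>x. g x \<partial>?P) - (\<integral>x. g x \<partial>std_normal_distribution)\<bar> \<le> ?b + e" if e: "0 < e" for e
  proof -
    \<comment> \<open>Replacing \<open>g\<close> by \<open>h\<close> costs \<open>e / 2\<close>
      under each of the two laws.\<close>
    obtain h h' where h: "\<And>x. (h has_real_derivative h' x) (at x)" "\<And>x. \<bar>h' x\<bar> \<le> 1" "\<And>x. \<bar>h x - g x\<bar> \<le> e / 2"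
      using lipschitz_smoothing[OF g half_gt_zero[OF e]] by metis
    have cont: "isCont h x" for x using h(1) DERIV_isCont by blast
    have hm [measurable]: "h \<in> borel_measurable borel"
      by (intro borel_measurable_continuous_onI) (simp add: continuous_at_imp_continuous_on cont)
    note lim = stein_limit[OF t k var h(1,2)]
    have "integrable ?P h" using lim(1) by (simp add: integrable_distr_eq)
    then have 1: "\<bar>(\<integral>x. g x \<partial>?P) - (\<integral>x. h x \<partial>?P)\<bar> \<le> e / 2"
      by (intro close_integrals prob_space_distr W gm h(3)) simp_all
    have "integrable std_normal_distribution h"
      using std_normal_lipschitz_integrable(1)[OF h(1,2)] by (subst integrable_density) auto
    then have 2: "\<bar>(\<integral>x. g x \<partial>std_normal_distribution) - (\<integral>x. h x \<partial>std_normal_distribution)\<bar> \<le> e / 2"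
      by (intro close_integrals prob_space_normal_density gm h(3)) simp_all
    have "(\<integral>x. h x \<partial>?P) = (\<integral>\<omega>. h (standardize M (cliques k t) \<omega>) \<partial>M)"
      by (rule integral_distr[OF W hm])
    with lim(2) 1 2 show ?thesis by linarith
  qed
  then have "\<bar>(\<integral>x. g x \<partial>?P) - (\<integral>x. g x \<partial>std_normal_distribution)\<bar> \<le> ?b"
    by (rule field_le_epsilon)
  then show "ennreal \<bar>(\<integral>x. g x \<partial>?P) - (\<integral>x. g x \<partial>std_normal_distribution)\<bar> \<le> ennreal ?b"
    by (rule ennreal_leI)
qed

end

section \<open>Linear growth of the variance\<close>

text \<open>With \<open>y ^ d = t / t0\<close>, superadditivity gives
  \<open>V t / t >= (1 - 1 / y) ^ d * (V t0 / t0)\<close>, and the first factor tends to 1. Hence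
  the limit is the supremum of \<open>V t / t\<close>, which is finite by the linear bound and
  positive because of \<open>t1\<close>.\<close>

lemma superadditive_limit:
  fixes V :: "real \<Rightarrow> real" and d :: nat
  assumes d: "d > 0" and le: "\<And>t. 0 < t \<Longrightarrow> V t \<le> C * t" and nonneg: "\<And>t. 0 < t \<Longrightarrow> 0 \<le> V t"
    and super: "\<And>t t0. 0 < t \<Longrightarrow> 0 < t0 \<Longrightarrow> real (nat \<lfloor>t powr (1 / real d) / t0 powr (1 / real d)\<rfloor>) ^ d * V t0 \<le> V t"
    and pos: "0 < t1" "0 < V t1"
  obtains c where "c > 0" "((\<lambda>t. V t / t) \<longlongrightarrow> c) at_top"
proof -
  define S where "S = (\<lambda>t. V t / t) ` {0<..}"
  define c where "c = Sup S"
  have bdd: "bdd_above S"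
    unfolding S_def by (rule bdd_aboveI2[where M = C]) (use le in \<open>auto simp: pos_divide_le_eq\<close>)
  have ne: "S \<noteq> {}" by (auto simp: S_def)
  have upper: "V t / t \<le> c" if "0 < t" for t
    unfolding c_def using that by (intro cSup_upper[OF _ bdd]) (auto simp: S_def)
  have "0 < V t1 / t1" using pos by simp
  then have c: "c > 0" using upper[OF pos(1)] by linarith
  have "((\<lambda>t. V t / t) \<longlongrightarrow> c) at_top"
  proof (rule order_tendstoI)
    fix a assume a: "c < a"
    show "\<forall>\<^sub>F t in at_top. V t / t < a"
      using eventually_gt_at_top[of 0]
    proof eventually_elim
      case (elim t)
      then show ?case using upper[of t] a by linarith
    qed
  next
    fix a assume "a < c"
    then obtain x where "x \<in> S" "a < x" unfolding c_def using less_cSup_iff[OF ne bdd] by auto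
    then obtain t0 where t0: "0 < t0" "a < V t0 / t0" by (auto simp: S_def)
    define y where "y t = t powr (1 / real d) / t0 powr (1 / real d)" for t
    have ytop: "filterlim y at_top at_top"
    proof -
      have "filterlim (\<lambda>t::real. t powr (1 / real d)) at_top at_top"
        using d by real_asymp
      then have "filterlim (\<lambda>t::real. (1 / t0 powr (1 / real d)) * t powr (1 / real d)) at_top at_top"
        using t0 by (intro filterlim_tendsto_pos_mult_at_top[OF tendsto_const]) auto
      then show ?thesis by (simp add: y_def[abs_def])
    qed
    have "((\<lambda>t. (1 - 1 / y t) ^ d * (V t0 / t0)) \<longlongrightarrow> (1 - 0) ^ d * (V t0 / t0)) at_top"
      by (intro tendsto_intros tendsto_divide_0[OF tendsto_const] filterlim_at_top_imp_at_infinity ytop)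
    then have "((\<lambda>t. (1 - 1 / y t) ^ d * (V t0 / t0)) \<longlongrightarrow> V t0 / t0) at_top" by simp
    from order_tendstoD(1)[OF this t0(2)]
    have "\<forall>\<^sub>F t in at_top. a < (1 - 1 / y t) ^ d * (V t0 / t0)" .
    moreover have "\<forall>\<^sub>F t in at_top. 1 \<le> y t" using ytop by (simp add: filterlim_at_top)
    ultimately show "\<forall>\<^sub>F t in at_top. a < V t / t"
      using eventually_gt_at_top[of 0]
    proof eventually_elim
      case (elim t)
      have yd: "y t ^ d = t / t0"
        using elim t0 d by (simp add: y_def power_divide powr_realpow[symmetric] powr_powr)
      have "y t - 1 \<le> real (nat \<lfloor>y t\<rfloor>)" by linarith
      then have "(y t - 1) ^ d \<le> real (nat \<lfloor>y t\<rfloor>) ^ d" using elim by (intro power_mono) auto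
      then have "(y t - 1) ^ d * V t0 \<le> real (nat \<lfloor>y t\<rfloor>) ^ d * V t0"
        using nonneg[OF t0(1)] by (rule mult_right_mono)
      also have "\<dots> \<le> V t" unfolding y_def using elim t0 by (intro super) auto
      finally have Vt: "(y t - 1) ^ d * V t0 \<le> V t" .
      have "(1 - 1 / y t) ^ d * (V t0 / t0) = ((y t - 1) / y t) ^ d * (V t0 / t0)"
        using elim by (simp add: diff_divide_distrib)
      also have "\<dots> = (y t - 1) ^ d * V t0 / t"
        using elim t0 unfolding power_divide yd by simp
      also have "\<dots> \<le> V t / t" using Vt elim by (intro divide_right_mono) auto
      finally show ?case using elim by linarith
    qed
  qed
  with c show ?thesis by (rule that)
qed

text \<open>Translation by whole windows: for mesh \<open>2 * s0 / q\<close> the side of the small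
  window is \<open>q\<close> cells long.\<close>

definition site_shift :: "nat \<Rightarrow> ('n \<Rightarrow> int) \<Rightarrow> ('n \<Rightarrow> int) \<times> int \<Rightarrow> ('n \<Rightarrow> int) \<times> int" where
  "site_shift q J c = (\<lambda>j. fst c j + J j * int q, snd c)"

lemma inj_site_shift: "inj (site_shift q J)"
  by (rule injI) (auto simp: site_shift_def prod_eq_iff fun_eq_iff)

lemma site_adj_shift:
  fixes c c' :: "('n::finite \<Rightarrow> int) \<times> int"
  shows "site_adj h q (site_shift q J c) (site_shift q J c') \<longleftrightarrow> site_adj h q c c'"
  by (simp add: site_adj_def site_shift_def)

text \<open>Blocks of \<open>q\<close> consecutive indices are disjoint: division by
  \<open>q\<close> recovers the block from a shifted site.\<close>

lemma site_shift_index: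
  assumes "c \<in> sites (int q) q" "c' \<in> sites (int q) q" "site_shift q J c = site_shift q J' c'"
  shows "J = J'"
proof
  fix j
  have c: "0 \<le> fst c j" "fst c j < int q" "0 \<le> fst c' j" "fst c' j < int q"
    using assms(1,2) by (auto simp: sites_def)
  have "fst c j + J j * int q = fst c' j + J' j * int q"
    using assms(3) by (simp add: site_shift_def fun_eq_iff)
  then have "(fst c j + J j * int q) div int q = (fst c' j + J' j * int q) div int q" by simp
  then show "J j = J' j" using c by simp
qed

section \<open>Superadditivity and positivity of the variance\<close>

context poisson_cliques_degree
begin

text \<open>A cell that the window does not cut off is a full box, so its measure depends on the
  radius level alone. This is the translation invariance behind the comparison of windows.\<close>

lemma measure_inner_cell:
  assumes h: "0 < h" and v: "\<And>j. 0 \<le> fst c j" "\<And>j. h * (real_of_int (fst c j) + 1) \<le> 2 * s"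
  shows "measure \<mu> (cell s h q c) = h ^ CARD('n) * measure \<nu> {r \<in> space \<nu>. \<lfloor>r * real q\<rfloor> = snd c}"
proof -
  let ?H = "{x :: real ^ 'n. \<forall>j. - s + h * real_of_int (fst c j) \<le> x $ j \<and> x $ j < - s + h * real_of_int (fst c j) + h}"
  let ?R = "{r \<in> space \<nu>. \<lfloor>r * real q\<rfloor> = snd c}"
  have H: "?H \<in> sets lborel" by measurable
  have R: "?R \<in> sets \<nu>" by measurable
  have "cell s h q c = ?H \<times> ?R"
  proof (intro set_eqI iffI)
    fix z assume z: "z \<in> cell s h q c"
    then have sz: "site s h q z = c" by (simp add: cell_def)
    have "fst z \<in> ?H"
    proof (intro CollectI allI)
      fix j
      show "- s + h * real_of_int (fst c j) \<le> fst z $ j \<and> fst z $ j < - s + h * real_of_int (fst c j) + h"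
        using site_coord[OF h, where s = s and q = q and z = z and j = j] unfolding sz by simp
    qed
    moreover have "snd z \<in> ?R" using z sz by (auto simp: cell_def site_def space_\<mu> space_\<nu>)
    ultimately show "z \<in> ?H \<times> ?R" by (simp add: mem_Times_iff)
  next
    fix z assume "z \<in> ?H \<times> ?R"
    then have zH: "- s + h * real_of_int (fst c j) \<le> fst z $ j" "fst z $ j < - s + h * real_of_int (fst c j) + h"
      and zR: "snd z \<in> space \<nu>" "\<lfloor>snd z * real q\<rfloor> = snd c" for j by (auto simp: mem_Times_iff)
    have "\<lfloor>(fst z $ j + s) / h\<rfloor> = fst c j" for j
    proof -
      have "real_of_int (fst c j) * h \<le> fst z $ j + s" "fst z $ j + s < (real_of_int (fst c j) + 1) * h"
        using zH[of j] by (simp_all add: algebra_simps)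
      then have "real_of_int (fst c j) \<le> (fst z $ j + s) / h" "(fst z $ j + s) / h < real_of_int (fst c j) + 1"
        by (simp_all only: pos_le_divide_eq[OF h] pos_divide_less_eq[OF h])
      then show ?thesis by (simp add: floor_eq_iff)
    qed
    then have "site s h q z = c" using zR by (simp add: site_def)
    moreover have "- s \<le> fst z $ j \<and> fst z $ j \<le> s" for j
    proof -
      have "0 \<le> h * real_of_int (fst c j)" using h v(1)[of j] by simp
      moreover have "h * real_of_int (fst c j) + h \<le> 2 * s" using v(2)[of j] by (simp add: distrib_left)
      ultimately show ?thesis using zH[of j] by linarith
    qed
    ultimately show "z \<in> cell s h q c" using zR by (auto simp: cell_def cube_def space_\<mu> space_\<nu> mem_Times_iff)
  qed
  then have "emeasure \<mu> (cell s h q c) = emeasure lborel ?H * emeasure \<nu> ?R"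
    using \<nu>.emeasure_pair_measure_Times[OF H R] by simp
  also have "emeasure lborel ?H = ennreal (h ^ CARD('n))"
    using emeasure_lborel_half_open_cube[of h "\<lambda>j. - s + h * real_of_int (fst c j)"] h by simp
  finally show ?thesis using h by (simp add: measure_def enn2real_mult)
qed

text \<open>Locations are rounded down, so the index \<open>q\<close> is reached only on the face
  where coordinate \<open>j\<close> equals \<open>s\<close>, a set of volume 0.\<close>

lemma siteprob_boundary:
  assumes s: "0 < s" and q: "q > 0" and j: "fst c j = int q"
  shows "siteprob s (2 * s / real q) q c = 0"
proof -
  let ?h = "2 * s / real q"
  have h: "0 < ?h" using s q by simp
  let ?B = "cbox (\<chi> i. if i = j then s else - s) (\<chi> i. s) :: (real ^ 'n) set"
  have "cell s ?h q c \<subseteq> ?B \<times> space \<nu>"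
  proof
    fix z assume z: "z \<in> cell s ?h q c"
    then have sz: "site s ?h q z = c" and cz: "\<And>i. - s \<le> fst z $ i \<and> fst z $ i \<le> s" by (auto simp: cell_def cube_def)
    have "?h * real_of_int (fst c j) \<le> fst z $ j + s"
      using site_coord(1)[OF h, where s = s and q = q and z = z and j = j] unfolding sz .
    then have "s \<le> fst z $ j" using q j by simp
    then have "fst z \<in> ?B" using cz by (simp add: mem_box_cart)
    then show "z \<in> ?B \<times> space \<nu>" using z by (auto simp: cell_def space_\<mu> space_\<nu> mem_Times_iff)
  qed
  then have "emeasure \<mu> (cell s ?h q c) \<le> emeasure \<mu> (?B \<times> space \<nu>)"
    by (rule emeasure_mono) (intro pair_measureI; simp)
  also have "\<dots> = emeasure lborel ?B * emeasure \<nu> (space \<nu>)"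
    by (rule \<nu>.emeasure_pair_measure_Times) auto
  also have "emeasure lborel ?B = 0"
  proof -
    have ne: "?B \<noteq> {}" using s by (auto simp: interval_ne_empty_cart)
    have "emeasure lborel ?B = ennreal (measure lborel ?B)"
      using emeasure_lborel_cbox_finite[of "(\<chi> i. if i = j then s else - s) :: real ^ 'n" "\<chi> i. s"]
      by (intro emeasure_eq_ennreal_measure) simp
    also have "measure lborel ?B = (\<Prod>i\<in>UNIV. ((\<chi> i. s) :: real ^ 'n) $ i - ((\<chi> i. if i = j then s else - s) :: real ^ 'n) $ i)"
      by (rule content_cbox_cart[OF ne])
    also have "\<dots> = 0" by (rule prod_zero) (auto intro: bexI[of _ j])
    finally show ?thesis by simp
  qed
  finally have "measure \<mu> (cell s ?h q c) = 0" by (simp add: measure_def)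
  then show ?thesis by (simp add: siteprob_def)
qed

text \<open>Disjoint translates of the smaller window contribute independent families of cliques;
  dropping the remaining covariances is harmless since they are nonnegative.\<close>

lemma grid_var_superadditive:
  assumes s: "0 < s" "0 < s0" and q: "q > 0" "2 * s0 \<le> real q" and k: "k > 0"
  shows "real (nat \<lfloor>s / s0\<rfloor>) ^ CARD('n) * grid_var k s0 (2 * s0) q \<le> grid_var k s (2 * s0) q"
proof -
  define L where "L = 2 * s0"
  define h where "h = L / real q"
  define N where "N = \<lfloor>s / s0\<rfloor>"
  define p where "p = siteprob s h q"
  define p0 where "p0 = siteprob s0 h q"
  define \<A> where "\<A> = site_cliques k h q (grid s L q)"
  define \<A>0 where "\<A>0 = site_cliques k h q (grid s0 L q)"
  define \<A>1 where "\<A>1 = site_cliques k h q (sites (int q) q :: (('n \<Rightarrow> int) \<times> int) set)"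
  define cov where "cov p A B = prod p (A \<union> B) - prod p A * prod p B" for p :: "('n \<Rightarrow> int) \<times> int \<Rightarrow> real" and A B
  have L: "0 < L" "L \<le> real q" using s q by (simp_all add: L_def)
  have h: "0 < h" using L q by (simp add: h_def)
  have hq: "h * real q = 2 * s0" using q by (simp add: h_def L_def)
  have N: "0 \<le> N" "real_of_int N * (2 * s0) \<le> 2 * s"
  proof -
    show "0 \<le> N" using s by (simp add: N_def)
    have "real_of_int N \<le> s / s0" unfolding N_def by linarith
    then have "real_of_int N * s0 \<le> s" using s by (simp add: pos_le_divide_eq)
    then show "real_of_int N * (2 * s0) \<le> 2 * s" by simp
  qed
  note ve = grid_var_eq[OF s(1) L(1) q(1) L(2) k, folded h_def, folded p_def \<A>_def]
  note ve0 = grid_var_eq[OF s(2) L(1) q(1) L(2) k, folded h_def, folded p0_def \<A>0_def]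
  \<comment> \<open>For \<open>L = 2 * s0\<close> the quotient \<open>2 * s0 / (L / q)\<close> is
    exactly \<open>q\<close>, and the index \<open>q\<close> belongs to the right faces.\<close>
  have grid0: "grid s0 L q = sites (int q + 1) q"
    using s q by (simp add: grid_def L_def)
  have sites_mono: "(sites (int q) q :: (('n \<Rightarrow> int) \<times> int) set) \<subseteq> sites (int q + 1) q"
  proof
    fix c :: "('n \<Rightarrow> int) \<times> int" assume c: "c \<in> sites (int q) q"
    then have a: "0 \<le> fst c j" and b: "fst c j < int q" for j by (simp_all add: sites_def)
    have "fst c j < int q + 1" for j using b[of j] by linarith
    with a c show "c \<in> sites (int q + 1) q" by (simp add: sites_def)
  qed
  have sub0: "A \<subseteq> sites (int q + 1) q" if "A \<in> \<A>0" for A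
    using that by (simp add: \<A>0_def site_cliques_def grid0)
  have sub1: "\<A>1 \<subseteq> \<A>0"
  proof
    fix A assume A: "A \<in> \<A>1"
    then have "A \<subseteq> sites (int q) q" by (simp add: \<A>1_def site_cliques_def)
    from order_trans[OF this sites_mono] A show "A \<in> \<A>0"
      by (simp add: \<A>1_def \<A>0_def grid0 site_cliques_def)
  qed
  have fin1: "finite \<A>1" by (rule finite_subset[OF sub1 ve0(4)])
  \<comment> \<open>Cliques with a site on a right face have probability 0. Discarding them leaves
    \<open>q\<close> indices per coordinate, so that the translated blocks do not overlap.\<close>
  have zero: "prod p0 A = 0" if A: "A \<in> \<A>0" "A \<notin> \<A>1" for A
  proof -
    have Ag: "A \<subseteq> sites (int q + 1) q" by (rule sub0[OF A(1)])
    have "\<not> A \<subseteq> sites (int q) q" using A unfolding \<A>0_def \<A>1_def site_cliques_def by simp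
    then obtain c where c: "c \<in> A" "c \<notin> sites (int q) q" by auto
    then have "c \<in> sites (int q + 1) q" using Ag by auto
    have "\<exists>j. fst c j = int q"
    proof (rule ccontr)
      assume "\<not> (\<exists>j. fst c j = int q)"
      then have ne: "fst c j \<noteq> int q" for j by simp
      have a: "0 \<le> fst c j" and b: "fst c j < int q + 1" for j
        using \<open>c \<in> sites (int q + 1) q\<close> by (simp_all add: sites_def)
      have "fst c j < int q" for j using b[of j] ne[of j] by linarith
      with a have "c \<in> sites (int q) q" using \<open>c \<in> sites (int q + 1) q\<close> by (simp add: sites_def)
      with c(2) show False by simp
    qed
    then obtain j where "fst c j = int q" by (elim exE)
    then have "p0 c = 0" unfolding p0_def h_def L_def by (rule siteprob_boundary[OF s(2) q(1)])
    moreover have "finite A" by (rule finite_subset[OF Ag finite_sites])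
    ultimately show ?thesis using c(1) by (auto intro: prod_zero)
  qed
  have zeroU: "prod p0 (A \<union> B) = 0" if "A \<in> \<A>0" "B \<in> \<A>0" "prod p0 A = 0 \<or> prod p0 B = 0" for A B
  proof -
    have "finite A" "finite B"
      by (rule finite_subset[OF sub0[OF that(1)] finite_sites], rule finite_subset[OF sub0[OF that(2)] finite_sites])
    then show ?thesis using that(3) by (auto simp: prod_zero_iff)
  qed
  have v0: "grid_var k s0 L q = (\<Sum>(A, B)\<in>\<A>1 \<times> \<A>1. cov p0 A B)"
  proof -
    have "grid_var k s0 L q = (\<Sum>(A, B)\<in>\<A>0 \<times> \<A>0. cov p0 A B)"
      unfolding ve0(1) cov_def by (rule sum.cartesian_product)
    also have "\<dots> = (\<Sum>(A, B)\<in>\<A>1 \<times> \<A>1. cov p0 A B)"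
    proof (rule sum.mono_neutral_right)
      show "\<forall>i\<in>\<A>0 \<times> \<A>0 - \<A>1 \<times> \<A>1. (case i of (A, B) \<Rightarrow> cov p0 A B) = 0"
      proof
        fix i assume i: "i \<in> \<A>0 \<times> \<A>0 - \<A>1 \<times> \<A>1"
        obtain A B where AB: "i = (A, B)" by (cases i)
        have "prod p0 A = 0 \<or> prod p0 B = 0" using i zero[of A] zero[of B] AB by blast
        then show "(case i of (A, B) \<Rightarrow> cov p0 A B) = 0"
          using zeroU[of A B] i AB by (auto simp: cov_def)
      qed
    qed (use ve0(4) sub1 in auto)
    finally show ?thesis .
  qed
  define \<J> where "\<J> = (PiE UNIV (\<lambda>_. {0..<N}) :: ('n \<Rightarrow> int) set)"
  have finJ: "finite \<J>" unfolding \<J>_def by (intro finite_PiE) auto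
  have J: "0 \<le> J j \<and> J j < N" if "J \<in> \<J>" for J j using that by (auto simp: \<J>_def PiE_iff)
  \<comment> \<open>Translated cells are not cut off by the larger window, since \<open>N\<close>
    sides of length \<open>2 * s0\<close> fit into \<open>2 * s\<close>.\<close>
  have inner: "h * (real_of_int (fst c j + J j * int q) + 1) \<le> 2 * s" if "J \<in> \<J>" "c \<in> sites (int q) q" for J c j
  proof -
    have "fst c j < int q" using that(2) by (simp add: sites_def)
    then have "fst c j + 1 \<le> int q" by linarith
    moreover have "J j * int q \<le> (N - 1) * int q" using J[OF that(1), of j] by (intro mult_right_mono) auto
    ultimately have "fst c j + J j * int q + 1 \<le> N * int q" by (simp add: left_diff_distrib)
    then have "real_of_int (fst c j + J j * int q + 1) \<le> real_of_int (N * int q)" by (simp only: of_int_le_iff)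
    then have "real_of_int (fst c j + J j * int q) + 1 \<le> real_of_int N * real q" by simp
    then have "h * (real_of_int (fst c j + J j * int q) + 1) \<le> h * (real_of_int N * real q)"
      using h by (intro mult_left_mono) auto
    also have "\<dots> = real_of_int N * (2 * s0)" unfolding hq[symmetric] by simp
    finally show ?thesis using N(2) by linarith
  qed
  have shift_p: "p (site_shift q J c) = p0 c" if "J \<in> \<J>" and c: "c \<in> sites (int q) q" for J c
  proof -
    have v': "fst c j < int q" for j using c by (simp add: sites_def)
    have v: "0 \<le> fst c j" "fst c j + 1 \<le> int q" for j using c v'[of j] by (simp add: sites_def, linarith)
    have "real_of_int (fst c j) + 1 \<le> real q" for j using v(2)[of j] by linarith
    then have "h * (real_of_int (fst c j) + 1) \<le> h * real q" for j using h by (intro mult_left_mono) auto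
    then have "measure \<mu> (cell s0 h q c) = h ^ CARD('n) * measure \<nu> {r \<in> space \<nu>. \<lfloor>r * real q\<rfloor> = snd c}"
      unfolding hq by (intro measure_inner_cell h v(1))
    moreover have "measure \<mu> (cell s h q (site_shift q J c)) = h ^ CARD('n) * measure \<nu> {r \<in> space \<nu>. \<lfloor>r * real q\<rfloor> = snd (site_shift q J c)}"
    proof (rule measure_inner_cell[OF h])
      show "0 \<le> fst (site_shift q J c) j" for j
        using v(1)[of j] J[OF that(1), of j] by (simp add: site_shift_def)
      show "h * (real_of_int (fst (site_shift q J c) j) + 1) \<le> 2 * s" for j
        using inner[OF that] by (simp add: site_shift_def)
    qed
    ultimately show ?thesis by (simp add: p_def p0_def siteprob_def site_shift_def)
  qed
  have shift_mem: "site_shift q J ` A \<in> \<A>" if JJ: "J \<in> \<J>" and A: "A \<in> \<A>1" for J A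
  proof -
    have As: "A \<subseteq> sites (int q) q" "card A = k" and adj: "\<forall>c\<in>A. \<forall>c'\<in>A. c \<noteq> c' \<longrightarrow> site_adj h q c c'"
      using A by (simp_all add: \<A>1_def site_cliques_def)
    have "site_shift q J c \<in> grid s L q" if c: "c \<in> A" for c
    proof -
      have cs: "c \<in> sites (int q) q" using As c by auto
      have "fst c j + J j * int q \<le> \<lfloor>2 * s / h\<rfloor>" for j
      proof -
        have "h * real_of_int (fst c j + J j * int q) \<le> 2 * s"
          using inner[OF JJ cs, of j] h by (simp only: distrib_left)
        then have "real_of_int (fst c j + J j * int q) \<le> 2 * s / h"
          by (simp only: pos_le_divide_eq[OF h] mult.commute)
        then show ?thesis by (simp only: le_floor_iff)
      qed
      then have "fst c j + J j * int q < \<lfloor>2 * s / h\<rfloor> + 1" for j by (meson zle_add1_eq_le)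
      moreover have "0 \<le> fst c j + J j * int q" for j
        using cs J[OF JJ, of j] by (auto simp: sites_def)
      ultimately show ?thesis
        using cs unfolding grid_def h_def[symmetric] by (auto simp: sites_def site_shift_def)
    qed
    moreover have "card (site_shift q J ` A) = k"
      using As(2) card_image[OF inj_on_subset[OF inj_site_shift subset_UNIV]] by metis
    moreover have "\<forall>c\<in>site_shift q J ` A. \<forall>c'\<in>site_shift q J ` A. c \<noteq> c' \<longrightarrow> site_adj h q c c'"
      using adj by (auto simp: site_adj_shift)
    ultimately show ?thesis by (auto simp: \<A>_def site_cliques_def)
  qed
  have shift_prod: "prod p (site_shift q J ` A) = prod p0 A" if "J \<in> \<J>" "A \<subseteq> sites (int q) q" for J A
  proof -
    have "prod p (site_shift q J ` A) = prod (p \<circ> site_shift q J) A"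
      by (rule prod.reindex[OF inj_on_subset[OF inj_site_shift subset_UNIV]])
    also have "\<dots> = prod p0 A"
    proof (rule prod.cong[OF refl])
      fix c assume "c \<in> A"
      then have "c \<in> sites (int q) q" using that(2) by (rule subsetD[rotated])
      from shift_p[OF that(1) this] show "(p \<circ> site_shift q J) c = p0 c" by (simp only: comp_def)
    qed
    finally show ?thesis .
  qed
  have sub_sites: "A \<subseteq> sites (int q) q" if "A \<in> \<A>1" for A using that by (simp add: \<A>1_def site_cliques_def)
  define \<Phi> where "\<Phi> x = (case x of (J, A, B) \<Rightarrow> (site_shift q J ` A, site_shift q J ` B))"
    for x :: "('n \<Rightarrow> int) \<times> (('n \<Rightarrow> int) \<times> int) set \<times> (('n \<Rightarrow> int) \<times> int) set"
  \<comment> \<open>As \<open>k > 0\<close>, the shifted set has a vertex, and any vertex determines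
    the shift; the sets are then recovered by injectivity of the shift.\<close>
  have inj: "inj_on \<Phi> (\<J> \<times> \<A>1 \<times> \<A>1)"
  proof (rule inj_onI)
    fix x y assume xy: "x \<in> \<J> \<times> \<A>1 \<times> \<A>1" "y \<in> \<J> \<times> \<A>1 \<times> \<A>1" "\<Phi> x = \<Phi> y"
    obtain J A B where x: "x = (J, A, B)" by (cases x)
    obtain J' A' B' where y: "y = (J', A', B')" by (cases y)
    have mem: "A \<in> \<A>1" "A' \<in> \<A>1" using xy x y by auto
    have eqs: "site_shift q J ` A = site_shift q J' ` A'" "site_shift q J ` B = site_shift q J' ` B'"
      using xy(3) by (simp_all add: x y \<Phi>_def)
    have "card A = k" using mem(1) by (simp add: \<A>1_def site_cliques_def)
    then have "A \<noteq> {}" using k by auto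
    then obtain c where c: "c \<in> A" by auto
    then obtain c' where c': "c' \<in> A'" "site_shift q J c = site_shift q J' c'" using eqs(1) by blast
    have "J = J'"
      by (rule site_shift_index[OF _ _ c'(2)]) (use c c' mem sub_sites in auto)
    moreover have "A = A'" using eqs(1) unfolding \<open>J = J'\<close> inj_image_eq_iff[OF inj_site_shift] .
    moreover have "B = B'" using eqs(2) unfolding \<open>J = J'\<close> inj_image_eq_iff[OF inj_site_shift] .
    ultimately show "x = y" by (simp add: x y)
  qed
  have "real (card \<J>) * grid_var k s0 L q = (\<Sum>J\<in>\<J>. \<Sum>(A, B)\<in>\<A>1 \<times> \<A>1. cov p0 A B)"
    unfolding v0 by simp
  also have "\<dots> = (\<Sum>x\<in>\<J> \<times> \<A>1 \<times> \<A>1. case x of (J, A, B) \<Rightarrow> cov p0 A B)"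
    by (subst sum.cartesian_product) (simp add: case_prod_unfold)
  also have "\<dots> = (\<Sum>x\<in>\<J> \<times> \<A>1 \<times> \<A>1. (case \<Phi> x of (A, B) \<Rightarrow> cov p A B))"
  proof (rule sum.cong[OF refl])
    fix x assume x: "x \<in> \<J> \<times> \<A>1 \<times> \<A>1"
    obtain J A B where xe: "x = (J, A, B)" by (cases x)
    have mem: "J \<in> \<J>" "A \<subseteq> sites (int q) q" "B \<subseteq> sites (int q) q" using x xe sub_sites by auto
    have "prod p (site_shift q J ` A \<union> site_shift q J ` B) = prod p0 (A \<union> B)"
      using shift_prod[OF mem(1), of "A \<union> B"] mem(2,3) by (simp add: image_Un)
    then show "(case x of (J, A, B) \<Rightarrow> cov p0 A B) = (case \<Phi> x of (A, B) \<Rightarrow> cov p A B)"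
      using shift_prod[OF mem(1,2)] shift_prod[OF mem(1,3)] by (simp add: xe \<Phi>_def cov_def)
  qed
  also have "\<dots> = (\<Sum>(A, B)\<in>\<Phi> ` (\<J> \<times> \<A>1 \<times> \<A>1). cov p A B)"
    by (subst sum.reindex[OF inj]) (simp add: comp_def)
  also have "\<dots> \<le> (\<Sum>(A, B)\<in>\<A> \<times> \<A>. cov p A B)"
  proof (rule sum_mono2)
    show "finite (\<A> \<times> \<A>)" using ve(4) by simp
    show "\<Phi> ` (\<J> \<times> \<A>1 \<times> \<A>1) \<subseteq> \<A> \<times> \<A>" using shift_mem by (auto simp: \<Phi>_def)
    show "0 \<le> (case b of (A, B) \<Rightarrow> cov p A B)" if "b \<in> \<A> \<times> \<A> - \<Phi> ` (\<J> \<times> \<A>1 \<times> \<A>1)" for b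
      using ve(3)[of "fst b" "snd b"] that by (auto simp: cov_def)
  qed
  also have "\<dots> = grid_var k s L q"
    unfolding ve(1) cov_def by (rule sum.cartesian_product[symmetric])
  also have "real (card \<J>) = real (nat N) ^ CARD('n)"
    unfolding \<J>_def by (subst card_PiE) (simp_all)
  finally show ?thesis by (simp add: N_def L_def)
qed

text \<open>Both variances are approximated with \<open>L\<close> equal to the side length of the
  smaller window, which is allowed because the limit does not depend on \<open>L\<close>.\<close>

lemma var_superadditive:
  assumes t: "0 < t" "0 < t0" and k: "k > 0"
  shows "real (nat \<lfloor>t powr (1 / real CARD('n)) / t0 powr (1 / real CARD('n))\<rfloor>) ^ CARD('n) * var M (cliques k t0)
    \<le> var M (cliques k t)"
proof (rule tendsto_le[OF sequentially_bot])
  let ?s = "t powr (1 / real CARD('n))" and ?b = "t0 powr (1 / real CARD('n))"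
  have s: "0 < ?s" "0 < ?b" using t by auto
  show "(\<lambda>q. grid_var k ?s (2 * ?b) q) \<longlonglongrightarrow> var M (cliques k t)"
    using t s by (intro grid_var_tendsto) auto
  show "(\<lambda>q. real (nat \<lfloor>?s / ?b\<rfloor>) ^ CARD('n) * grid_var k ?b (2 * ?b) q) \<longlonglongrightarrow>
      real (nat \<lfloor>?s / ?b\<rfloor>) ^ CARD('n) * var M (cliques k t0)"
    using t s by (intro tendsto_mult tendsto_const grid_var_tendsto) auto
  show "\<forall>\<^sub>F q in sequentially. real (nat \<lfloor>?s / ?b\<rfloor>) ^ CARD('n) * grid_var k ?b (2 * ?b) q \<le> grid_var k ?s (2 * ?b) q"
    using eventually_fine[of "2 * ?b"]
  proof eventually_elim
    case (elim q)
    then show ?case using s k by (intro grid_var_superadditive) auto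
  qed
qed

text \<open>With positive probability each of \<open>k\<close> disjoint cubes inside a small window contains a
  point of radius larger than the diameter of the window; such points form a clique.\<close>

lemma var_pos:
  assumes mass: "emeasure \<nu> {0<..} > 0" and k: "k > 0"
  obtains t where "t > 0" "var M (cliques k t) > 0"
proof -
  have nu_sets: "{r<..} \<in> sets \<nu>" if "0 \<le> r" for r :: real
    unfolding sets_\<nu> sets_restrict_space using that by (auto simp: image_iff intro!: bexI[of _ "{r<..}"])
  \<comment> \<open>A lower bound for the radii that is exceeded with positive probability:
    otherwise \<open>{0<..}\<close> would be a countable union of null sets.\<close>
  have "\<exists>n. emeasure \<nu> {1 / real (Suc n)<..} \<noteq> 0"
  proof (rule ccontr)
    assume "\<not> (\<exists>n. emeasure \<nu> {1 / real (Suc n)<..} \<noteq> 0)"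
    then have "{1 / real (Suc n)<..} \<in> null_sets \<nu>" for n
      using nu_sets[of "1 / real (Suc n)"] by (intro null_setsI) simp_all
    then have "(\<Union>n. {1 / real (Suc n)<..}) \<in> null_sets \<nu>" by (intro null_sets_UN)
    also have "(\<Union>n. {1 / real (Suc n)<..}) = {0<..}"
    proof (intro set_eqI iffI)
      fix x :: real assume "x \<in> {0<..}"
      then obtain n where "inverse (real (Suc n)) < x" using reals_Archimedean[of x] by auto
      then show "x \<in> (\<Union>n. {1 / real (Suc n)<..})" by (auto simp: inverse_eq_divide)
    next
      fix x :: real assume "x \<in> (\<Union>n. {1 / real (Suc n)<..})"
      then obtain n where "1 / real (Suc n) < x" by auto
      moreover have "0 < 1 / real (Suc n)" by simp
      ultimately show "x \<in> {0<..}" by (simp only: greaterThan_iff)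
    qed
    finally show False using mass by auto
  qed
  then obtain n where n: "emeasure \<nu> {1 / real (Suc n)<..} \<noteq> 0" by (elim exE)
  define \<rho> where "\<rho> = 1 / real (Suc n)"
  have \<rho>: "\<rho> > 0" "emeasure \<nu> {\<rho><..} \<noteq> 0" using n by (simp_all add: \<rho>_def)
  \<comment> \<open>With this half side the diameter of the window in the sum norm,
    \<open>CARD('n) * (2 * s)\<close>, equals \<open>\<rho>\<close>.\<close>
  define s where "s = \<rho> / (2 * real CARD('n))"
  define t where "t = s ^ CARD('n)"
  have s: "0 < s" using \<rho> by (simp add: s_def)
  have t: "0 < t" using s by (simp add: t_def)
  have st: "t powr (1 / real CARD('n)) = s"
    unfolding t_def using s by (simp add: powr_realpow[symmetric] powr_powr)
  \<comment> \<open>The side of \<open>k\<close> disjoint cubes lined up along the main diagonal of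
    the window.\<close>
  define \<delta> where "\<delta> = 2 * s / real k"
  have \<delta>: "0 < \<delta>" "real k * \<delta> = 2 * s" using s k by (simp_all add: \<delta>_def)
  define H where "H i = {x :: real ^ 'n. \<forall>j. - s + real i * \<delta> \<le> x $ j \<and> x $ j < - s + real i * \<delta> + \<delta>}" for i
  define C where "C i = H i \<times> {\<rho><..}" for i
  have H_sets: "H i \<in> sets lborel" for i unfolding H_def by measurable
  have R_sets: "{\<rho><..} \<in> sets \<nu>" using nu_sets \<rho>(1) by simp
  have C_sets: "C i \<in> sets \<mu>" for i unfolding C_def by (rule pair_measureI[OF H_sets R_sets])
  have Cem: "emeasure \<mu> (C i) = ennreal (\<delta> ^ CARD('n)) * emeasure \<nu> {\<rho><..}" for i
  proof -
    have "emeasure lborel (H i) = ennreal (\<delta> ^ CARD('n))"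
      unfolding H_def using \<delta> by (intro emeasure_lborel_half_open_cube) simp
    then show ?thesis unfolding C_def \<nu>.emeasure_pair_measure_Times[OF H_sets R_sets] by simp
  qed
  have C_fin: "emeasure \<mu> (C i) < \<infinity>" for i
    unfolding Cem unfolding \<nu>.emeasure_eq_measure by (simp add: ennreal_mult_less_top)
  have C_pos: "0 < measure \<mu> (C i)" for i
  proof -
    have "emeasure \<mu> (C i) \<noteq> 0" unfolding Cem using \<delta> \<rho>(2) by simp
    then show ?thesis using C_fin[of i] by (simp add: measure_def enn2real_positive_iff zero_less_iff_neq_zero)
  qed
  have idx: "i = i'" if "x \<in> H i" "x \<in> H i'" for i i' x
  proof (rule ccontr)
    fix j :: 'n
    assume ne: "i \<noteq> i'"
    have 1: "- s + real i * \<delta> \<le> x $ j" "x $ j < - s + real i * \<delta> + \<delta>"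
      "- s + real i' * \<delta> \<le> x $ j" "x $ j < - s + real i' * \<delta> + \<delta>"
      using that by (simp_all add: H_def)
    have "real i * \<delta> < (real i' + 1) * \<delta>" "real i' * \<delta> < (real i + 1) * \<delta>"
      using 1 by (simp_all add: distrib_right)
    then have "real i < real i' + 1" "real i' < real i + 1" using \<delta>(1) by simp_all
    then show False using ne by linarith
  qed
  have disj: "disjoint_family_on C {..<k}"
    unfolding disjoint_family_on_def C_def using idx by auto
  define p where "p i = 1 - exp (- measure \<mu> (C i))" for i
  define full where "full \<omega> = {i \<in> {..<k}. emeasure (\<eta> \<omega>) (C i) \<noteq> 0}" for \<omega>
  have "(\<integral>\<omega>. of_bool (full \<omega> = {..<k}) \<partial>M) = bern_exp p {..<k} (\<lambda>S. of_bool (S = {..<k}))"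
    unfolding full_def
    by (rule occupied_cells(2)[OF finite_lessThan C_sets C_fin disj p_def, where g = "\<lambda>S. of_bool (S = {..<k})"])
  also have "\<dots> = (\<Sum>S\<in>Pow {..<k}. if S = {..<k} then bern_weight p {..<k} {..<k} else 0)"
    unfolding bern_exp_def by (rule sum.cong) auto
  also have "\<dots> = prod p {..<k}" by (simp add: bern_weight_def)
  also have "\<dots> > 0" using C_pos by (intro prod_pos) (simp add: p_def)
  finally have full_pos: "(\<integral>\<omega>. of_bool (full \<omega> = {..<k}) \<partial>M) > (0 :: real)" .
  have H_cube: "H i \<subseteq> cube s" if "i < k" for i
  proof
    fix x assume x: "x \<in> H i"
    have "0 \<le> real i * \<delta>" using \<delta> by simp
    moreover have "real i * \<delta> + \<delta> \<le> 2 * s"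
    proof -
      have "(real i + 1) * \<delta> \<le> real k * \<delta>" using that \<delta>(1) by (intro mult_right_mono) auto
      then show ?thesis using \<delta>(2) by (simp add: distrib_right)
    qed
    moreover have "- s + real i * \<delta> \<le> x $ j \<and> x $ j < - s + real i * \<delta> + \<delta>" for j using x by (simp add: H_def)
    ultimately have "- s \<le> x $ j \<and> x $ j \<le> s" for j by (smt (verit))
    then show "x \<in> cube s" by (simp add: cube_def)
  qed
  have diam: "norm (x - y) \<le> \<rho>" if "x \<in> cube s" "y \<in> cube s" for x y :: "real ^ 'n"
  proof -
    have "norm (x - y) \<le> (\<Sum>j\<in>UNIV. \<bar>(x - y) $ j\<bar>)" by (rule norm_le_l1_cart)
    also have "\<dots> \<le> (\<Sum>j\<in>(UNIV :: 'n set). 2 * s)"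
    proof (rule sum_mono)
      fix j
      have "- s \<le> x $ j" "x $ j \<le> s" "- s \<le> y $ j" "y $ j \<le> s" using that by (simp_all add: cube_def)
      then show "\<bar>(x - y) $ j\<bar> \<le> 2 * s" by simp
    qed
    also have "\<dots> = \<rho>" by (simp add: s_def)
    finally show ?thesis .
  qed
  have win: "window t = (cube s :: (real ^ 'n) set)" by (simp add: window_cube st)
  have num: "AE \<omega> in M. num_cliques k t (\<eta> \<omega>) = card (clique_sets k (points (\<eta> \<omega>) \<inter> strip s)) \<and>
      finite (points (\<eta> \<omega>) \<inter> strip s)"
    using AE_finite_strip[OF less_imp_le[OF s]] AE_distinct_locations[OF s] AE_space
  proof eventually_elim
    case (elim \<omega>)
    have fP: "finite (points (\<eta> \<omega>) \<inter> strip s)"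
      by (rule points_card(1)[OF _ elim(3) strip_sets]) (use elim singleton_sets in auto)
    have w: "points (\<eta> \<omega>) \<inter> (window t \<times> UNIV) = points (\<eta> \<omega>) \<inter> strip s"
      unfolding win by (rule points_strip[OF elim(3)])
    have "num_cliques k t (\<eta> \<omega>) = card (clique_sets k (points (\<eta> \<omega>) \<inter> (window t \<times> UNIV)))"
    proof (rule num_cliques_eq_card)
      show "finite (points (\<eta> \<omega>) \<inter> (window t \<times> UNIV))" "inj_on fst (points (\<eta> \<omega>) \<inter> (window t \<times> UNIV))"
        unfolding w by fact+
      show "0 \<le> snd z" if "z \<in> points (\<eta> \<omega>) \<inter> (window t \<times> UNIV)" for z
        using that unfolding w by (auto simp: strip_def)
    qed
    then show ?case using fP unfolding w by simp
  qed
  have X_pos: "AE \<omega> in M. full \<omega> = {..<k} \<longrightarrow> 1 \<le> cliques k t \<omega>"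
    using num AE_space
  proof eventually_elim
    case (elim \<omega>)
    show ?case
    proof
      assume f: "full \<omega> = {..<k}"
      have "\<exists>z. z \<in> points (\<eta> \<omega>) \<inter> C i" if "i < k" for i
      proof -
        have "i \<in> full \<omega>" using f that by simp
        then have "emeasure (\<eta> \<omega>) (C i) \<noteq> 0" by (simp add: full_def)
        moreover have "emeasure (\<eta> \<omega>) (C i) = 0 \<longleftrightarrow> points (\<eta> \<omega>) \<inter> C i = {}"
          by (rule points_empty_iff[OF _ elim(2) C_sets]) (rule singleton_sets)
        ultimately show ?thesis by auto
      qed
      then obtain z where z: "\<And>i. i < k \<Longrightarrow> z i \<in> points (\<eta> \<omega>) \<inter> C i" by metis
      have zH: "fst (z i) \<in> H i" "\<rho> < snd (z i)" if "i < k" for i using z[OF that] by (auto simp: C_def)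
      have "inj_on z {..<k}"
      proof (rule inj_onI)
        fix i i' assume "i \<in> {..<k}" "i' \<in> {..<k}" "z i = z i'"
        then show "i = i'" using idx[of "fst (z i)" i i'] zH(1)[of i] zH(1)[of i'] by simp
      qed
      then have "card (z ` {..<k}) = k" by (simp add: card_image)
      moreover have "z ` {..<k} \<subseteq> points (\<eta> \<omega>) \<inter> strip s"
      proof
        fix y assume "y \<in> z ` {..<k}"
        then obtain i where i: "i < k" "y = z i" by auto
        then have "fst y \<in> cube s" "0 \<le> snd y" "y \<in> points (\<eta> \<omega>)"
          using zH[OF i(1)] H_cube[OF i(1)] z[OF i(1)] \<rho>(1) by auto
        then show "y \<in> points (\<eta> \<omega>) \<inter> strip s" by (simp add: strip_def mem_Times_iff)
      qed
      moreover have "norm (fst y - fst y') \<le> min (snd y) (snd y')" if "y \<in> z ` {..<k}" "y' \<in> z ` {..<k}" for y y'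
      proof -
        obtain i i' where i: "i < k" "y = z i" "i' < k" "y' = z i'" using \<open>y \<in> z ` {..<k}\<close> \<open>y' \<in> z ` {..<k}\<close> by auto
        have "norm (fst y - fst y') \<le> \<rho>"
          using zH(1)[OF i(1)] zH(1)[OF i(3)] H_cube[OF i(1)] H_cube[OF i(3)] unfolding i by (intro diam) auto
        then show ?thesis using zH(2)[OF i(1)] zH(2)[OF i(3)] unfolding i by simp
      qed
      ultimately have "z ` {..<k} \<in> clique_sets k (points (\<eta> \<omega>) \<inter> strip s)"
        unfolding clique_sets_def by simp
      moreover have "finite (clique_sets k (points (\<eta> \<omega>) \<inter> strip s))"
      proof (rule finite_subset)
        show "clique_sets k (points (\<eta> \<omega>) \<inter> strip s) \<subseteq> Pow (points (\<eta> \<omega>) \<inter> strip s)"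
          by (auto simp: clique_sets_def)
        show "finite (Pow (points (\<eta> \<omega>) \<inter> strip s))"
          by (rule finite_Pow_iff[THEN iffD2, OF conjunct2[OF elim(1)]])
      qed
      ultimately have "card (clique_sets k (points (\<eta> \<omega>) \<inter> strip s)) \<noteq> 0" by auto
      then show "1 \<le> cliques k t \<omega>" using elim(1) by simp
    qed
  qed
  \<comment> \<open>A vanishing variance would make the count almost surely constant. The constant
    is 0 because the window is empty with positive probability, while the count is at least 1 with
    positive probability.\<close>
  have "var M (cliques k t) \<noteq> 0"
  proof
    assume v0: "var M (cliques k t) = 0"
    let ?e = "expct M (cliques k t)"
    note mom = cliques_moments(1,2)[OF t zero_less_one, of k]
    have sq: "integrable M (\<lambda>\<omega>. (cliques k t \<omega> - ?e)\<^sup>2)"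
      using mom by (simp add: power2_diff)
    have "AE \<omega> in M. (cliques k t \<omega> - ?e)\<^sup>2 = 0"
      using integral_nonneg_eq_0_iff_AE[OF sq] v0 by (simp add: var_def expct_def)
    then have const: "AE \<omega> in M. cliques k t \<omega> = ?e" by eventually_elim simp
    have X0: "AE \<omega> in M. emeasure (\<eta> \<omega>) (strip s) = 0 \<longrightarrow> cliques k t \<omega> = 0"
      using num AE_space
    proof eventually_elim
      case (elim \<omega>)
      have "points (\<eta> \<omega>) \<inter> strip s = {}" if "emeasure (\<eta> \<omega>) (strip s) = 0"
        using that points_empty_iff[OF singleton_sets elim(2) strip_sets] by simp
      moreover have "clique_sets k ({} :: ((real ^ 'n) \<times> real) set) = {}"
        using k by (auto simp: clique_sets_def)
      ultimately show ?case using elim(1) by simp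
    qed
    have e0: "?e = 0"
    proof (rule ccontr)
      assume ne: "?e \<noteq> 0"
      have "AE \<omega> in M. \<omega> \<notin> {\<omega> \<in> space M. emeasure (\<eta> \<omega>) (strip s) = 0}"
        using const X0 by eventually_elim (use ne in auto)
      moreover have [measurable]: "(\<lambda>\<omega>. emeasure (\<eta> \<omega>) (strip s)) \<in> borel_measurable M"
        by (rule count_measurable[OF strip_sets])
      have "{\<omega> \<in> space M. emeasure (\<eta> \<omega>) (strip s) = 0} \<in> events" by measurable
      ultimately have "prob {\<omega> \<in> space M. emeasure (\<eta> \<omega>) (strip s) = 0} = 0"
        by (simp add: prob_eq_0)
      then show False
        using prob_count_0[OF strip_sets emeasure_strip_finite[OF less_imp_le[OF s]]] by simp
    qed
    have "AE \<omega> in M. (of_bool (full \<omega> = {..<k}) :: real) = 0"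
      using const X_pos by eventually_elim (use e0 in auto)
    then have "(\<integral>\<omega>. (of_bool (full \<omega> = {..<k}) :: real) \<partial>M) = 0"
      by (rule integral_eq_zero_AE)
    with full_pos show False by simp
  qed
  moreover have "0 \<le> var M (cliques k t)"
    unfolding var_def expct_def by (rule Bochner_Integration.integral_nonneg) simp
  ultimately show ?thesis using t by (intro that[of t]) simp_all
qed

end

section \<open>The degree bound from the moment condition\<close>

context poisson_cliques
begin

text \<open>The mass \<open>r ^ d\<close> of a ball is dominated by the contribution of \<open>[r / 2, r]\<close> to
  \<open>\<integral> s ^ (4 d - 1 + \<epsilon>) ds\<close>, so that Tonelli's theorem applies.\<close>

lemma degree_finite:
  assumes \<epsilon>: "\<epsilon> > 0"
    and mom: "(\<integral>\<^sup>+ r\<in>{0..}. ennreal (measure \<nu> {r<..} * r powr (4 * real CARD('n) - 1 + \<epsilon>)) \<partial>lborel) < \<infinity>"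
    and \<kappa>: "2 \<le> \<kappa>"
  shows "(\<integral>\<^sup>+ r. ennreal ((2 * (r + \<kappa>)) ^ CARD('n)) \<partial>\<nu>) < \<infinity>"
proof -
  interpret swap: pair_sigma_finite \<nu> lborel ..
  let ?d = "CARD('n)"
  define b where "b = 4 * real ?d - 1 + \<epsilon>"
  define w :: "real \<Rightarrow> real \<Rightarrow> ennreal" where "w r u = (if 0 \<le> u \<and> u < r then ennreal (u powr b) else 0)" for r u
  have d1: "1 \<le> real ?d" by (simp add: Suc_leI)
  have b0: "0 \<le> b" "real ?d - 1 \<le> b" unfolding b_def using d1 \<epsilon> by linarith+
  \<comment> \<open>Radii up to \<open>\<kappa>\<close> are absorbed by the first term. For
    \<open>r > \<kappa>\<close> one has \<open>2 * (r + \<kappa>) <= 8 * (r / 2)\<close>, and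
    \<open>r / 2 >= 1\<close> because of \<open>2 <= \<kappa>\<close>, which permits raising the
    exponent from \<open>d - 1\<close> to \<open>b\<close>.\<close>
  have pointwise: "ennreal ((2 * (r + \<kappa>)) ^ ?d) \<le> ennreal ((4 * \<kappa>) ^ ?d) + ennreal (8 ^ ?d) * (\<integral>\<^sup>+ u. w r u \<partial>lborel)"
    if r: "0 \<le> r" for r
  proof (cases "r \<le> \<kappa>")
    case True
    then have "(2 * (r + \<kappa>)) ^ ?d \<le> (4 * \<kappa>) ^ ?d" using r \<kappa> by (intro power_mono) auto
    then have "ennreal ((2 * (r + \<kappa>)) ^ ?d) \<le> ennreal ((4 * \<kappa>) ^ ?d)" by (rule ennreal_leI)
    then show ?thesis by (rule order_trans) simp
  next
    case False
    then have r2: "2 \<le> r" using \<kappa> by linarith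
    have "ennreal ((r / 2) ^ ?d) = ennreal ((r / 2) powr (real ?d - 1) * (r / 2))"
    proof -
      have "(r / 2) ^ ?d = (r / 2) powr (real ?d - 1 + 1)" using r2 by (simp add: powr_realpow)
      also have "\<dots> = (r / 2) powr (real ?d - 1) * (r / 2)" using r2 by (subst powr_add) simp
      finally show ?thesis by (rule arg_cong)
    qed
    also have "\<dots> = ennreal ((r / 2) powr (real ?d - 1)) * ennreal (r / 2)"
      using r2 by (intro ennreal_mult) auto
    also have "\<dots> = (\<integral>\<^sup>+ u. ennreal ((r / 2) powr (real ?d - 1)) * indicator {r / 2..<r} u \<partial>lborel)"
      using r2 by (simp add: nn_integral_cmult_indicator)
    also have "\<dots> \<le> (\<integral>\<^sup>+ u. w r u \<partial>lborel)"
    proof (rule nn_integral_mono)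
      fix u
      show "ennreal ((r / 2) powr (real ?d - 1)) * indicator {r / 2..<r} u \<le> w r u"
      proof (cases "u \<in> {r / 2..<r}")
        case True
        then have u: "r / 2 \<le> u" "u < r" by auto
        have "(r / 2) powr (real ?d - 1) \<le> (r / 2) powr b"
          using r2 b0 by (intro powr_mono) auto
        also have "\<dots> \<le> u powr b"
          using r2 u b0 by (intro powr_mono2) auto
        finally have "ennreal ((r / 2) powr (real ?d - 1)) \<le> ennreal (u powr b)" by (rule ennreal_leI)
        then show ?thesis using True u r2 by (simp add: w_def)
      qed simp
    qed
    finally have half: "ennreal ((r / 2) ^ ?d) \<le> (\<integral>\<^sup>+ u. w r u \<partial>lborel)" .
    have "(2 * (r + \<kappa>)) ^ ?d \<le> (8 * (r / 2)) ^ ?d" using False r \<kappa> by (intro power_mono) auto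
    then have "ennreal ((2 * (r + \<kappa>)) ^ ?d) \<le> ennreal (8 ^ ?d * (r / 2) ^ ?d)"
      unfolding power_mult_distrib by (rule ennreal_leI)
    also have "\<dots> = ennreal (8 ^ ?d) * ennreal ((r / 2) ^ ?d)" using r by (intro ennreal_mult) auto
    also have "\<dots> \<le> ennreal (8 ^ ?d) * (\<integral>\<^sup>+ u. w r u \<partial>lborel)" by (rule mult_left_mono[OF half]) simp
    finally show ?thesis by (rule order_trans) simp
  qed
  have w_meas: "case_prod w \<in> borel_measurable (\<nu> \<Otimes>\<^sub>M lborel)"
  proof -
    have [measurable]: "fst \<in> borel_measurable (\<nu> \<Otimes>\<^sub>M (lborel :: real measure))"
      using measurable_compose[OF measurable_fst measurable_\<nu>] by simp
    have [measurable]: "snd \<in> borel_measurable (\<nu> \<Otimes>\<^sub>M (lborel :: real measure))"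
      using measurable_snd[of \<nu> "lborel :: real measure"] by simp
    show ?thesis unfolding w_def case_prod_unfold by measurable
  qed
  have "(\<integral>\<^sup>+ r. (\<integral>\<^sup>+ u. w r u \<partial>lborel) \<partial>\<nu>) = (\<integral>\<^sup>+ u. (\<integral>\<^sup>+ r. w r u \<partial>\<nu>) \<partial>lborel)"
    by (rule swap.Fubini'[OF w_meas, symmetric])
  also have "\<dots> = (\<integral>\<^sup>+ u\<in>{0..}. ennreal (measure \<nu> {u<..} * u powr b) \<partial>lborel)"
  proof (rule nn_integral_cong)
    fix u :: real
    show "(\<integral>\<^sup>+ r. w r u \<partial>\<nu>) = ennreal (measure \<nu> {u<..} * u powr b) * indicator {0..} u"
    proof (cases "0 \<le> u")
      case True
      have U: "{u<..} \<in> sets \<nu>"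
        unfolding sets_\<nu> sets_restrict_space using True by (auto simp: image_iff intro!: bexI[of _ "{u<..}"])
      have "(\<integral>\<^sup>+ r. w r u \<partial>\<nu>) = (\<integral>\<^sup>+ r. ennreal (u powr b) * indicator {u<..} r \<partial>\<nu>)"
        using True by (intro nn_integral_cong) (auto simp: w_def indicator_def)
      also have "\<dots> = ennreal (u powr b) * emeasure \<nu> {u<..}" by (rule nn_integral_cmult_indicator[OF U])
      also have "\<dots> = ennreal (measure \<nu> {u<..} * u powr b)"
        unfolding \<nu>.emeasure_eq_measure by (subst ennreal_mult[symmetric]) (auto simp: mult.commute)
      finally show ?thesis using True by simp
    next
      case False
      then have "w r u = 0" for r by (simp add: w_def)
      with False show ?thesis by simp
    qed
  qed
  also have "\<dots> < \<infinity>" using mom unfolding b_def .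
  finally have fin: "(\<integral>\<^sup>+ r. (\<integral>\<^sup>+ u. w r u \<partial>lborel) \<partial>\<nu>) < \<infinity>" .
  have wm: "(\<lambda>r. \<integral>\<^sup>+ u. w r u \<partial>lborel) \<in> borel_measurable \<nu>"
    by (rule lborel.borel_measurable_nn_integral[OF w_meas])
  have "(\<integral>\<^sup>+ r. ennreal ((2 * (r + \<kappa>)) ^ ?d) \<partial>\<nu>) \<le> (\<integral>\<^sup>+ r. ennreal ((4 * \<kappa>) ^ ?d) + ennreal (8 ^ ?d) * (\<integral>\<^sup>+ u. w r u \<partial>lborel) \<partial>\<nu>)"
    by (rule nn_integral_mono) (use pointwise in \<open>simp add: space_\<nu>\<close>)
  also have "\<dots> = ennreal ((4 * \<kappa>) ^ ?d) + ennreal (8 ^ ?d) * (\<integral>\<^sup>+ r. (\<integral>\<^sup>+ u. w r u \<partial>lborel) \<partial>\<nu>)"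
    using wm by (subst nn_integral_add) (auto simp: nn_integral_cmult \<nu>.emeasure_space_1)
  also have "\<dots> < \<infinity>" using fin by (simp add: ennreal_mult_less_top)
  finally show ?thesis .
qed

end

theorem theorem8p4:
  fixes \<nu> :: "real measure" and M :: "'w measure"
    and \<eta> :: "'w \<Rightarrow> ((real ^ 'n) \<times> real) measure" and \<epsilon> :: real
  assumes "prob_space \<nu>" and "sets \<nu> = sets (restrict_space borel {0..})"
    and "emeasure \<nu> {0<..} > 0"
    and "poisson_process M (lborel \<Otimes>\<^sub>M \<nu>) \<eta>"
    and "\<epsilon> > 0"
    and "(\<integral>\<^sup>+ r\<in>{0..}. ennreal (measure \<nu> {r<..} * r powr (4 * real CARD('n) - 1 + \<epsilon>)) \<partial>lborel) < \<infinity>"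
  shows "\<forall>k\<ge>2. \<exists>c>0. \<exists>C>0.
           (\<lambda>t. var M (\<lambda>\<omega>. real (num_cliques k t (\<eta> \<omega>)))) \<sim>[at_top] (\<lambda>t::real. c * t) \<and>
           (\<forall>\<^sub>F t in at_top.
              wasserstein
                (distr M borel (standardize M (\<lambda>\<omega>. real (num_cliques k t (\<eta> \<omega>)))))
                std_normal_distribution
              \<le> ennreal (C * t powr (- 1 / 2)))"
proof (intro allI impI)
  fix k :: nat assume "2 \<le> k"
  then have k: "k > 0" by simp
  interpret poisson_cliques M \<nu> \<eta>
    by (intro poisson_cliques.intro poisson_cliques_axioms.intro assms)
  have "(\<integral>\<^sup>+ r. ennreal ((2 * (r + (1 + 2 * real CARD('n)))) ^ CARD('n)) \<partial>\<nu>) < \<infinity>"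
  proof (rule degree_finite[OF assms(5,6)])
    have "1 \<le> real CARD('n)" by (simp add: Suc_leI)
    then show "2 \<le> 1 + 2 * real CARD('n)" by linarith
  qed
  then obtain m where m: "0 \<le> m" "(\<integral>\<^sup>+ r. ennreal ((2 * (r + (1 + 2 * real CARD('n)))) ^ CARD('n)) \<partial>\<nu>) = ennreal m"
    by (auto simp: less_top_ennreal)
  interpret poisson_cliques_degree M \<nu> \<eta> m
    by unfold_locales (use m in simp_all)
  let ?V = "\<lambda>t. var M (cliques k t)"
  obtain t1 where t1: "t1 > 0" "?V t1 > 0" by (rule var_pos[OF assms(3) k])
  have V_nonneg: "0 \<le> ?V t" for t
    unfolding var_def expct_def by (rule Bochner_Integration.integral_nonneg) simp
  have V_le: "?V t \<le> (chain_const2 k m * 2 ^ CARD('n)) * t" if "0 < t" for t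
    using var_le[OF that k] by (simp add: mult.assoc)
  obtain c where c: "c > 0" "((\<lambda>t. ?V t / t) \<longlongrightarrow> c) at_top"
    by (rule superadditive_limit[where V = ?V and d = "CARD('n)" and ?t1.0 = t1, OF _ V_le V_nonneg var_superadditive])
      (use k t1 in auto)
  \<comment> \<open>Eventually the variance exceeds \<open>c / 2 * t\<close>, so
    \<open>b * sqrt t\<close> is a lower bound for the standard deviation.\<close>
  define b where "b = sqrt (c / 2)"
  have b: "b > 0" using c by (simp add: b_def)
  \<comment> \<open>The numerators grow like \<open>t\<close> and \<open>sqrt t\<close>, the
    denominators at least like \<open>(b * sqrt t) ^ 3\<close> and \<open>(b * sqrt t) ^ 2\<close>;
    both quotients are multiples of \<open>1 / sqrt t\<close>.\<close>
  define K3 where "K3 = 27 * (chain_const3 k m * 2 ^ CARD('n)) / b ^ 3"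
  define K4 where "K4 = 54 * sqrt (chain_const4 k m * 2 ^ CARD('n)) / b\<^sup>2"
  have cc: "0 \<le> chain_const3 k m" "0 \<le> chain_const4 k m"
    by (simp_all add: chain_const2_def chain_const3_def chain_const4_def)
  have K: "0 \<le> K3" "0 \<le> K4" unfolding K3_def K4_def using cc b by auto
  have half: "c / 2 < c" using c(1) by simp
  \<comment> \<open>The summand 1 secures a positive constant, as \<open>K3\<close> and
    \<open>K4\<close> are only shown to be nonnegative.\<close>
  have bound: "\<forall>\<^sub>F t in at_top. wasserstein (distr M borel (standardize M (cliques k t))) std_normal_distribution
      \<le> ennreal ((K3 + K4 + 1) * t powr (- 1 / 2))"
    using order_tendstoD(1)[OF c(2) half] eventually_gt_at_top[of 0]
  proof eventually_elim
    case (elim t)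
    then have t: "0 < t" and Vt: "c / 2 * t < ?V t" by (auto simp: pos_less_divide_eq)
    have "0 < c / 2 * t" using c t by simp
    then have Vpos: "0 < ?V t" using Vt by linarith
    define \<sigma> where "\<sigma> = sqrt (?V t)"
    define u where "u = sqrt t"
    have u: "0 < u" "u\<^sup>2 = t" using t by (simp_all add: u_def)
    have \<sigma>: "b * u \<le> \<sigma>"
      unfolding b_def u_def \<sigma>_def real_sqrt_mult[symmetric] using Vt by (intro real_sqrt_le_mono) simp
    have bu: "0 < b * u" using b u by simp
    then have \<sigma>pos: "0 < \<sigma>" using \<sigma> by linarith
    have 1: "27 * (chain_const3 k m * (2 ^ CARD('n) * t)) / \<sigma> ^ 3 \<le> K3 / u"
    proof -
      have "27 * (chain_const3 k m * (2 ^ CARD('n) * t)) / \<sigma> ^ 3 \<le> 27 * (chain_const3 k m * (2 ^ CARD('n) * t)) / (b * u) ^ 3"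
      proof (rule divide_left_mono)
        show "(b * u) ^ 3 \<le> \<sigma> ^ 3" by (rule power_mono[OF \<sigma> less_imp_le[OF bu]])
        show "0 \<le> 27 * (chain_const3 k m * (2 ^ CARD('n) * t))" using cc t by simp
        show "0 < \<sigma> ^ 3 * (b * u) ^ 3" by (rule mult_pos_pos[OF zero_less_power[OF \<sigma>pos] zero_less_power[OF bu]])
      qed
      also have "\<dots> = K3 / u"
        unfolding K3_def u(2)[symmetric] using u(1) b by (simp add: power_mult_distrib power2_eq_square power3_eq_cube)
      finally show ?thesis .
    qed
    have 2: "54 * sqrt (chain_const4 k m * (2 ^ CARD('n) * t)) / \<sigma>\<^sup>2 \<le> K4 / u"
    proof -
      have "54 * sqrt (chain_const4 k m * (2 ^ CARD('n) * t)) / \<sigma>\<^sup>2 \<le> 54 * sqrt (chain_const4 k m * (2 ^ CARD('n) * t)) / (b * u)\<^sup>2"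
      proof (rule divide_left_mono)
        show "(b * u) ^ 2 \<le> \<sigma> ^ 2" by (rule power_mono[OF \<sigma> less_imp_le[OF bu]])
        show "0 \<le> 54 * sqrt (chain_const4 k m * (2 ^ CARD('n) * t))" using cc t by simp
        show "0 < \<sigma> ^ 2 * (b * u) ^ 2" by (rule mult_pos_pos[OF zero_less_power[OF \<sigma>pos] zero_less_power[OF bu]])
      qed
      also have "\<dots> = 54 * (sqrt (chain_const4 k m * 2 ^ CARD('n)) * u) / (b * u)\<^sup>2"
        unfolding u_def by (simp add: real_sqrt_mult)
      also have "\<dots> = K4 / u"
        unfolding K4_def using u(1) b by (simp add: power_mult_distrib power2_eq_square)
      finally show ?thesis .
    qed
    have tu: "t powr (- 1 / 2) = 1 / u"
      unfolding u_def using t by (simp add: powr_minus_divide powr_half_sqrt[symmetric])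
    have "stein_const k t \<sigma> \<le> (K3 + K4) / u"
      unfolding stein_const_def using 1 2 by (simp add: add_divide_distrib)
    also have "\<dots> \<le> (K3 + K4 + 1) * t powr (- 1 / 2)"
      unfolding tu using u(1) by (simp add: divide_right_mono)
    finally have "ennreal (stein_const k t \<sigma>) \<le> ennreal ((K3 + K4 + 1) * t powr (- 1 / 2))"
      by (rule ennreal_leI)
    with wasserstein_le[OF t k Vpos] show ?case unfolding \<sigma>_def by (rule order_trans)
  qed
  have "((\<lambda>t. ?V t / t / c) \<longlongrightarrow> c / c) at_top"
    using c by (intro tendsto_divide tendsto_const) auto
  then have "((\<lambda>t. ?V t / (c * t)) \<longlongrightarrow> 1) at_top"
    using c by (simp add: mult.commute)
  then have "?V \<sim>[at_top] (\<lambda>t. c * t)"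
    by (rule asymp_equivI')
  with bound c(1) K show "\<exists>c>0. \<exists>C>0.
           (\<lambda>t. var M (\<lambda>\<omega>. real (num_cliques k t (\<eta> \<omega>)))) \<sim>[at_top] (\<lambda>t::real. c * t) \<and>
           (\<forall>\<^sub>F t in at_top.
              wasserstein
                (distr M borel (standardize M (\<lambda>\<omega>. real (num_cliques k t (\<eta> \<omega>)))))
                std_normal_distribution
              \<le> ennreal (C * t powr (- 1 / 2)))"
    by (intro exI[of _ c] exI[of _ "K3 + K4 + 1"] conjI) auto
qed

end
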